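(* Let $\Omega\subset\mathbb{R}^N$ ($N\ge 2$) be a bounded smooth domain, $0<s<1<p<\infty$, and let $\omega\in L^r(\Omega)\setminus\{0\}$, $\omega\ge0$, with $r>\max\{1,\frac{N}{sp}\}$. Let $$\lambda_\alpha:=\min\Big\{[v]_{s,p}^p: v\in W_0^{s,p}(\Omega),\int_\Omega|v|^{1-\alpha}\omega\,dx=1\Big\},\qquad \mu:=\lim_{\alpha\to1^-}\lambda_\alpha\|\omega\|_1^{\frac{p}{1-\alpha}},$$ suppose that $\mu<\infty$, and let $V$ be the unique nonnegative minimizer of $v\mapsto[v]_{s,p}^p$ on $$\mathcal{M}:=\Big\{v\in W_0^{s,p}(\Omega):\int_\Omega(\log|v|)\,\omega\,dx=0\Big\}.$$ Then $V$ is the weak solution of the singular problem $$(-\Delta_p)^s u=\frac{\mu}{\|\omega\|_1}\,\frac{\omega}{u}\ \text{ in }\Omega,\qquad u=0\ \text{ on }\mathbb{R}^N\setminus\Omega.$$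
   Context: Gagliardo semi-norm: $[u]_{s,p}:=\left(\iint_{\mathbb{R}^{2N}}\frac{|u(x)-u(y)|^p}{|x-y|^{N+sp}}\,dx\,dy\right)^{1/p}$. $W_0^{s,p}(\Omega)$ is the completion of $C_c^\infty(\Omega)$ with respect to $([u]_{s,p}^p+\|u\|_p^p)^{1/p}$; equivalently $W_0^{s,p}(\Omega)=\{u\in L^p(\mathbb{R}^N):[u]_{s,p}<\infty,\ u=0 \text{ in }\mathbb{R}^N\setminus\Omega\}$, normed by $[\cdot]_{s,p}$. $\|\cdot\|_1$ is the $L^1(\Omega)$ norm. Pairing: $\langle(-\Delta_p)^s u,v\rangle:=\iint_{\mathbb{R}^{2N}}\frac{|u(x)-u(y)|^{p-2}(u(x)-u(y))(v(x)-v(y))}{|x-y|^{N+sp}}\,dx\,dy$ for $u,v\in W_0^{s,p}(\Omega)$. Weak solution: $u\in W_0^{s,p}(\Omega)$ is a weak solution of the singular problem $(-\Delta_p)^s u=\frac{\mu}{\|\omega\|_1}\frac{\omega}{u}$ in $\Omega$, $u=0$ on $\mathbb{R}^N\setminus\Omega$, if (i) for each subdomain $\Omega'$ compactly contained in $\Omega$ there is a constant $C_{\Omega'}>0$ with $u\ge C_{\Omega'}$ a.e. in $\Omega'$; and (ii) $\langle(-\Delta_p)^s u,\varphi\rangle=\frac{\mu}{\|\omega\|_1}\int_\Omega\frac{\omega\varphi}{u}\,dx$ for all $\varphi\in C_c^\infty(\Omega)$. Weak solutions of this problem are unique. Exponents: $p_s^\star:=\frac{Np}{N-sp}$ if $N>sp$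 and $p_s^\star:=\infty$ if $N\le sp$; $t':=t/(t-1)$. For $0<\alpha<1$: $r_\alpha:=\left(\frac{p_s^\star}{1-\alpha}\right)'$ if $sp<N$, and $r_\alpha:=\alpha^{-1}$ if $sp\ge N$. The minimum $\lambda_\alpha$ exists whenever $r\ge r_\alpha$, in particular for all $\alpha$ in some interval $[\alpha_0,1)$, on which $\alpha\mapsto\lambda_\alpha\|\omega\|_1^{p/(1-\alpha)}$ is nondecreasing, so the limit $\mu$ exists in $(0,\infty]$. When $\mu<\infty$, the functional $v\mapsto[v]_{s,p}^p$ attains its minimum on $\mathcal{M}$ at exactly two functions $V\ge0$ and $-V$. *)

theory Defs
  imports "HOL-Analysis.Analysis"
begin

text \<open>
  The ambient space \<open>\<real>\<^sup>N\<close> is a type \<open>'a::euclidean_space\<close> with \<open>N = DIM('a)\<close>. Functions are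
  Lebesgue measurable representatives; all conditions on them are insensitive to changes on
  null sets.
\<close>

section \<open>Smooth functions, test functions, smooth bounded domains\<close>

text \<open>
  Intended for open \<open>U\<close>: \<open>f\<close> is \<open>C\<^sup>k\<^sup>+\<^sup>1\<close> iff it is differentiable and all of its directional
  derivatives are \<open>C\<^sup>k\<close>.
\<close>

primrec Ck_on :: "nat \<Rightarrow> 'a::euclidean_space set \<Rightarrow> ('a \<Rightarrow> real) \<Rightarrow> bool" where
  "Ck_on 0 U f \<longleftrightarrow> continuous_on U f"
| "Ck_on (Suc k) U f \<longleftrightarrow>
     (\<forall>x\<in>U. f differentiable (at x)) \<and> (\<forall>v. Ck_on k U (\<lambda>x. frechet_derivative f (at x) v))"

definition smooth_on :: "'a::euclidean_space set \<Rightarrow> ('a \<Rightarrow> real) \<Rightarrow> bool" where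
  "smooth_on U f \<longleftrightarrow> (\<forall>k. Ck_on k U f)"

definition test_functions :: "'a::euclidean_space set \<Rightarrow> ('a \<Rightarrow> real) set" where
  "test_functions \<Omega> =
     {\<phi>. smooth_on UNIV \<phi> \<and> compact (closure {x. \<phi> x \<noteq> 0}) \<and> closure {x. \<phi> x \<noteq> 0} \<subseteq> \<Omega>}"

definition domain :: "'a::euclidean_space set \<Rightarrow> bool" where
  "domain \<Omega> \<longleftrightarrow> open \<Omega> \<and> connected \<Omega> \<and> \<Omega> \<noteq> {}"

text \<open>
  Near each boundary point the domain is the strict epigraph, in some unit direction \<open>e\<close>, of a
  smooth function \<open>\<gamma>\<close> of the component \<open>x - (x \<bullet> e) e\<close> of \<open>x\<close> orthogonal to \<open>e\<close>.
\<close>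

definition smooth_bounded_domain :: "'a::euclidean_space set \<Rightarrow> bool" where
  "smooth_bounded_domain \<Omega> \<longleftrightarrow>
     domain \<Omega> \<and> bounded \<Omega> \<and>
     (\<forall>x0\<in>frontier \<Omega>. \<exists>\<rho>>0. \<exists>e \<gamma>. norm e = 1 \<and> smooth_on UNIV \<gamma> \<and>
        \<Omega> \<inter> ball x0 \<rho> = {x \<in> ball x0 \<rho>. x \<bullet> e > \<gamma> (x - (x \<bullet> e) *\<^sub>R e)})"

section \<open>Lebesgue and fractional Sobolev spaces\<close>

definition Lp_space :: "real \<Rightarrow> 'a::euclidean_space set \<Rightarrow> ('a \<Rightarrow> real) set" where
  "Lp_space p A =
     {f. set_borel_measurable lebesgue A f \<and> set_integrable lebesgue A (\<lambda>x. \<bar>f x\<bar> powr p)}"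

definition Lp_norm :: "real \<Rightarrow> 'a::euclidean_space set \<Rightarrow> ('a \<Rightarrow> real) \<Rightarrow> real" where
  "Lp_norm p A f = (LINT x:A|lebesgue. \<bar>f x\<bar> powr p) powr (1 / p)"

definition gagliardo_integral :: "real \<Rightarrow> real \<Rightarrow> ('a::euclidean_space \<Rightarrow> real) \<Rightarrow> ennreal" where
  "gagliardo_integral s p u =
     (\<integral>\<^sup>+ (x, y). ennreal (\<bar>u x - u y\<bar> powr p / norm (x - y) powr (real DIM('a) + s * p))
        \<partial>(lebesgue :: ('a \<times> 'a) measure))"

text \<open>
  The real number below is the Gagliardo seminorm only if \<open>gagliardo_integral s p u\<close> is finite,
  which is part of membership in the Sobolev spaces.
\<close>

definition gagliardo :: "real \<Rightarrow> real \<Rightarrow> ('a::euclidean_space \<Rightarrow> real) \<Rightarrow> real" where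
  "gagliardo s p u = enn2real (gagliardo_integral s p u) powr (1 / p)"

definition Wsp :: "real \<Rightarrow> real \<Rightarrow> ('a::euclidean_space \<Rightarrow> real) set" where
  "Wsp s p = {u \<in> Lp_space p UNIV. gagliardo_integral s p u < \<infinity>}"

definition Wsp_norm :: "real \<Rightarrow> real \<Rightarrow> ('a::euclidean_space \<Rightarrow> real) \<Rightarrow> real" where
  "Wsp_norm s p u = (gagliardo s p u powr p + Lp_norm p UNIV u powr p) powr (1 / p)"

text \<open>
  The completion of the test functions with respect to \<open>Wsp_norm\<close>, realised as their closure in
  the Banach space \<open>Wsp\<close>. Elements vanish almost everywhere outside \<open>\<Omega>\<close>.
\<close>

definition W0sp :: "real \<Rightarrow> real \<Rightarrow> 'a::euclidean_space set \<Rightarrow> ('a \<Rightarrow> real) set" where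
  "W0sp s p \<Omega> = {u \<in> Wsp s p. \<exists>\<phi>. (\<forall>n::nat. \<phi> n \<in> test_functions \<Omega>) \<and>
     (\<lambda>n. Wsp_norm s p (\<lambda>x. \<phi> n x - u x)) \<longlonglongrightarrow> 0}"

section \<open>The fractional p-Laplacian and the singular problem\<close>

text \<open>
  Where \<open>u x = u y\<close> the integrand is \<open>0\<close>, also for \<open>p < 2\<close>, since \<open>0 powr a = 0\<close>.
\<close>

definition plap_pairing ::
  "real \<Rightarrow> real \<Rightarrow> ('a::euclidean_space \<Rightarrow> real) \<Rightarrow> ('a \<Rightarrow> real) \<Rightarrow> real" where
  "plap_pairing s p u v =
     (LINT (x, y)|(lebesgue :: ('a \<times> 'a) measure).
        \<bar>u x - u y\<bar> powr (p - 2) * (u x - u y) * (v x - v y)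
          / norm (x - y) powr (real DIM('a) + s * p))"

text \<open>
  The right-hand side of the integral identity is a convergent integral: by the lower bounds
  \<open>u\<close> is bounded away from \<open>0\<close> on the support of \<open>\<phi>\<close>. The boundary condition
  \<open>u = 0\<close> outside \<open>\<Omega>\<close> is contained in \<open>u \<in> W0sp s p \<Omega>\<close>.
\<close>

definition weak_solution ::
  "real \<Rightarrow> real \<Rightarrow> 'a::euclidean_space set \<Rightarrow> ('a \<Rightarrow> real) \<Rightarrow> real \<Rightarrow> ('a \<Rightarrow> real) \<Rightarrow> bool" where
  "weak_solution s p \<Omega> \<omega> \<mu> u \<longleftrightarrow>
     u \<in> W0sp s p \<Omega> \<and>
     (\<forall>\<Omega>'. domain \<Omega>' \<and> compact (closure \<Omega>') \<and> closure \<Omega>' \<subseteq> \<Omega> \<longrightarrow>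
        (\<exists>C>0. AE x\<in>\<Omega>' in lebesgue. u x \<ge> C)) \<and>
     (\<forall>\<phi>\<in>test_functions \<Omega>.
        plap_pairing s p u \<phi> = \<mu> / Lp_norm 1 \<Omega> \<omega> * (LINT x:\<Omega>|lebesgue. \<omega> x * \<phi> x / u x))"

section \<open>The variational problems\<close>

text \<open>
  The infimum is the minimum whenever the latter exists, in particular for all \<open>\<alpha> < 1\<close>
  close to \<open>1\<close>. A Bochner integral equal to \<open>1\<close> is necessarily convergent.
\<close>

definition lam ::
  "real \<Rightarrow> real \<Rightarrow> 'a::euclidean_space set \<Rightarrow> ('a \<Rightarrow> real) \<Rightarrow> real \<Rightarrow> real" where
  "lam s p \<Omega> \<omega> \<alpha> =
     (INF v \<in> {v \<in> W0sp s p \<Omega>. (LINT x:\<Omega>|lebesgue. \<bar>v x\<bar> powr (1 - \<alpha>) * \<omega> x) = 1}.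
        gagliardo s p v powr p)"

text \<open>
  With \<open>log 0 = -\<infinity>\<close> and \<open>(-\<infinity>) * 0 = 0\<close>, the integral of \<open>(log \<bar>v\<bar>) \<omega>\<close> is a real number only if
  \<open>v \<noteq> 0\<close> almost everywhere where \<open>\<omega> \<noteq> 0\<close>. Both this and integrability are stated explicitly,
  because \<open>ln 0 = 0\<close> and the Bochner integral of a non-integrable function is \<open>0\<close>.
\<close>

definition log_constraint ::
  "real \<Rightarrow> real \<Rightarrow> 'a::euclidean_space set \<Rightarrow> ('a \<Rightarrow> real) \<Rightarrow> ('a \<Rightarrow> real) set" where
  "log_constraint s p \<Omega> \<omega> = {v \<in> W0sp s p \<Omega>.
     (AE x\<in>\<Omega> in lebesgue. \<omega> x \<noteq> 0 \<longrightarrow> v x \<noteq> 0) \<and>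
     set_integrable lebesgue \<Omega> (\<lambda>x. ln \<bar>v x\<bar> * \<omega> x) \<and>
     (LINT x:\<Omega>|lebesgue. ln \<bar>v x\<bar> * \<omega> x) = 0}"

end

theory Submission
  imports Defs
begin

text \<open>
  Let \<open>W\<close> be the integral of \<open>\<omega>\<close> and \<open>E\<close> the energy \<open>[V]\<^sup>p\<close>. For \<open>\<phi> \<ge> 0\<close>, rescaling \<open>V + t \<phi>\<close> into
  the constraint and letting \<open>t \<rightarrow> 0\<close> gives
  \<open>\<langle>A V, \<phi>\<rangle> \<ge> (E / W) \<integral> \<omega> \<phi> / V\<close>, where \<open>A\<close> is the fractional p-Laplacian. In particular \<open>V\<close> is a
  nonnegative nontrivial supersolution, so a nonlocal De Giorgi iteration bounds it below on compact
  subsets of \<open>\<Omega>\<close>. The inequality is an equality for \<open>\<phi> = V\<close>; applied to \<open>K V \<plusminus> \<phi> \<ge> 0\<close> it becomes an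
  equality for every test function \<open>\<phi>\<close>. Its convexity form together with Young's inequality bounds
  \<open>[v]\<^sup>p\<close> from below for the competitors \<open>v\<close> in the definition of \<open>\<lambda>\<^sub>\<alpha>\<close>, and yields \<open>\<mu> = E\<close>.
  For uniqueness, the weak formulation extends from test functions to the whole Sobolev space, and
  the difference of two solutions is an admissible test function for the monotone operator \<open>A\<close>.
\<close>

section \<open>Smooth functions and test functions\<close>

text \<open>The logarithm is singular where \<open>V\<close> vanishes, and nothing bounds
  \<open>V\<close> from below at first, so the constraint cannot be differentiated in an arbitrary
  direction. Nonnegative directions only increase the logarithm; for them Fatou's lemma yields half
  of the Euler-Lagrange equation, and this half is all that the minimum principle asks for. The
  direction \<open>V\<close> loses nothing, because the weighted integral of \<open>V / V\<close> is
  the total weight and the pairing of \<open>V\<close> with itself is the energy. The lower bound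
  then dominates each test function by a multiple of \<open>V\<close>, which is what lets that
  single equality spread. For the limit, put \<open>q = 1 - \<alpha>\<close>. Normalising
  \<open>V\<close> gives the upper bound, since \<open>1 + q * ln V \<le> V powr q\<close>. The
  lower bound falls short only by a multiple of the integral of \<open>(V powr t - 1) / t\<close>,
  which tends to the vanishing integral of \<open>ln V\<close>. The quantitative input comes from
  the kernel itself: its mass on a set at bounded distance gives the Poincare inequality and the
  start of the iteration, its mass off a small set gives the gain, and integrability against
  \<open>\<omega>\<close> is Hoelder's inequality with \<open>u\<close> in the \<open>p\<close>-th
  Lebesgue space.\<close>

lemma Ck_on_SucI:
  assumes "\<And>x. (f has_derivative D x) (at x)" "\<And>v. Ck_on k UNIV (\<lambda>x. D x v)"
  shows "Ck_on (Suc k) UNIV f"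
proof -
  have "frechet_derivative f (at x) = D x" for x
    using frechet_derivative_at[OF assms(1)] by simp
  then show ?thesis
    using assms by (auto simp: differentiable_def)
qed

lemma Ck_on_SucD:
  assumes "Ck_on (Suc k) UNIV f"
  shows "(f has_derivative frechet_derivative f (at x)) (at x)"
    and "Ck_on k UNIV (\<lambda>x. frechet_derivative f (at x) v)"
  using assms by (auto simp: frechet_derivative_works)

lemma Ck_on_pred: "Ck_on (Suc k) UNIV f \<Longrightarrow> Ck_on k UNIV f"
proof (induction k arbitrary: f)
  case 0
  then show ?case
    using differentiable_imp_continuous_on[of f UNIV]
    by (auto simp: differentiable_on_def differentiable_at_withinI)
next
  case (Suc k)
  then show ?case by simp
qed

lemma Ck_on_continuous: "Ck_on k UNIV f \<Longrightarrow> continuous_on UNIV f"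
proof (induction k)
  case (Suc k)
  then show ?case using Ck_on_pred by blast
qed simp

lemma Ck_on_const: "Ck_on k UNIV (\<lambda>x. c)"
proof (induction k arbitrary: c)
  case (Suc k)
  show ?case by (rule Ck_on_SucI[where D="\<lambda>x v. 0"]) (auto intro: Suc)
qed simp

lemma Ck_on_add: "Ck_on k UNIV f \<Longrightarrow> Ck_on k UNIV g \<Longrightarrow> Ck_on k UNIV (\<lambda>x. f x + g x)"
proof (induction k arbitrary: f g)
  case 0
  then show ?case by (auto intro: continuous_intros)
next
  case (Suc k)
  show ?case
    by (rule Ck_on_SucI[OF has_derivative_add[OF Ck_on_SucD(1)[OF Suc.prems(1)]
          Ck_on_SucD(1)[OF Suc.prems(2)]]])
      (intro Suc.IH Ck_on_SucD(2)[OF Suc.prems(1)] Ck_on_SucD(2)[OF Suc.prems(2)])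
qed

lemma Ck_on_mult: "Ck_on k UNIV f \<Longrightarrow> Ck_on k UNIV g \<Longrightarrow> Ck_on k UNIV (\<lambda>x. f x * g x)"
proof (induction k arbitrary: f g)
  case 0
  then show ?case by (auto intro: continuous_intros)
next
  case (Suc k)
  show ?case
    by (rule Ck_on_SucI[OF has_derivative_mult[OF Ck_on_SucD(1)[OF Suc.prems(1)]
          Ck_on_SucD(1)[OF Suc.prems(2)]]])
      (intro Ck_on_add Suc.IH Ck_on_pred[OF Suc.prems(1)] Ck_on_pred[OF Suc.prems(2)]
        Ck_on_SucD(2)[OF Suc.prems(1)] Ck_on_SucD(2)[OF Suc.prems(2)])
qed

text \<open>Smoothness of a composition needs all derivatives of the outer function. A family
  \<open>h\<close> closed under differentiation through \<open>D\<close> supplies them at once, and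
  the induction treats all indices \<open>i\<close> together, because the derivative of
  \<open>h i\<close> at \<open>f x\<close> involves \<open>h (D i)\<close>.\<close>

lemma Ck_on_compose:
  fixes h :: "'i \<Rightarrow> real \<Rightarrow> real"
  assumes h: "\<And>i t. t \<in> T \<Longrightarrow> (h i has_real_derivative h (D i) t) (at t)"
    and f: "\<And>x. f x \<in> T"
  shows "Ck_on k UNIV f \<Longrightarrow> Ck_on k UNIV (\<lambda>x. h i (f x))"
proof (induction k arbitrary: i)
  case 0
  have "isCont (h i) (f x)" for x
    using h[OF f] by (rule DERIV_isCont)
  moreover have "isCont f x" for x
    using 0 by (simp add: continuous_on_eq_continuous_at)
  ultimately show ?case
    by (auto simp: continuous_on_eq_continuous_at intro: isCont_o2)
next
  case (Suc k)
  show ?case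
    by (rule Ck_on_SucI[OF DERIV_compose_FDERIV[OF h[OF f] Ck_on_SucD(1)[OF Suc.prems(1)]]])
      (intro Ck_on_mult Ck_on_SucD(2)[OF Suc.prems(1)] Suc.IH Ck_on_pred[OF Suc.prems(1)])
qed

lemma smooth_on_const: "smooth_on UNIV (\<lambda>x. c)"
  and smooth_on_add: "smooth_on UNIV f \<Longrightarrow> smooth_on UNIV g \<Longrightarrow> smooth_on UNIV (\<lambda>x. f x + g x)"
  and smooth_on_mult: "smooth_on UNIV f \<Longrightarrow> smooth_on UNIV g \<Longrightarrow> smooth_on UNIV (\<lambda>x. f x * g x)"
  by (auto simp: smooth_on_def Ck_on_const Ck_on_add Ck_on_mult)

lemma smooth_on_inner: "smooth_on UNIV (\<lambda>x. x \<bullet> v)"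
proof -
  have "Ck_on k UNIV (\<lambda>x. x \<bullet> v)" for k
  proof (cases k)
    case (Suc k')
    show ?thesis unfolding Suc
      by (rule Ck_on_SucI[where D="\<lambda>x h. h \<bullet> v"]) (auto intro!: derivative_eq_intros Ck_on_const)
  qed (auto intro: continuous_intros)
  then show ?thesis by (simp add: smooth_on_def)
qed

lemma smooth_on_sum:
  "finite I \<Longrightarrow> (\<And>i. i \<in> I \<Longrightarrow> smooth_on UNIV (f i)) \<Longrightarrow> smooth_on UNIV (\<lambda>x. \<Sum>i\<in>I. f i x)"
  by (induction I rule: finite_induct) (auto intro: smooth_on_const smooth_on_add)

lemma smooth_on_norm_sq:
  fixes x0 :: "'a::euclidean_space"
  shows "smooth_on UNIV (\<lambda>x. (norm (x - x0))\<^sup>2)"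
proof -
  have "(norm (x - x0))\<^sup>2 = (\<Sum>b\<in>Basis. (x \<bullet> b + - (x0 \<bullet> b)) * (x \<bullet> b + - (x0 \<bullet> b)))" for x
    unfolding power2_norm_eq_inner by (subst euclidean_inner) (simp add: inner_diff_left)
  then show ?thesis
    by (simp only:) (intro smooth_on_sum smooth_on_mult smooth_on_add smooth_on_inner smooth_on_const
        finite_Basis)
qed

lemma smooth_on_powr:
  assumes "smooth_on UNIV f" "\<And>x. 0 < f x"
  shows "smooth_on UNIV (\<lambda>x. f x powr a)"
proof -
  \<comment> \<open>The index is the pair of coefficient and exponent; on the positive axis this
    family is closed under differentiation.\<close>
  define h where "h i t = fst i * t powr snd i" for i :: "real \<times> real" and t
  have "(h i has_real_derivative h (fst i * snd i, snd i - 1) t) (at t)" if "t \<in> {0<..}" for i t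
  proof -
    have "((\<lambda>t. fst i * t powr snd i) has_real_derivative fst i * (snd i * t powr (snd i - 1))) (at t)"
      using that by (intro DERIV_cmult has_real_derivative_powr) simp
    moreover have "h i = (\<lambda>t. fst i * t powr snd i)"
      by (rule ext) (simp add: h_def)
    ultimately show ?thesis by (simp add: h_def mult.assoc)
  qed
  then have "Ck_on k UNIV (\<lambda>x. h (1, a) (f x))" for k
    by (rule Ck_on_compose[where T="{0<..}" and f=f and h=h and
          D="\<lambda>i. (fst i * snd i, snd i - 1)"]) (use assms in \<open>simp_all add: smooth_on_def\<close>)
  then show ?thesis by (simp add: smooth_on_def h_def)
qed

text \<open>The free power \<open>s ^ m\<close> absorbs the shift of degree in the recursion on the
  coefficients of \<open>q\<close>. With \<open>s = 1 / h\<close> the limit says that the bump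
  profile is flat at \<open>0\<close>.\<close>

lemma poly_exp_tendsto_0:
  fixes q :: "real poly"
  shows "((\<lambda>s. s ^ m * poly q s * exp (- s)) \<longlongrightarrow> 0) at_top"
proof (induction q arbitrary: m)
  case 0
  then show ?case by simp
next
  case (pCons a q)
  have "((\<lambda>s::real. a * (s ^ m / exp s) + s ^ Suc m * poly q s * exp (- s)) \<longlongrightarrow> a * 0 + 0) at_top"
    by (rule tendsto_add[OF tendsto_mult[OF tendsto_const tendsto_power_div_exp_0] pCons.IH])
  then show ?case by (simp add: exp_minus divide_inverse ring_distribs mult_ac)
qed

text \<open>The functions \<open>q(1/t) exp(-1/t)\<close> with a polynomial \<open>q\<close>,
  extended by \<open>0\<close>, are closed under differentiation: for \<open>w = 1/t\<close> the
  derivative is \<open>w^2 (q(w) - q'(w)) exp(-w)\<close>. The factor \<open>[:0, 0, 1:]\<close> in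
  the index map is the square of the variable.\<close>

lemma smooth_on_bump:
  assumes "smooth_on UNIV f"
  shows "smooth_on UNIV (\<lambda>x. if f x > 0 then exp (- (1 / f x)) else 0)"
proof -
  define b where "b q t = (if t > 0 then poly q (1 / t) * exp (- (1 / t)) else 0)"
    for q and t :: real
  have der: "(b q has_real_derivative b ([:0, 0, 1:] * (q - pderiv q)) t) (at t)" for q t
  proof (rule linorder_cases[of t 0])
    assume t: "t > 0"
    define w where "w = 1 / t"
    have d: "((\<lambda>t. 1 / t) has_real_derivative - w\<^sup>2) (at t)"
      using t by (auto intro!: derivative_eq_intros simp: w_def power2_eq_square)
    have d1: "((\<lambda>t. poly q (1 / t)) has_real_derivative poly (pderiv q) w * (- w\<^sup>2)) (at t)"
      unfolding w_def by (rule DERIV_chain2[OF poly_DERIV d[unfolded w_def]])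
    have d2: "((\<lambda>t. exp (- (1 / t))) has_real_derivative exp (- w) * (- (- w\<^sup>2))) (at t)"
      unfolding w_def by (rule DERIV_chain2[OF DERIV_exp DERIV_minus[OF d[unfolded w_def]]])
    have "((\<lambda>t. poly q (1 / t) * exp (- (1 / t))) has_real_derivative
        poly q w * (exp (- w) * (- (- w\<^sup>2))) + poly (pderiv q) w * (- w\<^sup>2) * exp (- w)) (at t)"
      using DERIV_mult'[OF d1 d2] by (simp only: w_def)
    also have "poly q w * (exp (- w) * (- (- w\<^sup>2))) + poly (pderiv q) w * (- w\<^sup>2) * exp (- w)
        = b ([:0, 0, 1:] * (q - pderiv q)) t"
    proof -
      have "b ([:0, 0, 1:] * (q - pderiv q)) t = (w * (w * (poly q w - poly (pderiv q) w))) * exp (- w)"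
        using t by (simp add: b_def w_def)
      then show ?thesis by (simp add: power2_eq_square algebra_simps)
    qed
    finally have D: "((\<lambda>t. poly q (1 / t) * exp (- (1 / t))) has_real_derivative
        b ([:0, 0, 1:] * (q - pderiv q)) t) (at t)" .
    have "eventually (\<lambda>t. t \<in> {0<..}) (nhds t)"
      using t by (intro eventually_nhds_in_open) auto
    then have "eventually (\<lambda>t. b q t = poly q (1 / t) * exp (- (1 / t))) (nhds t)"
      by eventually_elim (simp add: b_def)
    from DERIV_cong_ev[OF refl this refl, THEN iffD2, OF D] show ?thesis .
  next
    assume t: "t < 0"
    then have "eventually (\<lambda>t. t \<in> {..<0}) (nhds t)"
      by (intro eventually_nhds_in_open) auto
    then have ev: "eventually (\<lambda>t. b q t = 0) (nhds t)"
      by eventually_elim (simp add: b_def)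
    have "((\<lambda>t. 0) has_real_derivative b ([:0, 0, 1:] * (q - pderiv q)) t) (at t)"
      using t by (simp add: b_def)
    from DERIV_cong_ev[OF refl ev refl, THEN iffD2, OF this] show ?thesis .
  next
    assume t: "t = 0"
    \<comment> \<open>The quotient from the right is the profile with one more factor
      \<open>1 / h\<close>, so the exponential still wins.\<close>
    have "((\<lambda>h. b q h / h) \<longlongrightarrow> 0) (at_right 0)"
    proof -
      have "((\<lambda>s. s ^ 1 * poly q s * exp (- s)) \<longlongrightarrow> 0) at_top" by (rule poly_exp_tendsto_0)
      then have "((\<lambda>h::real. (inverse h) ^ 1 * poly q (inverse h) * exp (- (inverse h))) \<longlongrightarrow> 0) (at_right 0)"
        by (rule filterlim_compose) (rule filterlim_inverse_at_top_right)
      moreover have "eventually (\<lambda>h::real. (inverse h) ^ 1 * poly q (inverse h) * exp (- (inverse h)) = b q h / h) (at_right 0)"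
        by (rule eventually_at_right_less[THEN eventually_mono]) (simp add: b_def field_simps)
      ultimately show ?thesis by (rule Lim_transform_eventually)
    qed
    moreover have "((\<lambda>h. b q h / h) \<longlongrightarrow> 0) (at_left 0)"
    proof (rule Lim_transform_eventually[OF tendsto_const])
      show "eventually (\<lambda>h. 0 = b q h / h) (at_left 0)"
        by (auto simp: eventually_at_filter b_def)
    qed
    ultimately have "((\<lambda>h. b q h / h) \<longlongrightarrow> 0) (at 0)"
      by (simp add: filterlim_split_at)
    then show ?thesis using t by (simp add: DERIV_def b_def)
  qed
  have "Ck_on k UNIV (\<lambda>x. b 1 (f x))" for k
    by (rule Ck_on_compose[where T=UNIV and f=f and h=b and D="\<lambda>q. [:0, 0, 1:] * (q - pderiv q)"])
      (use assms der in \<open>simp_all add: smooth_on_def\<close>)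
  then have "smooth_on UNIV (\<lambda>x. b 1 (f x))" by (simp add: smooth_on_def)
  moreover have "(\<lambda>x. b 1 (f x)) = (\<lambda>x. if f x > 0 then exp (- (1 / f x)) else 0)"
    by (simp add: b_def fun_eq_iff)
  ultimately show ?thesis by simp
qed

lemma test_functionsI:
  assumes "smooth_on UNIV f" "compact K" "K \<subseteq> \<Omega>" "\<And>x. f x \<noteq> 0 \<Longrightarrow> x \<in> K"
  shows "f \<in> test_functions \<Omega>"
proof -
  have "closure {x. f x \<noteq> 0} \<subseteq> K"
    using assms by (intro closure_minimal) (auto simp: compact_imp_closed)
  then show ?thesis
    using assms compact_Int_closed[of K "closure {x. f x \<noteq> 0}"]
    by (simp add: test_functions_def Int_absorb1 subset_trans[of _ K])
qed

lemma test_functionsE: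
  assumes "f \<in> test_functions \<Omega>"
  shows "\<exists>K. compact K \<and> K \<subseteq> \<Omega> \<and> (\<forall>x. f x \<noteq> 0 \<longrightarrow> x \<in> K)"
proof (intro exI conjI)
  show "compact (closure {x. f x \<noteq> 0})" "closure {x. f x \<noteq> 0} \<subseteq> \<Omega>"
    using assms by (auto simp: test_functions_def)
  show "\<forall>x. f x \<noteq> 0 \<longrightarrow> x \<in> closure {x. f x \<noteq> 0}"
    by (simp add: subsetD[OF closure_subset])
qed

lemma test_functions_smooth: "f \<in> test_functions \<Omega> \<Longrightarrow> smooth_on UNIV f"
  by (simp add: test_functions_def)

lemma test_functions_continuous: "f \<in> test_functions \<Omega> \<Longrightarrow> continuous_on UNIV f"
  using test_functions_smooth[of f \<Omega>] Ck_on_continuous[of 0 f] by (auto simp: smooth_on_def)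

lemma test_functions_add:
  assumes "f \<in> test_functions \<Omega>" "g \<in> test_functions \<Omega>"
  shows "(\<lambda>x. f x + g x) \<in> test_functions \<Omega>"
proof -
  obtain K where K: "compact K" "K \<subseteq> \<Omega>" "\<forall>x. f x \<noteq> 0 \<longrightarrow> x \<in> K" using test_functionsE[OF assms(1)] by blast
  obtain L where L: "compact L" "L \<subseteq> \<Omega>" "\<forall>x. g x \<noteq> 0 \<longrightarrow> x \<in> L" using test_functionsE[OF assms(2)] by blast
  show ?thesis
    using K L assms
    by (intro test_functionsI[of _ "K \<union> L"] smooth_on_add) (auto simp: test_functions_smooth, force)
qed

lemma test_functions_scale:
  assumes "f \<in> test_functions \<Omega>"
  shows "(\<lambda>x. c * f x) \<in> test_functions \<Omega>"
proof -
  obtain K where "compact K" "K \<subseteq> \<Omega>" "\<forall>x. f x \<noteq> 0 \<longrightarrow> x \<in> K" using test_functionsE[OF assms] by blast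
  then show ?thesis
    using assms by (intro test_functionsI[of _ K] smooth_on_mult smooth_on_const)
      (auto simp: test_functions_smooth)
qed

lemma test_functions_diff:
  assumes "f \<in> test_functions \<Omega>" "g \<in> test_functions \<Omega>"
  shows "(\<lambda>x. f x - g x) \<in> test_functions \<Omega>"
  using test_functions_add[OF assms(1) test_functions_scale[OF assms(2), of "-1"]] by simp

text \<open>A smooth regularisation of \<open>\<bar>t - l\<bar> - \<bar>l\<bar>\<close>, applied to
  \<open>f\<close>. The subtracted constant makes it vanish at \<open>t = 0\<close>, so the support
  does not grow.\<close>

lemma test_functions_sqrt:
  assumes "f \<in> test_functions \<Omega>" "e > 0"
  shows "(\<lambda>x. sqrt ((f x - l)\<^sup>2 + e\<^sup>2) - sqrt (l\<^sup>2 + e\<^sup>2)) \<in> test_functions \<Omega>"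
proof -
  obtain K where K: "compact K" "K \<subseteq> \<Omega>" "\<forall>x. f x \<noteq> 0 \<longrightarrow> x \<in> K" using test_functionsE[OF assms(1)] by blast
  have pos: "0 < (t - l) * (t - l) + e\<^sup>2" for t
    using assms(2) by (intro add_nonneg_pos) auto
  have "smooth_on UNIV (\<lambda>x. ((f x + - l) * (f x + - l) + e\<^sup>2) powr (1/2) + - sqrt (l\<^sup>2 + e\<^sup>2))"
    using assms pos by (intro smooth_on_add smooth_on_powr smooth_on_mult smooth_on_const)
      (auto simp: test_functions_smooth)
  moreover have "(\<lambda>x. ((f x + - l) * (f x + - l) + e\<^sup>2) powr (1/2) + - sqrt (l\<^sup>2 + e\<^sup>2))
      = (\<lambda>x. sqrt ((f x - l)\<^sup>2 + e\<^sup>2) - sqrt (l\<^sup>2 + e\<^sup>2))"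
    using pos by (simp add: powr_half_sqrt power2_eq_square less_imp_le)
  ultimately have "smooth_on UNIV (\<lambda>x. sqrt ((f x - l)\<^sup>2 + e\<^sup>2) - sqrt (l\<^sup>2 + e\<^sup>2))"
    by (simp only:)
  moreover have "x \<in> K" if "sqrt ((f x - l)\<^sup>2 + e\<^sup>2) - sqrt (l\<^sup>2 + e\<^sup>2) \<noteq> 0" for x
  proof -
    have "f x \<noteq> 0" using that by (intro notI) simp
    then show ?thesis using K(3) by blast
  qed
  ultimately show ?thesis
    using K(1,2) by (intro test_functionsI[of _ K])
qed

lemma test_functions_bounded:
  assumes "f \<in> test_functions \<Omega>"
  obtains M where "M > 0" "\<And>x. \<bar>f x\<bar> \<le> M"
proof -
  obtain K where K: "compact K" "\<forall>x. f x \<noteq> 0 \<longrightarrow> x \<in> K" using test_functionsE[OF assms] by blast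
  have "compact (f ` K)"
    using K test_functions_continuous[OF assms] by (intro compact_continuous_image) (auto intro: continuous_on_subset)
  then obtain M where M: "M > 0" "\<And>x. x \<in> K \<Longrightarrow> \<bar>f x\<bar> \<le> M"
    by (auto dest!: compact_imp_bounded simp: bounded_pos)
  then have "\<bar>f x\<bar> \<le> M" for x using K(2) M(1) by (cases "f x = 0") auto
  then show ?thesis using that M by blast
qed

text \<open>\<open>Ck_on\<close> gives continuity of one directional derivative at a time, so the
  operator norm is bounded through the finitely many basis directions. Off the compact set
  \<open>K\<close> the function is locally \<open>0\<close>, hence so is its derivative.\<close>

lemma test_functions_lipschitz:
  fixes f :: "'a::euclidean_space \<Rightarrow> real"
  assumes "f \<in> test_functions \<Omega>"
  obtains L where "L > 0" "\<And>x y. \<bar>f x - f y\<bar> \<le> L * norm (x - y)"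
proof -
  obtain K where K: "compact K" "\<forall>x. f x \<noteq> 0 \<longrightarrow> x \<in> K" using test_functionsE[OF assms] by blast
  define D where "D x v = frechet_derivative f (at x) v" for x v
  have C1: "Ck_on (Suc 0) UNIV f" using test_functions_smooth[OF assms] by (simp only: smooth_on_def)
  have D: "(f has_derivative D x) (at x)" for x
    using Ck_on_SucD(1)[OF C1] by (simp add: D_def[abs_def])
  have contD: "continuous_on UNIV (\<lambda>x. D x v)" for v
    using Ck_on_SucD(2)[OF C1] by (simp add: D_def)
  have D0: "D x v = 0" if "x \<notin> K" for x v
  proof -
    have z: "(f has_derivative (\<lambda>v. 0)) (at x)"
      by (rule has_derivative_transform_within_open[of "\<lambda>x. 0" _ _ _ "- K"])
        (use that K in \<open>auto dest: compact_imp_closed\<close>)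
    show ?thesis using has_derivative_unique[OF D z] by simp
  qed
  have "\<exists>M\<ge>0. \<forall>x. \<bar>D x v\<bar> \<le> M" for v
  proof -
    have "compact ((\<lambda>x. D x v) ` K)"
      using K contD by (intro compact_continuous_image) (auto intro: continuous_on_subset)
    then obtain M where M: "M > 0" "\<And>x. x \<in> K \<Longrightarrow> \<bar>D x v\<bar> \<le> M"
      by (auto dest!: compact_imp_bounded simp: bounded_pos)
    then have "\<bar>D x v\<bar> \<le> M" for x using D0[of x v] by (cases "x \<in> K") auto
    then show ?thesis using M less_imp_le by blast
  qed
  then obtain M where M: "\<And>v. M v \<ge> 0" "\<And>v x. \<bar>D x v\<bar> \<le> M v" by metis
  define L where "L = (\<Sum>b\<in>Basis. M b) + 1"
  have L: "L > 0" using M(1) by (auto simp: L_def intro!: add_nonneg_pos sum_nonneg)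
  have "onorm (D x) \<le> L" for x
  proof (rule onorm_bound)
    show "0 \<le> L" using L by simp
    fix v
    have lin: "linear (D x)" using D has_derivative_linear by blast
    have "D x v = D x (\<Sum>b\<in>Basis. (v \<bullet> b) *\<^sub>R b)" by (simp add: euclidean_representation)
    also have "\<dots> = (\<Sum>b\<in>Basis. (v \<bullet> b) * D x b)"
      unfolding linear_sum[OF lin] linear_cmul[OF lin] by (simp only: real_scaleR_def)
    finally have "\<bar>D x v\<bar> \<le> (\<Sum>b\<in>Basis. \<bar>(v \<bullet> b) * D x b\<bar>)"
      by (simp only: sum_abs)
    also have "\<dots> \<le> (\<Sum>b\<in>Basis. M b * norm v)"
    proof (rule sum_mono)
      fix b :: 'a assume b: "b \<in> Basis"
      then have "\<bar>v \<bullet> b\<bar> \<le> norm v" by (rule Basis_le_norm)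
      then show "\<bar>(v \<bullet> b) * D x b\<bar> \<le> M b * norm v"
        using mult_mono[OF M(2)[of x b] \<open>\<bar>v \<bullet> b\<bar> \<le> norm v\<close>] M(1)[of b]
        by (simp add: abs_mult mult.commute)
    qed
    also have "\<dots> \<le> L * norm v" by (simp add: L_def sum_distrib_right[symmetric] algebra_simps)
    finally show "norm (D x v) \<le> L * norm v" by simp
  qed
  then have "norm (f x - f y) \<le> L * norm (x - y)" for x y
    by (intro differentiable_bound[where S=UNIV and f'=D]) (auto intro: D)
  then show ?thesis using that L by auto
qed

lemma test_functions_ball:
  fixes x0 :: "'a::euclidean_space"
  assumes "r > 0" "cball x0 r \<subseteq> \<Omega>"
  obtains g where "g \<in> test_functions \<Omega>" "\<And>x. g x \<ge> 0" "\<And>x. x \<in> ball x0 (r/2) \<Longrightarrow> g x \<ge> 1"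
proof -
  define f where "f x = r\<^sup>2 + (- 1) * (norm (x - x0))\<^sup>2" for x
  have f: "smooth_on UNIV f"
    unfolding f_def by (intro smooth_on_add smooth_on_mult smooth_on_const smooth_on_norm_sq)
  \<comment> \<open>Within distance \<open>r / 2\<close> of the centre, \<open>f\<close> is at least
    \<open>3/4\<close> of the square of \<open>r\<close>; dividing by the profile at this value
    lifts the bump to at least \<open>1\<close> there.\<close>
  define a where "a = exp (- (1 / (3/4 * r\<^sup>2)))"
  define g where "g x = 1 / a * (if f x > 0 then exp (- (1 / f x)) else 0)" for x
  have a: "a > 0" by (simp add: a_def)
  have fpos: "f x > 0 \<longleftrightarrow> norm (x - x0) < r" for x
  proof
    assume "f x > 0"
    then have "(norm (x - x0))\<^sup>2 < r\<^sup>2" by (simp add: f_def)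
    then show "norm (x - x0) < r" using assms(1) power2_less_imp_less[of "norm (x - x0)" r] by simp
  next
    assume "norm (x - x0) < r"
    then have "(norm (x - x0))\<^sup>2 < r\<^sup>2" by (rule power_strict_mono) auto
    then show "f x > 0" by (simp add: f_def)
  qed
  have "smooth_on UNIV g"
    unfolding g_def by (intro smooth_on_mult smooth_on_const smooth_on_bump f)
  then have "g \<in> test_functions \<Omega>"
    using fpos assms by (intro test_functionsI[of _ "cball x0 r"])
      (auto simp: g_def dist_norm norm_minus_commute split: if_splits)
  moreover have "g x \<ge> 0" for x using a by (simp add: g_def)
  moreover have "g x \<ge> 1" if "x \<in> ball x0 (r/2)" for x
  proof -
    have n: "norm (x - x0) < r / 2" using that by (simp add: dist_norm norm_minus_commute)
    then have "(norm (x - x0))\<^sup>2 \<le> (r / 2)\<^sup>2" by (rule power_mono[OF less_imp_le]) auto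
    then have "3/4 * r\<^sup>2 \<le> f x" by (simp add: f_def power_divide)
    moreover have "3/4 * r\<^sup>2 > 0" using assms by simp
    ultimately have "1 / f x \<le> 1 / (3/4 * r\<^sup>2)" "f x > 0"
      by (auto intro: divide_left_mono mult_pos_pos simp del: times_divide_eq_left)
    then have "a \<le> exp (- (1 / f x))" by (simp add: a_def)
    then show ?thesis using a \<open>f x > 0\<close> by (simp add: g_def)
  qed
  ultimately show ?thesis using that by blast
qed

section \<open>Lebesgue measure on the product space\<close>

text \<open>\<open>lebesgue\<close> on the product type completes the product of the Borel measures
  and is not itself a product measure, so a null set is first covered by a Borel null set and only
  then multiplied by the whole space.\<close>

lemma AE_lebesgue_fst:
  fixes P :: "'a::euclidean_space \<Rightarrow> bool"
  assumes "AE x in lebesgue. P x"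
  shows "AE z in (lebesgue :: ('a \<times> 'b::euclidean_space) measure). P (fst z)"
proof -
  from assms have "AE x in lborel. P x" by (simp only: AE_completion_iff)
  then obtain N where N: "N \<in> null_sets lborel" "{x. \<not> P x} \<subseteq> N"
    by (auto simp: eventually_ae_filter)
  have "N \<times> UNIV \<in> null_sets (lborel \<Otimes>\<^sub>M (lborel :: 'b measure))"
    using N by (intro lborel.times_in_null_sets1) auto
  then have "AE z in (lborel :: ('a \<times> 'b) measure). P (fst z)"
    unfolding lborel_prod by (rule AE_I') (use N in auto)
  then show ?thesis by (simp add: AE_completion_iff)
qed

lemma AE_lebesgue_snd:
  fixes P :: "'b::euclidean_space \<Rightarrow> bool"
  assumes "AE x in lebesgue. P x"
  shows "AE z in (lebesgue :: ('a::euclidean_space \<times> 'b) measure). P (snd z)"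
proof -
  from assms have "AE x in lborel. P x" by (simp only: AE_completion_iff)
  then obtain N where N: "N \<in> null_sets lborel" "{x. \<not> P x} \<subseteq> N"
    by (auto simp: eventually_ae_filter)
  have "UNIV \<times> N \<in> null_sets ((lborel :: 'a measure) \<Otimes>\<^sub>M lborel)"
    using N by (intro lborel.times_in_null_sets2) auto
  then have "AE z in (lborel :: ('a \<times> 'b) measure). P (snd z)"
    unfolding lborel_prod by (rule AE_I') (use N in auto)
  then show ?thesis by (simp add: AE_completion_iff)
qed

lemma borel_measurable_fst_euclidean:
  "(fst :: 'a::euclidean_space \<times> 'b::euclidean_space \<Rightarrow> 'a) \<in> borel_measurable borel"
  by (intro borel_measurable_continuous_onI continuous_intros)

lemma borel_measurable_snd_euclidean:
  "(snd :: 'a::euclidean_space \<times> 'b::euclidean_space \<Rightarrow> 'b) \<in> borel_measurable borel"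
  by (intro borel_measurable_continuous_onI continuous_intros)

text \<open>A Lebesgue set is a Borel set together with part of a Borel null set. Borel
  measurability of \<open>g\<close> pulls back the first; the second needs preimages of null sets to
  be null.\<close>

lemma measurable_lebesgue_lebesgueI:
  fixes g :: "'a::euclidean_space \<Rightarrow> 'b::euclidean_space"
  assumes g: "g \<in> borel_measurable borel"
    and null: "\<And>N. N \<in> null_sets lborel \<Longrightarrow> AE z in lebesgue. g z \<notin> N"
  shows "g \<in> measurable lebesgue lebesgue"
proof (rule measurableI)
  fix A :: "'b set" assume "A \<in> sets lebesgue"
  then obtain S N N' where A: "A = S \<union> N" "N \<subseteq> N'" "N' \<in> null_sets lborel" "S \<in> sets lborel"
    by (rule sets_completionE)
  have "g -` S \<in> sets lebesgue"
    using measurable_sets[OF g, of S] A(4) by simp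
  moreover have "g -` N' \<in> null_sets lebesgue"
  proof -
    have "g -` N' \<in> sets lebesgue"
      using measurable_sets[OF g, of N'] A(3) by (simp add: null_sets_def)
    then show ?thesis using null[OF A(3)] by (simp add: AE_iff_null_sets)
  qed
  then have "g -` N \<in> sets lebesgue"
    using A(2) by (meson null_setsD2 null_sets_completion_subset vimage_mono)
  ultimately show "g -` A \<inter> space lebesgue \<in> sets lebesgue"
    using A(1) by (simp add: vimage_Un sets.Un)
qed simp

lemma measurable_fst_lebesgue:
  "fst \<in> measurable (lebesgue :: ('a::euclidean_space \<times> 'b::euclidean_space) measure) lebesgue"
proof (rule measurable_lebesgue_lebesgueI[OF borel_measurable_fst_euclidean])
  fix N :: "'a set" assume "N \<in> null_sets lborel"
  then have "AE x in lebesgue. x \<notin> N" by (intro AE_completion AE_not_in)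
  then show "AE z in (lebesgue :: ('a \<times> 'b) measure). fst z \<notin> N" by (rule AE_lebesgue_fst)
qed

lemma measurable_snd_lebesgue:
  "snd \<in> measurable (lebesgue :: ('a::euclidean_space \<times> 'b::euclidean_space) measure) lebesgue"
proof (rule measurable_lebesgue_lebesgueI[OF borel_measurable_snd_euclidean])
  fix N :: "'b set" assume "N \<in> null_sets lborel"
  then have "AE x in lebesgue. x \<notin> N" by (intro AE_completion AE_not_in)
  then show "AE z in (lebesgue :: ('a \<times> 'b) measure). snd z \<notin> N" by (rule AE_lebesgue_snd)
qed

text \<open>Tonelli for the completed measure: \<open>f\<close> agrees almost everywhere with a
  Borel function \<open>g\<close>, and almost every section of the exceptional set is null, so the
  inner integrals agree almost everywhere.\<close>

lemma
  fixes f :: "'a::euclidean_space \<times> 'b::euclidean_space \<Rightarrow> ennreal"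
  assumes "f \<in> borel_measurable lebesgue"
  shows nn_integral_lebesgue_fst:
      "(\<integral>\<^sup>+z. f z \<partial>lebesgue) = (\<integral>\<^sup>+x. (\<integral>\<^sup>+y. f (x, y) \<partial>lebesgue) \<partial>lebesgue)"
    and nn_integral_lebesgue_snd:
      "(\<integral>\<^sup>+z. f z \<partial>lebesgue) = (\<integral>\<^sup>+y. (\<integral>\<^sup>+x. f (x, y) \<partial>lebesgue) \<partial>lebesgue)"
proof -
  obtain g where g: "g \<in> borel_measurable lborel" and fg: "AE z in lborel. f z = g z"
    using completion_ex_borel_measurable[OF assms] by blast
  have g': "g \<in> borel_measurable (lborel \<Otimes>\<^sub>M lborel)" unfolding lborel_prod by (rule g)
  have fg': "AE z in lborel \<Otimes>\<^sub>M lborel. f z = g z" unfolding lborel_prod by (rule fg)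
  have eq: "(\<integral>\<^sup>+z. f z \<partial>lebesgue) = (\<integral>\<^sup>+z. g z \<partial>(lborel \<Otimes>\<^sub>M lborel))"
    unfolding nn_integral_completion lborel_prod by (rule nn_integral_cong_AE[OF fg])
  have "AE x in lborel. (\<integral>\<^sup>+y. f (x, y) \<partial>lborel) = (\<integral>\<^sup>+y. g (x, y) \<partial>lborel)"
    using lborel_pair.AE_pair[OF fg'] by eventually_elim (rule nn_integral_cong_AE)
  then show "(\<integral>\<^sup>+z. f z \<partial>lebesgue) = (\<integral>\<^sup>+x. (\<integral>\<^sup>+y. f (x, y) \<partial>lebesgue) \<partial>lebesgue)"
    unfolding eq unfolding nn_integral_completion lborel.nn_integral_fst[OF g', symmetric]
    by (intro nn_integral_cong_AE) auto
  \<comment> \<open>The coordinates are swapped so that the exceptional set is cut into sections in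
    the other variable.\<close>
  have sw: "AE z in lborel \<Otimes>\<^sub>M lborel. f (snd z, fst z) = g (snd z, fst z)"
    using fg' by (subst (asm) lborel_pair.distr_pair_swap)
      (rule AE_distrD[OF measurable_pair_swap', of "\<lambda>z. f z = g z", simplified case_prod_beta], simp)
  have "AE y in lborel. (\<integral>\<^sup>+x. f (x, y) \<partial>lborel) = (\<integral>\<^sup>+x. g (x, y) \<partial>lborel)"
    using lborel_pair.AE_pair[OF sw] by eventually_elim (rule nn_integral_cong_AE, simp)
  then show "(\<integral>\<^sup>+z. f z \<partial>lebesgue) = (\<integral>\<^sup>+y. (\<integral>\<^sup>+x. f (x, y) \<partial>lebesgue) \<partial>lebesgue)"
    unfolding eq unfolding nn_integral_completion lborel_pair.nn_integral_snd[OF g', symmetric]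
    by (intro nn_integral_cong_AE) auto
qed

section \<open>The fractional kernel\<close>

text \<open>On the diagonal the value is \<open>0\<close>, from \<open>0 powr _ = 0\<close> and
  division by zero; lower bounds for the kernel therefore have to exclude
  \<open>x = y\<close>.\<close>

definition frac_kernel :: "real \<Rightarrow> real \<Rightarrow> 'a::euclidean_space \<times> 'a \<Rightarrow> real" where
  "frac_kernel s p z = 1 / norm (fst z - snd z) powr (real DIM('a) + s * p)"

lemma frac_kernel_nonneg: "frac_kernel s p z \<ge> 0"
  by (simp add: frac_kernel_def)

lemma frac_kernel_swap: "frac_kernel s p (x, y) = frac_kernel s p (y, x)"
  by (simp add: frac_kernel_def norm_minus_commute)

lemma frac_kernel_borel: "frac_kernel s p \<in> borel_measurable borel"
proof -
  note borel_measurable_fst_euclidean[measurable] borel_measurable_snd_euclidean[measurable]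
  show ?thesis unfolding frac_kernel_def[abs_def] by measurable
qed

lemma frac_kernel_measurable: "frac_kernel s p \<in> borel_measurable lebesgue"
  using frac_kernel_borel by (intro measurable_completion) simp

lemma frac_kernel_ge:
  fixes x y :: "'a::euclidean_space"
  assumes "x \<noteq> y" "norm (x - y) \<le> R" "0 < s" "0 < p"
  shows "1 / R powr (real DIM('a) + s * p) \<le> frac_kernel s p (x, y)"
  unfolding frac_kernel_def fst_conv snd_conv using assms
  by (intro divide_left_mono powr_mono2 mult_pos_pos powr_gt_zero[THEN iffD2] add_nonneg_nonneg)
    (auto intro!: powr_gt_zero[THEN iffD2])

lemma ex_dyadic:
  assumes "(x::real) \<ge> 1"
  shows "\<exists>n. 2 ^ n \<le> x \<and> x < 2 ^ Suc n"
proof -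
  obtain m where m: "x < 2 ^ m" using real_arch_pow[of 2 x] by auto
  define k where "k = (LEAST m. x < 2 ^ m)"
  have k: "x < 2 ^ k" unfolding k_def using m by (rule LeastI)
  have "k \<noteq> 0" using k assms by (intro notI) simp
  then obtain n where n: "k = Suc n" using not0_implies_Suc by blast
  have "\<not> x < 2 ^ n" unfolding k_def using n not_less_Least[of n "\<lambda>m. x < 2 ^ m"] by (simp add: k_def)
  then show ?thesis using k n by (intro exI[of _ n]) auto
qed

lemma ennreal_term_le_suminf: "f n \<le> (\<Sum>n. f n)" for f :: "nat \<Rightarrow> ennreal"
  using sum_le_suminf[of f "{n}"] by simp

lemma nn_integral_suminf_cball:
  fixes x :: "'a::euclidean_space"
  assumes "\<And>n. a n \<ge> 0" "\<And>n. \<rho> n \<ge> 0" "summable (\<lambda>n. a n * \<rho> n ^ DIM('a))"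
  shows "(\<integral>\<^sup>+y. (\<Sum>n. ennreal (a n) * indicator (cball x (\<rho> n)) y) \<partial>lebesgue)
    = ennreal (unit_ball_vol DIM('a) * (\<Sum>n. a n * \<rho> n ^ DIM('a)))"
proof -
  have [measurable]: "cball z e \<in> sets lborel" for z :: 'a and e by simp
  have "(\<integral>\<^sup>+y. (\<Sum>n. ennreal (a n) * indicator (cball x (\<rho> n)) y) \<partial>lebesgue)
    = (\<Sum>n. \<integral>\<^sup>+y. ennreal (a n) * indicator (cball x (\<rho> n)) y \<partial>lborel)"
    unfolding nn_integral_completion by (rule nn_integral_suminf) measurable
  also have "\<dots> = (\<Sum>n. ennreal (unit_ball_vol DIM('a) * (a n * \<rho> n ^ DIM('a))))"
    using assms by (subst nn_integral_cmult_indicator)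
      (auto simp: emeasure_cball ennreal_mult'[symmetric] mult_ac)
  also have "\<dots> = ennreal (\<Sum>n. unit_ball_vol DIM('a) * (a n * \<rho> n ^ DIM('a)))"
    using assms by (intro suminf_ennreal2 summable_mult) auto
  also have "\<dots> = ennreal (unit_ball_vol DIM('a) * (\<Sum>n. a n * \<rho> n ^ DIM('a)))"
    using assms by (subst suminf_mult) auto
  finally show ?thesis .
qed

text \<open>
  Split into dyadic shells around \<open>x\<close>: far away the kernel decays like the power \<open>- N - s p\<close>, and
  near \<open>x\<close> the integrand is bounded by the power \<open>p - N - s p\<close> of the distance.
\<close>

lemma frac_kernel_integral_bound:
  assumes s: "0 < s" "s < 1" and p: "0 < p" and L: "0 \<le> L" and M: "0 \<le> M"
  obtains C where "C > 0" "\<And>x :: 'a::euclidean_space.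
    (\<integral>\<^sup>+y. ennreal (min (L * norm (x - y)) M powr p * frac_kernel s p (x, y)) \<partial>lebesgue) \<le> ennreal C"
proof -
  define N where "N = DIM('a)"
  define q where "q = real N + s * p"
  \<comment> \<open>\<open>a n\<close> bounds the integrand on the shell of distances from
    \<open>2 ^ n\<close> to \<open>2 ^ Suc n\<close>, and \<open>b n\<close> on the shell from
    \<open>(1/2) ^ Suc n\<close> to \<open>(1/2) ^ n\<close>. The factor \<open>2 powr q\<close> in
    \<open>b n\<close> pays for evaluating the kernel at the inner radius.\<close>
  define a b where "a n = M powr p * (1 / 2 powr (real n * q))"
    and "b n = (L powr p * 2 powr q) * (1/2) powr (real n * (p - q))" for n :: nat
  have q: "q > 0" using s p by (simp add: q_def add_nonneg_pos)
  have a0: "a n \<ge> 0" and b0: "b n \<ge> 0" for n by (simp_all add: a_def b_def)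
  \<comment> \<open>Multiplied by the volume of their balls, both sequences become geometric: the
    ratio is \<open>2 powr (- (s * p))\<close> far away and \<open>(1/2) powr (p - s * p)\<close>
    near \<open>x\<close>, the latter being below \<open>1\<close> because
    \<open>s < 1\<close>.\<close>
  have aN: "a n * (2 ^ Suc n) ^ N = (M powr p * 2 ^ N) * (2 powr (- (s * p))) ^ n" for n
  proof -
    have e1: "(2 ^ Suc n) ^ N = (2::real) ^ N * 2 powr (real n * real N)"
      by (simp add: power_mult_distrib powr_realpow[symmetric] powr_powr powr_mult)
    have e2: "(2 powr (- (s * p))) ^ n = 2 powr (- (s * p) * real n)"
      by (simp add: powr_realpow[symmetric] powr_powr)
    have e3: "2 powr (real n * real N) * (1 / 2 powr (real n * q)) = 2 powr (- (s * p) * real n)"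
      by (simp add: powr_minus_divide[symmetric] powr_add[symmetric] q_def algebra_simps)
    have "a n * (2 ^ Suc n) ^ N
        = (M powr p * 2 ^ N) * (2 powr (real n * real N) * (1 / 2 powr (real n * q)))"
      unfolding a_def e1 by (simp only: mult_ac)
    then show ?thesis unfolding e3 e2 .
  qed
  have bN: "b n * ((1/2) ^ n) ^ N = (L powr p * 2 powr q) * ((1/2) powr (p - s * p)) ^ n" for n
  proof -
    have e1: "((1/2) ^ n) ^ N = (1/2::real) powr (real n * real N)"
      by (simp add: powr_realpow[symmetric] powr_powr del: power_divide)
    have e2: "((1/2) powr (p - s * p)) ^ n = (1/2::real) powr ((p - s * p) * real n)"
      by (simp add: powr_realpow[symmetric] powr_powr)
    have e3: "(1/2::real) powr (real n * (p - q)) * (1/2) powr (real n * real N)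
        = (1/2) powr ((p - s * p) * real n)"
      by (simp only: powr_add[symmetric]) (simp add: q_def algebra_simps)
    have "b n * ((1/2) ^ n) ^ N
        = (L powr p * 2 powr q) * ((1/2) powr (real n * (p - q)) * (1/2) powr (real n * real N))"
      unfolding b_def e1 by (simp only: mult_ac)
    then show ?thesis unfolding e3 e2 .
  qed
  have "summable (\<lambda>n. (2 powr (- (s * p))) ^ n)"
    using s p by (intro summable_geometric) (simp add: powr_less_one)
  then have sa: "summable (\<lambda>n. a n * (2 ^ Suc n) ^ N)"
    unfolding aN by (rule summable_mult)
  have "(1/2::real) powr (p - s * p) < 1"
    using s p by (simp add: powr_divide gr_one_powr)
  then have "summable (\<lambda>n. ((1/2::real) powr (p - s * p)) ^ n)"
    by (intro summable_geometric) simp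
  then have sb: "summable (\<lambda>n. b n * ((1/2) ^ n) ^ N)"
    unfolding bN by (rule summable_mult)
  define C where "C = unit_ball_vol N * (\<Sum>n. a n * (2 ^ Suc n) ^ N)
    + unit_ball_vol N * (\<Sum>n. b n * ((1/2) ^ n) ^ N) + 1"
  have v: "unit_ball_vol N \<ge> 0" by simp
  have C12: "0 \<le> unit_ball_vol N * (\<Sum>n. a n * (2 ^ Suc n) ^ N)"
      "0 \<le> unit_ball_vol N * (\<Sum>n. b n * ((1/2) ^ n) ^ N)"
    using v sa sb a0 b0 by (auto intro!: mult_nonneg_nonneg suminf_nonneg)
  then have C: "C > 0" by (simp add: C_def)
  have pt: "ennreal (min (L * norm (x - y)) M powr p * frac_kernel s p (x, y))
      \<le> (\<Sum>n. ennreal (a n) * indicator (cball x (2 ^ Suc n)) y)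
        + (\<Sum>n. ennreal (b n) * indicator (cball x ((1/2) ^ n)) y)" for x y :: 'a
  proof (cases "x = y")
    case True
    then show ?thesis by (simp add: frac_kernel_def)
  next
    case False
    define d where "d = norm (x - y)"
    have d: "d > 0" using False by (simp add: d_def)
    have K: "frac_kernel s p (x, y) = 1 / d powr q" by (simp add: frac_kernel_def d_def q_def N_def)
    have m0: "0 \<le> min (L * d) M" using L M d by simp
    show ?thesis
    proof (cases "d \<ge> 1")
      case True
      then obtain n where n: "2 ^ n \<le> d" "d < 2 ^ Suc n" using ex_dyadic by blast
      have "2 powr (real n * q) = (2 ^ n) powr q"
        by (simp add: powr_realpow[symmetric] powr_powr)
      also have "\<dots> \<le> d powr q" using n q by (intro powr_mono2) auto
      finally have "1 / d powr q \<le> 1 / 2 powr (real n * q)" using d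
        by (intro divide_left_mono) auto
      moreover have "min (L * d) M powr p \<le> M powr p" using m0 p by (intro powr_mono2) auto
      ultimately have "min (L * d) M powr p * (1 / d powr q) \<le> a n"
        unfolding a_def by (intro mult_mono) auto
      then have "ennreal (min (L * norm (x - y)) M powr p * frac_kernel s p (x, y))
          \<le> ennreal (a n) * indicator (cball x (2 ^ Suc n)) y"
        using n by (simp add: K d_def[symmetric] dist_norm ennreal_leI)
      also have "\<dots> \<le> (\<Sum>n. ennreal (a n) * indicator (cball x (2 ^ Suc n)) y)"
        by (rule ennreal_term_le_suminf[of "\<lambda>n. ennreal (a n) * indicator (cball x (2 ^ Suc n)) y"])
      finally show ?thesis by (rule order_trans) simp
    next
      case False
      then have "1 / d \<ge> 1" using d by simp
      then obtain n where n: "2 ^ n \<le> 1 / d" "1 / d < 2 ^ Suc n" using ex_dyadic by blast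
      have n': "d \<le> (1/2) ^ n" "(1/2) ^ Suc n < d"
        using n d by (simp_all add: field_simps power_divide)
      have e: "(1/2::real) ^ Suc n = (1/2) powr real (Suc n)" by (subst powr_realpow) simp_all
      have "(1/2::real) powr (real n * q) * (1/2) powr q = ((1/2) ^ Suc n) powr q"
        unfolding e powr_powr powr_add[symmetric] by (simp add: algebra_simps)
      also have "\<dots> \<le> d powr q" using n' q by (intro powr_mono2) auto
      finally have "1 / d powr q \<le> 1 / ((1/2) powr (real n * q) * (1/2) powr q)" using d
        by (intro divide_left_mono) auto
      also have "\<dots> = 2 powr q * (1/2) powr (- (real n * q))"
        by (simp add: powr_minus powr_divide field_simps)
      finally have "1 / d powr q \<le> 2 powr q * (1/2) powr (- (real n * q))" .
      moreover have "min (L * d) M powr p \<le> L powr p * (1/2) powr (real n * p)"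
      proof -
        have "min (L * d) M \<le> L * (1/2) ^ n" using n' L
          by (metis min.coboundedI1 mult_left_mono)
        then have "min (L * d) M powr p \<le> (L * (1/2) ^ n) powr p"
          using m0 p by (intro powr_mono2) auto
        also have "\<dots> = L powr p * (1/2) powr (real n * p)"
          using L by (simp add: powr_mult powr_realpow[symmetric] powr_powr del: power_divide)
        finally show ?thesis .
      qed
      ultimately have "min (L * d) M powr p * (1 / d powr q)
          \<le> (L powr p * (1/2) powr (real n * p)) * (2 powr q * (1/2) powr (- (real n * q)))"
        by (intro mult_mono) auto
      also have "\<dots> = (L powr p * 2 powr q) * ((1/2) powr (real n * p) * (1/2) powr (- (real n * q)))"
        by (simp only: mult_ac)
      also have "(1/2::real) powr (real n * p) * (1/2) powr (- (real n * q)) = (1/2) powr (real n * (p - q))"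
        by (simp only: powr_add[symmetric]) (simp add: algebra_simps)
      finally have "min (L * d) M powr p * (1 / d powr q) \<le> b n" unfolding b_def .
      then have "ennreal (min (L * norm (x - y)) M powr p * frac_kernel s p (x, y))
          \<le> ennreal (b n) * indicator (cball x ((1/2) ^ n)) y"
        using n' by (simp add: K d_def[symmetric] dist_norm ennreal_leI del: power_divide)
      also have "\<dots> \<le> (\<Sum>n. ennreal (b n) * indicator (cball x ((1/2) ^ n)) y)"
        by (rule ennreal_term_le_suminf[of "\<lambda>n. ennreal (b n) * indicator (cball x ((1/2) ^ n)) y"])
      finally show ?thesis by (rule order_trans) simp
    qed
  qed
  have "(\<integral>\<^sup>+y. ennreal (min (L * norm (x - y)) M powr p * frac_kernel s p (x, y)) \<partial>lebesgue)
      \<le> ennreal C" for x :: 'a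
  proof -
    have [measurable]: "cball z e \<in> sets lborel" for z :: 'a and e by simp
    have "(\<integral>\<^sup>+y. ennreal (min (L * norm (x - y)) M powr p * frac_kernel s p (x, y)) \<partial>lebesgue)
      \<le> (\<integral>\<^sup>+y. (\<Sum>n. ennreal (a n) * indicator (cball x (2 ^ Suc n)) y)
        + (\<Sum>n. ennreal (b n) * indicator (cball x ((1/2) ^ n)) y) \<partial>lborel)"
      unfolding nn_integral_completion by (intro nn_integral_mono pt)
    also have "\<dots> = (\<integral>\<^sup>+y. (\<Sum>n. ennreal (a n) * indicator (cball x (2 ^ Suc n)) y) \<partial>lebesgue)
        + (\<integral>\<^sup>+y. (\<Sum>n. ennreal (b n) * indicator (cball x ((1/2) ^ n)) y) \<partial>lebesgue)"
      unfolding nn_integral_completion by (rule nn_integral_add) measurable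
    also have "\<dots> = ennreal (unit_ball_vol N * (\<Sum>n. a n * (2 ^ Suc n) ^ N))
        + ennreal (unit_ball_vol N * (\<Sum>n. b n * ((1/2) ^ n) ^ N))"
      unfolding N_def using sa sb a0 b0 by (intro arg_cong2[where f="(+)"] nn_integral_suminf_cball)
        (auto simp: N_def)
    also have "\<dots> = ennreal (unit_ball_vol N * (\<Sum>n. a n * (2 ^ Suc n) ^ N)
        + unit_ball_vol N * (\<Sum>n. b n * ((1/2) ^ n) ^ N))"
      using C12 by (simp add: ennreal_plus)
    also have "\<dots> \<le> ennreal C" by (intro ennreal_leI) (simp add: C_def)
    finally show ?thesis .
  qed
  then show ?thesis using that[OF C] by blast
qed

text \<open>
  Among all sets of given measure, a ball centred at \<open>x\<close> leaves the least kernel mass outside.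
  This is the source of the gain in the De Giorgi iteration, in place of a Sobolev inequality.
\<close>

lemma frac_kernel_integral_compl:
  assumes s: "0 < s" and p: "0 < p"
  obtains c where "c > 0" "\<And>(x :: 'a::euclidean_space) D. D \<in> lmeasurable \<Longrightarrow> measure lebesgue D > 0 \<Longrightarrow>
    ennreal (c * measure lebesgue D powr (- (s * p / DIM('a))))
      \<le> (\<integral>\<^sup>+y. ennreal (frac_kernel s p (x, y)) * indicator (- D) y \<partial>lebesgue)"
proof -
  define N where "N = real DIM('a)"
  define v where "v = unit_ball_vol N"
  define q where "q = N + s * p"
  \<comment> \<open>This is the constant in \<open>m / \<rho> powr q\<close> for the radius
    \<open>\<rho>\<close> below; the power of \<open>m\<close> that remains is
    \<open>1 - q / N = - (s * p / N)\<close>.\<close>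
  define c where "c = (v / 2) powr (q / N)"
  have N: "N > 0" by (simp add: N_def)
  have v: "v > 0" by (simp add: v_def N_def)
  have c: "c > 0" using v by (simp add: c_def)
  have "ennreal (c * measure lebesgue D powr (- (s * p / DIM('a))))
      \<le> (\<integral>\<^sup>+y. ennreal (frac_kernel s p (x, y)) * indicator (- D) y \<partial>lebesgue)"
    if D: "D \<in> lmeasurable" "measure lebesgue D > 0" for x :: 'a and D
  proof -
    define m where "m = measure lebesgue D"
    \<comment> \<open>The ball of this radius has twice the measure of \<open>D\<close>, so at least
      the measure \<open>m\<close> of it lies outside \<open>D\<close>, and there the kernel is at
      least \<open>1 / \<rho> powr q\<close>.\<close>
    define \<rho> where "\<rho> = (2 * m / v) powr (1 / N)"
    have m: "m > 0" using D by (simp add: m_def)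
    have \<rho>: "\<rho> > 0" using m v by (simp add: \<rho>_def)
    have "\<rho> ^ DIM('a) = 2 * m / v"
      using m v N by (simp add: powr_realpow[symmetric] \<rho>_def powr_powr N_def)
    moreover have "measure lebesgue (cball x \<rho>) = v * \<rho> ^ DIM('a)"
      using \<rho> by (simp add: content_cball v_def N_def)
    ultimately have B: "measure lebesgue (cball x \<rho>) = 2 * m"
      using v by simp
    \<comment> \<open>The centre is removed because the kernel is \<open>0\<close> on the
      diagonal.\<close>
    define A where "A = cball x \<rho> - D - {x}"
    have A: "A \<in> lmeasurable" unfolding A_def using D by (intro fmeasurable_Diff) auto
    have sing: "{x} \<in> lmeasurable" by (rule lmeasurable_compact) simp
    have Dx: "D \<union> {x} \<in> lmeasurable" by (rule fmeasurable.Un[OF D(1) sing])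
    have "2 * m = measure lebesgue (cball x \<rho>)" using B by simp
    also have "\<dots> \<le> measure lebesgue (A \<union> (D \<union> {x}))"
      using fmeasurable.Un[OF A Dx] by (intro measure_mono_fmeasurable) (auto simp: A_def)
    also have "\<dots> \<le> measure lebesgue A + measure lebesgue (D \<union> {x})"
      by (rule measure_Un_le[OF fmeasurableD[OF A] fmeasurableD[OF Dx]])
    also have "measure lebesgue (D \<union> {x}) \<le> m + measure lebesgue {x}"
      unfolding m_def by (rule measure_Un_le[OF fmeasurableD[OF D(1)] fmeasurableD[OF sing]])
    finally have mA: "m \<le> measure lebesgue A" by simp
    have "c * m powr (- (s * p / N)) = m * (1 / \<rho> powr q)"
    proof -
      have "1 / \<rho> powr q = (v / (2 * m)) powr (q / N)"
        using m v by (simp add: \<rho>_def powr_powr powr_divide)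
      also have "\<dots> = (v / 2) powr (q / N) / m powr (q / N)"
        using m v by (simp add: powr_divide powr_mult)
      finally have "m * (1 / \<rho> powr q) = c * (m powr 1 / m powr (q / N))"
        using m by (simp add: c_def)
      also have "m powr 1 / m powr (q / N) = m powr (1 - q / N)"
        by (rule powr_diff[symmetric])
      also have "1 - q / N = - (s * p / N)" using N by (simp add: q_def field_simps)
      finally show ?thesis by simp
    qed
    then have "ennreal (c * m powr (- (s * p / N))) \<le> ennreal (1 / \<rho> powr q) * emeasure lebesgue A"
      using mA m A by (subst emeasure_eq_measure2)
        (auto simp: ennreal_mult'[symmetric] mult.commute intro!: ennreal_leI divide_right_mono)
    also have "\<dots> = (\<integral>\<^sup>+y. ennreal (1 / \<rho> powr q) * indicator A y \<partial>lebesgue)"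
      using A by (subst nn_integral_cmult_indicator) auto
    also have "\<dots> \<le> (\<integral>\<^sup>+y. ennreal (frac_kernel s p (x, y)) * indicator (- D) y \<partial>lebesgue)"
    proof (intro nn_integral_mono)
      fix y show "ennreal (1 / \<rho> powr q) * indicator A y \<le> ennreal (frac_kernel s p (x, y)) * indicator (- D) y"
        using frac_kernel_ge[of x y \<rho> s p] s p
        by (auto simp: A_def indicator_def dist_norm q_def N_def intro!: ennreal_leI)
    qed
    finally show ?thesis by (simp add: m_def N_def)
  qed
  then show ?thesis using that[OF c] by blast
qed

section \<open>Fractional Sobolev functions\<close>

definition incr :: "('a \<Rightarrow> real) \<Rightarrow> 'a \<times> 'a \<Rightarrow> real" where
  "incr u z = u (fst z) - u (snd z)"

text \<open>With the kernel as density, the Gagliardo integral is the integral of a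
  \<open>p\<close>-th power of \<open>incr u\<close> and the pairing is a duality integral, so
  convergence theorems apply on a single measure space.\<close>

definition frac_measure :: "real \<Rightarrow> real \<Rightarrow> ('a::euclidean_space \<times> 'a) measure" where
  "frac_measure s p = density lebesgue (\<lambda>z. ennreal (frac_kernel s p z))"

definition lp_integral :: "real \<Rightarrow> ('a::euclidean_space \<Rightarrow> real) \<Rightarrow> ennreal" where
  "lp_integral p u = (\<integral>\<^sup>+x. ennreal (\<bar>u x\<bar> powr p) \<partial>lebesgue)"

lemma sets_frac_measure [simp, measurable_cong]: "sets (frac_measure s p) = sets lebesgue"
  by (simp add: frac_measure_def)

lemma space_frac_measure [simp]: "space (frac_measure s p) = UNIV"
  by (simp add: frac_measure_def)

declare frac_kernel_measurable [measurable]

lemma incr_measurable: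
  fixes u :: "'a::euclidean_space \<Rightarrow> real"
  assumes "u \<in> borel_measurable lebesgue"
  shows "incr u \<in> borel_measurable lebesgue"
  unfolding incr_def[abs_def]
  using measurable_compose[OF measurable_fst_lebesgue assms]
    measurable_compose[OF measurable_snd_lebesgue assms] by (rule borel_measurable_diff)

lemma incr_measurable_frac:
  fixes u :: "'a::euclidean_space \<Rightarrow> real"
  assumes "u \<in> borel_measurable lebesgue"
  shows "incr u \<in> borel_measurable (frac_measure s p)"
  using incr_measurable[OF assms] by simp

lemma AE_frac_measure:
  "AE z in lebesgue. P z \<Longrightarrow> AE z in frac_measure s p. P z"
  unfolding frac_measure_def by (subst AE_density) (auto elim: eventually_mono)

lemma AE_frac_measure_fst: "AE x in lebesgue. P x \<Longrightarrow> AE z in frac_measure s p. P (fst z)"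
  by (intro AE_frac_measure AE_lebesgue_fst)

lemma AE_frac_measure_snd: "AE x in lebesgue. P x \<Longrightarrow> AE z in frac_measure s p. P (snd z)"
  by (intro AE_frac_measure AE_lebesgue_snd)

lemma nn_integral_frac_measure:
  assumes "f \<in> borel_measurable lebesgue"
  shows "(\<integral>\<^sup>+z. f z \<partial>frac_measure s p) = (\<integral>\<^sup>+z. ennreal (frac_kernel s p z) * f z \<partial>lebesgue)"
  unfolding frac_measure_def using assms by (subst nn_integral_density) auto

lemma gagliardo_integral_eq:
  assumes "u \<in> borel_measurable lebesgue"
  shows "gagliardo_integral s p u = (\<integral>\<^sup>+z. ennreal (\<bar>incr u z\<bar> powr p) \<partial>frac_measure s p)"
proof -
  note incr_measurable[OF assms, measurable]
  have "gagliardo_integral s p u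
      = (\<integral>\<^sup>+z. ennreal (frac_kernel s p z) * ennreal (\<bar>incr u z\<bar> powr p) \<partial>lebesgue)"
    unfolding gagliardo_integral_def
    by (intro nn_integral_cong)
      (simp add: incr_def frac_kernel_def ennreal_mult'[symmetric] case_prod_beta)
  also have "\<dots> = (\<integral>\<^sup>+z. ennreal (\<bar>incr u z\<bar> powr p) \<partial>frac_measure s p)"
    by (rule nn_integral_frac_measure[symmetric]) measurable
  finally show ?thesis .
qed

text \<open>For \<open>p > 1\<close> this is the derivative of
  \<open>\<bar>a\<bar> powr p / p\<close>, the odd extension of the power
  \<open>p - 1\<close>.\<close>

definition jp :: "real \<Rightarrow> real \<Rightarrow> real" where
  "jp p a = \<bar>a\<bar> powr (p - 2) * a"

lemma jp_measurable [measurable]: "jp p \<in> borel_measurable borel"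
  unfolding jp_def[abs_def] by measurable

lemma plap_pairing_eq:
  assumes "u \<in> borel_measurable lebesgue" "v \<in> borel_measurable lebesgue"
  shows "plap_pairing s p u v = (\<integral>z. jp p (incr u z) * incr v z \<partial>frac_measure s p)"
proof -
  note [measurable] = incr_measurable[OF assms(1)] incr_measurable[OF assms(2)]
  have "plap_pairing s p u v
      = (\<integral>z. frac_kernel s p z *\<^sub>R (jp p (incr u z) * incr v z) \<partial>lebesgue)"
    unfolding plap_pairing_def
    by (intro Bochner_Integration.integral_cong)
      (simp_all add: incr_def frac_kernel_def jp_def case_prod_beta)
  also have "\<dots> = (\<integral>z. jp p (incr u z) * incr v z \<partial>frac_measure s p)"
    unfolding frac_measure_def
    by (rule integral_density[symmetric]) (auto simp: frac_kernel_nonneg)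
  finally show ?thesis .
qed

lemma abs_add_powr_le:
  fixes a b p :: real
  assumes "p > 0"
  shows "\<bar>a + b\<bar> powr p \<le> 2 powr p * (\<bar>a\<bar> powr p + \<bar>b\<bar> powr p)"
proof -
  have "\<bar>a + b\<bar> powr p \<le> (2 * max \<bar>a\<bar> \<bar>b\<bar>) powr p"
    using assms by (intro powr_mono2) auto
  also have "\<dots> = 2 powr p * max \<bar>a\<bar> \<bar>b\<bar> powr p" by (simp add: powr_mult)
  also have "\<dots> \<le> 2 powr p * (\<bar>a\<bar> powr p + \<bar>b\<bar> powr p)"
    by (intro mult_left_mono) (auto simp: max_def)
  finally show ?thesis .
qed

lemma nn_integral_abs_add_powr_le:
  assumes p: "p > 0" and [measurable]: "f \<in> borel_measurable M" "g \<in> borel_measurable M"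
  shows "(\<integral>\<^sup>+z. ennreal (\<bar>f z + g z\<bar> powr p) \<partial>M) \<le> ennreal (2 powr p) *
    ((\<integral>\<^sup>+z. ennreal (\<bar>f z\<bar> powr p) \<partial>M) + (\<integral>\<^sup>+z. ennreal (\<bar>g z\<bar> powr p) \<partial>M))"
proof -
  have "(\<integral>\<^sup>+z. ennreal (\<bar>f z + g z\<bar> powr p) \<partial>M)
      \<le> (\<integral>\<^sup>+z. ennreal (2 powr p) * (ennreal (\<bar>f z\<bar> powr p) + ennreal (\<bar>g z\<bar> powr p)) \<partial>M)"
    using abs_add_powr_le[OF p]
    by (intro nn_integral_mono) (simp add: ennreal_plus[symmetric] ennreal_mult'[symmetric] ennreal_leI del: ennreal_plus)
  also have "\<dots> = ennreal (2 powr p) *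
    ((\<integral>\<^sup>+z. ennreal (\<bar>f z\<bar> powr p) \<partial>M) + (\<integral>\<^sup>+z. ennreal (\<bar>g z\<bar> powr p) \<partial>M))"
    by (simp add: nn_integral_cmult nn_integral_add)
  finally show ?thesis .
qed

lemma incr_add: "incr (\<lambda>x. u x + v x) z = incr u z + incr v z"
  and incr_diff: "incr (\<lambda>x. u x - v x) z = incr u z - incr v z"
  and incr_scale: "incr (\<lambda>x. c * u x) z = c * incr u z"
  by (simp_all add: incr_def algebra_simps)

lemma gagliardo_integral_add_le:
  assumes "p > 0" "u \<in> borel_measurable lebesgue" "v \<in> borel_measurable lebesgue"
  shows "gagliardo_integral s p (\<lambda>x. u x + v x)
    \<le> ennreal (2 powr p) * (gagliardo_integral s p u + gagliardo_integral s p v)"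
  using nn_integral_abs_add_powr_le[OF assms(1) incr_measurable_frac[OF assms(2)]
      incr_measurable_frac[OF assms(3)]] assms
  by (simp add: gagliardo_integral_eq incr_add)

lemma gagliardo_integral_scale:
  assumes "u \<in> borel_measurable lebesgue"
  shows "gagliardo_integral s p (\<lambda>x. c * u x) = ennreal (\<bar>c\<bar> powr p) * gagliardo_integral s p u"
proof -
  note incr_measurable_frac[OF assms, measurable]
  show ?thesis
    using assms by (simp add: gagliardo_integral_eq incr_scale abs_mult powr_mult ennreal_mult'
        nn_integral_cmult)
qed

lemma gagliardo_integral_mono:
  assumes "p > 0" "u \<in> borel_measurable lebesgue" "v \<in> borel_measurable lebesgue"
    "\<And>x y. \<bar>u x - u y\<bar> \<le> \<bar>v x - v y\<bar>"
  shows "gagliardo_integral s p u \<le> gagliardo_integral s p v"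
  using assms by (simp add: gagliardo_integral_eq incr_def nn_integral_mono ennreal_leI powr_mono2)

lemma gagliardo_integral_diff_swap:
  assumes "u \<in> borel_measurable lebesgue" "v \<in> borel_measurable lebesgue"
  shows "gagliardo_integral s p (\<lambda>x. u x - v x) = gagliardo_integral s p (\<lambda>x. v x - u x)"
proof -
  have "\<bar>incr (\<lambda>x. u x - v x) z\<bar> = \<bar>incr (\<lambda>x. v x - u x) z\<bar>" for z
    by (simp add: incr_def)
  then show ?thesis using assms by (simp add: gagliardo_integral_eq)
qed

lemma gagliardo_powr:
  assumes "p > 0"
  shows "gagliardo s p u powr p = enn2real (gagliardo_integral s p u)"
  using assms by (simp add: gagliardo_def powr_powr)

lemma test_functions_outside: "f \<in> test_functions \<Omega> \<Longrightarrow> x \<notin> \<Omega> \<Longrightarrow> f x = 0"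
  using test_functionsE[of f \<Omega>] by blast

lemma test_functions_measurable:
  "f \<in> test_functions \<Omega> \<Longrightarrow> f \<in> borel_measurable lebesgue"
  using borel_measurable_continuous_onI[OF test_functions_continuous]
  by (intro measurable_completion) simp

lemma enn2real_tendsto_0_iff:
  "(\<lambda>n. enn2real (f n)) \<longlonglongrightarrow> 0 \<longleftrightarrow> f \<longlonglongrightarrow> 0" if "\<And>n. f n < \<infinity>" for f :: "nat \<Rightarrow> ennreal"
proof -
  have "(\<lambda>n. ennreal (enn2real (f n))) \<longlonglongrightarrow> ennreal 0 \<longleftrightarrow> (\<lambda>n. enn2real (f n)) \<longlonglongrightarrow> 0"
    by (intro tendsto_ennreal_iff) auto
  then show ?thesis using that by simp
qed

section \<open>Poincare inequality, finite energy of test functions, and a criterion for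
  membership\<close>

locale frac_sobolev =
  fixes s p :: real and \<Omega> :: "'a::euclidean_space set"
  assumes s: "0 < s" "s < 1" and p: "1 < p"
    and open_\<Omega>: "open \<Omega>" and bounded_\<Omega>: "bounded \<Omega>"
begin

abbreviation G :: "('a \<Rightarrow> real) \<Rightarrow> ennreal" where "G \<equiv> gagliardo_integral s p"

abbreviation \<nu> :: "('a \<times> 'a) measure" where "\<nu> \<equiv> frac_measure s p"

lemma p0: "p > 0" using p by simp

text \<open>Every \<open>x\<close> in \<open>\<Omega>\<close> interacts with a fixed ball
  \<open>A\<close> outside \<open>\<Omega>\<close>, where \<open>u\<close> vanishes: there the
  increment is \<open>u x\<close> itself and the kernel is bounded below. Integrating over
  \<open>y\<close> in \<open>A\<close> and then over \<open>x\<close> gives the estimate.\<close>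

lemma poincare:
  obtains C where "C > 0" "\<And>u. u \<in> borel_measurable lebesgue \<Longrightarrow>
    AE x in lebesgue. x \<notin> \<Omega> \<longrightarrow> u x = 0 \<Longrightarrow> lp_integral p u \<le> ennreal C * G u"
proof -
  obtain R where R: "R > 0" "\<And>x. x \<in> \<Omega> \<Longrightarrow> norm x < R"
    using bounded_\<Omega> by (meson bounded_pos_less)
  obtain b :: 'a where b: "b \<in> Basis" using nonempty_Basis by blast
  \<comment> \<open>Its points have norm strictly above \<open>R\<close> and at most
    \<open>3 * R\<close>, so the ball misses \<open>\<Omega>\<close> and has distance at most
    \<open>4 * R\<close> from each point of it.\<close>
  define A where "A = ball ((2 * R) *\<^sub>R b) R"
  have A: "A \<in> lmeasurable" "measure lebesgue A > 0"
    using R by (auto simp: A_def)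
  have nA: "norm (x - y) \<le> 4 * R" "x \<noteq> y" "y \<notin> \<Omega>" if "x \<in> \<Omega>" "y \<in> A" for x y
  proof -
    have 1: "norm ((2 * R) *\<^sub>R b - y) < R" using that by (simp add: A_def dist_norm)
    have 2: "norm ((2 * R) *\<^sub>R b) = 2 * R" using b R by simp
    have 3: "norm y \<le> 3 * R" "norm y > R"
      using norm_triangle_ineq4[of "(2 * R) *\<^sub>R b" "(2 * R) *\<^sub>R b - y"]
        norm_triangle_ineq2[of "(2 * R) *\<^sub>R b" y] norm_triangle_ineq[of "y" "(2 * R) *\<^sub>R b - y"] 1 2
      by auto
    show "norm (x - y) \<le> 4 * R" "x \<noteq> y" "y \<notin> \<Omega>"
      using norm_triangle_ineq4[of x y] 3 R(2)[OF that(1)] R(2)[of y] by auto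
  qed
  define k where "k = 1 / (4 * R) powr (real DIM('a) + s * p) * measure lebesgue A"
  have k: "k > 0" using R A by (simp add: k_def)
  have main: "ennreal k * lp_integral p u \<le> G u"
    if u: "u \<in> borel_measurable lebesgue" "AE x in lebesgue. x \<notin> \<Omega> \<longrightarrow> u x = 0" for u
  proof -
    note [measurable] = incr_measurable[OF u(1)] u(1) frac_kernel_measurable
    have "AE x in lebesgue. ennreal k * ennreal (\<bar>u x\<bar> powr p)
        \<le> (\<integral>\<^sup>+y. ennreal (frac_kernel s p (x, y)) * ennreal (\<bar>incr u (x, y)\<bar> powr p) \<partial>lebesgue)"
      using u(2)
    proof eventually_elim
      fix x assume x: "x \<notin> \<Omega> \<longrightarrow> u x = 0"
      show "ennreal k * ennreal (\<bar>u x\<bar> powr p)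
        \<le> (\<integral>\<^sup>+y. ennreal (frac_kernel s p (x, y)) * ennreal (\<bar>incr u (x, y)\<bar> powr p) \<partial>lebesgue)"
      proof (cases "x \<in> \<Omega>")
        case True
        have "ennreal k * ennreal (\<bar>u x\<bar> powr p)
          = ennreal (1 / (4 * R) powr (real DIM('a) + s * p) * \<bar>u x\<bar> powr p) * emeasure lebesgue A"
          using A by (simp add: k_def emeasure_eq_measure2 ennreal_mult'[symmetric] mult_ac)
        also have "\<dots> = (\<integral>\<^sup>+y. ennreal (1 / (4 * R) powr (real DIM('a) + s * p) * \<bar>u x\<bar> powr p) * indicator A y \<partial>lebesgue)"
          using A by (subst nn_integral_cmult_indicator) auto
        also have "\<dots> \<le> (\<integral>\<^sup>+y. ennreal (frac_kernel s p (x, y)) * ennreal (\<bar>incr u (x, y)\<bar> powr p) \<partial>lebesgue)"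
        proof (rule nn_integral_mono_AE)
          show "AE y in lebesgue. ennreal (1 / (4 * R) powr (real DIM('a) + s * p) * \<bar>u x\<bar> powr p) * indicator A y
            \<le> ennreal (frac_kernel s p (x, y)) * ennreal (\<bar>incr u (x, y)\<bar> powr p)"
            using u(2)
          proof eventually_elim
            fix y assume y: "y \<notin> \<Omega> \<longrightarrow> u y = 0"
            show "ennreal (1 / (4 * R) powr (real DIM('a) + s * p) * \<bar>u x\<bar> powr p) * indicator A y
            \<le> ennreal (frac_kernel s p (x, y)) * ennreal (\<bar>incr u (x, y)\<bar> powr p)"
            proof (cases "y \<in> A")
              case yA: True
              have "1 / (4 * R) powr (real DIM('a) + s * p) \<le> frac_kernel s p (x, y)"
                using nA[OF True yA] s p by (intro frac_kernel_ge) auto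
              moreover have "incr u (x, y) = u x" using y nA[OF True yA] by (simp add: incr_def)
              ultimately show ?thesis using yA
                by (simp add: ennreal_mult'[symmetric] frac_kernel_nonneg ennreal_leI mult_right_mono
                    del: times_divide_eq_left)
            qed simp
          qed
        qed
        finally show ?thesis .
      qed (use x p in simp)
    qed
    then have "(\<integral>\<^sup>+x. ennreal k * ennreal (\<bar>u x\<bar> powr p) \<partial>lebesgue)
      \<le> (\<integral>\<^sup>+x. (\<integral>\<^sup>+y. ennreal (frac_kernel s p (x, y)) * ennreal (\<bar>incr u (x, y)\<bar> powr p) \<partial>lebesgue) \<partial>lebesgue)"
      by (rule nn_integral_mono_AE)
    also have "\<dots> = G u"
      using u(1) by (subst nn_integral_lebesgue_fst[symmetric])
        (auto simp: gagliardo_integral_eq nn_integral_frac_measure)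
    finally show ?thesis
      by (simp add: lp_integral_def nn_integral_cmult)
  qed
  have "lp_integral p u \<le> ennreal (1 / k) * G u"
    if "u \<in> borel_measurable lebesgue" "AE x in lebesgue. x \<notin> \<Omega> \<longrightarrow> u x = 0" for u
  proof -
    have "ennreal (1 / k) * (ennreal k * lp_integral p u) \<le> ennreal (1 / k) * G u"
      by (intro mult_left_mono main that) auto
    then show ?thesis using k by (simp add: mult.assoc[symmetric] ennreal_mult'[symmetric])
  qed
  then show ?thesis using that[of "1 / k"] k by simp
qed

text \<open>For each fixed \<open>x\<close> the integral over \<open>y\<close> is bounded uniformly
  by the kernel estimate for a bounded Lipschitz function, so integrating over \<open>x\<close> in
  \<open>D\<close> costs only the measure of \<open>D\<close>. The pairs with second coordinate in
  \<open>D\<close> follow by symmetry. The linear dependence on the measure drives the later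
  Caccioppoli estimate.\<close>

lemma incr_integral_near:
  assumes gm: "g \<in> borel_measurable lebesgue" and M: "\<And>x. \<bar>g x\<bar> \<le> M"
    and L: "L \<ge> 0" "\<And>x y :: 'a. \<bar>g x - g y\<bar> \<le> L * norm (x - y)"
  obtains C where "C > 0" "\<And>D. D \<in> lmeasurable \<Longrightarrow>
    (\<integral>\<^sup>+z. ennreal (\<bar>incr g z\<bar> powr p) * indicator {z. fst z \<in> D \<or> snd z \<in> D} z \<partial>\<nu>)
      \<le> ennreal (C * measure lebesgue D)"
proof -
  have M0: "0 \<le> 2 * M" using M[of undefined] by simp
  obtain C where C: "C > 0" "\<And>x :: 'a.
    (\<integral>\<^sup>+y. ennreal (min (L * norm (x - y)) (2 * M) powr p * frac_kernel s p (x, y)) \<partial>lebesgue) \<le> ennreal C"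
    using frac_kernel_integral_bound[OF s p0 L(1) M0] by blast
  define F where "F z = ennreal (frac_kernel s p z) * ennreal (\<bar>incr g z\<bar> powr p)" for z
  note [measurable] = incr_measurable[OF gm] frac_kernel_measurable
  have Fm [measurable]: "F \<in> borel_measurable lebesgue" unfolding F_def by measurable
  have Fle: "F (x, y) \<le> ennreal (min (L * norm (x - y)) (2 * M) powr p * frac_kernel s p (x, y))" for x y
  proof -
    have "\<bar>incr g (x, y)\<bar> \<le> min (L * norm (x - y)) (2 * M)"
      using L(2)[of x y] M[of x] M[of y] by (auto simp: incr_def)
    then have "\<bar>incr g (x, y)\<bar> powr p \<le> min (L * norm (x - y)) (2 * M) powr p"
      using p by (intro powr_mono2) auto
    then show ?thesis
      unfolding F_def by (simp add: ennreal_mult'[symmetric] frac_kernel_nonneg mult.commute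
          ennreal_leI mult_left_mono)
  qed
  have F1: "(\<integral>\<^sup>+y. F (x, y) \<partial>lebesgue) \<le> ennreal C" for x
    using nn_integral_mono[of lebesgue "\<lambda>y. F (x, y)", OF Fle] C(2)[of x] by (rule order_trans)
  have Fsw: "F (x, y) = F (y, x)" for x y
    by (simp add: F_def incr_def frac_kernel_swap[of s p x y] abs_minus_commute)
  have F2: "(\<integral>\<^sup>+y. F (y, x) \<partial>lebesgue) \<le> ennreal C" for x
    using F1[of x] by (simp add: Fsw[of x])
  have "(\<integral>\<^sup>+z. ennreal (\<bar>incr g z\<bar> powr p) * indicator {z. fst z \<in> D \<or> snd z \<in> D} z \<partial>\<nu>)
      \<le> ennreal (2 * C * measure lebesgue D)" if D: "D \<in> lmeasurable" for D
  proof -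
    have [measurable]: "D \<in> sets lebesgue" using D by auto
    have Df [measurable]: "(\<lambda>z::'a\<times>'a. indicator D (fst z) :: ennreal) \<in> borel_measurable lebesgue"
      by (rule measurable_compose[OF measurable_fst_lebesgue]) simp
    have Ds [measurable]: "(\<lambda>z::'a\<times>'a. indicator D (snd z) :: ennreal) \<in> borel_measurable lebesgue"
      by (rule measurable_compose[OF measurable_snd_lebesgue]) simp
    have "(\<integral>\<^sup>+z. ennreal (\<bar>incr g z\<bar> powr p) * indicator {z. fst z \<in> D \<or> snd z \<in> D} z \<partial>\<nu>)
      \<le> (\<integral>\<^sup>+z. ennreal (\<bar>incr g z\<bar> powr p) * (indicator D (fst z) + indicator D (snd z)) \<partial>\<nu>)"
      by (intro nn_integral_mono mult_left_mono) (auto simp: indicator_def)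
    also have "\<dots> = (\<integral>\<^sup>+z. F z * indicator D (fst z) + F z * indicator D (snd z) \<partial>lebesgue)"
      by (subst nn_integral_frac_measure) (auto simp: F_def algebra_simps)
    also have "\<dots> = (\<integral>\<^sup>+z. F z * indicator D (fst z) \<partial>lebesgue) + (\<integral>\<^sup>+z. F z * indicator D (snd z) \<partial>lebesgue)"
      by (rule nn_integral_add) measurable
    also have "(\<integral>\<^sup>+z. F z * indicator D (fst z) \<partial>lebesgue) \<le> ennreal (C * measure lebesgue D)"
    proof -
      have "(\<integral>\<^sup>+z. F z * indicator D (fst z) \<partial>lebesgue)
        = (\<integral>\<^sup>+x. (\<integral>\<^sup>+y. F (x, y) * indicator D x \<partial>lebesgue) \<partial>lebesgue)"
        by (subst nn_integral_lebesgue_fst) auto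
      also have "\<dots> \<le> (\<integral>\<^sup>+x. ennreal C * indicator D x \<partial>lebesgue)"
        using F1 by (intro nn_integral_mono) (auto simp: indicator_def)
      also have "\<dots> = ennreal (C * measure lebesgue D)"
        using C D by (simp add: nn_integral_cmult_indicator emeasure_eq_measure2 ennreal_mult'[symmetric])
      finally show ?thesis .
    qed
    also have "(\<integral>\<^sup>+z. F z * indicator D (snd z) \<partial>lebesgue) \<le> ennreal (C * measure lebesgue D)"
    proof -
      have "(\<integral>\<^sup>+z. F z * indicator D (snd z) \<partial>lebesgue)
        = (\<integral>\<^sup>+x. (\<integral>\<^sup>+y. F (y, x) * indicator D x \<partial>lebesgue) \<partial>lebesgue)"
        by (subst nn_integral_lebesgue_snd) auto
      also have "\<dots> \<le> (\<integral>\<^sup>+x. ennreal C * indicator D x \<partial>lebesgue)"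
        using F2 by (intro nn_integral_mono) (auto simp: indicator_def)
      also have "\<dots> = ennreal (C * measure lebesgue D)"
        using C D by (simp add: nn_integral_cmult_indicator emeasure_eq_measure2 ennreal_mult'[symmetric])
      finally show ?thesis .
    qed
    also have "ennreal (C * measure lebesgue D) + ennreal (C * measure lebesgue D) = ennreal (2 * C * measure lebesgue D)"
      using C by (simp add: ennreal_plus[symmetric] del: ennreal_plus)
    finally show ?thesis by (simp add: add_mono)
  qed
  then show ?thesis using that[of "2 * C"] C by simp
qed

lemma test_function_gagliardo_finite:
  assumes "f \<in> test_functions \<Omega>"
  shows "G f < \<infinity>"
proof -
  obtain K where K: "compact K" "\<forall>x. f x \<noteq> 0 \<longrightarrow> x \<in> K" using test_functionsE[OF assms] by blast
  obtain M where M: "\<And>x. \<bar>f x\<bar> \<le> M" using test_functions_bounded[OF assms] by blast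
  obtain L where L: "L > 0" "\<And>x y. \<bar>f x - f y\<bar> \<le> L * norm (x - y)" using test_functions_lipschitz[OF assms] by blast
  have fm: "f \<in> borel_measurable lebesgue" by (rule test_functions_measurable[OF assms])
  obtain C where C: "C > 0" "\<And>D. D \<in> lmeasurable \<Longrightarrow>
    (\<integral>\<^sup>+z. ennreal (\<bar>incr f z\<bar> powr p) * indicator {z. fst z \<in> D \<or> snd z \<in> D} z \<partial>\<nu>)
      \<le> ennreal (C * measure lebesgue D)"
    using incr_integral_near[OF fm M less_imp_le[OF L(1)] L(2)] by blast
  have z: "f x = 0" if "x \<notin> K" for x using K(2) that by blast
  have "G f = (\<integral>\<^sup>+z. ennreal (\<bar>incr f z\<bar> powr p) * indicator {z. fst z \<in> K \<or> snd z \<in> K} z \<partial>\<nu>)"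
    unfolding gagliardo_integral_eq[OF fm] using z p
    by (intro nn_integral_cong) (auto simp: indicator_def incr_def)
  also have "\<dots> < \<infinity>" using C(2)[OF lmeasurable_compact[OF K(1)]]
    by (rule order_le_less_trans) simp
  finally show ?thesis .
qed

lemma test_function_lp_finite:
  assumes "f \<in> test_functions \<Omega>"
  shows "lp_integral p f < \<infinity>"
proof -
  obtain C where "C > 0" "\<And>u. u \<in> borel_measurable lebesgue \<Longrightarrow>
    AE x in lebesgue. x \<notin> \<Omega> \<longrightarrow> u x = 0 \<Longrightarrow> lp_integral p u \<le> ennreal C * G u"
    using poincare by blast
  moreover have "AE x in lebesgue. x \<notin> \<Omega> \<longrightarrow> f x = 0"
    using test_functions_outside[OF assms] by (intro AE_I2) blast
  ultimately have "lp_integral p f \<le> ennreal C * G f"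
    using test_functions_measurable[OF assms] by blast
  also have "\<dots> < \<infinity>" using test_function_gagliardo_finite[OF assms]
    by (simp add: ennreal_mult_less_top)
  finally show ?thesis .
qed

lemma Wsp_iff:
  "u \<in> Wsp s p \<longleftrightarrow> u \<in> borel_measurable lebesgue \<and> lp_integral p u < \<infinity> \<and> G u < \<infinity>"
proof -
  have "integrable lebesgue (\<lambda>x. \<bar>u x\<bar> powr p) \<longleftrightarrow> lp_integral p u < \<infinity>"
    if [measurable]: "u \<in> borel_measurable lebesgue"
    unfolding lp_integral_def integrable_iff_bounded by simp
  then show ?thesis
    unfolding Wsp_def Lp_space_def set_borel_measurable_def set_integrable_def by simp blast
qed

lemma Wsp_norm_powr:
  assumes "u \<in> Wsp s p"
  shows "Wsp_norm s p u powr p = enn2real (G u + lp_integral p u)"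
proof -
  have um [measurable]: "u \<in> borel_measurable lebesgue" using assms by (simp add: Wsp_iff)
  have "(LINT x:UNIV|lebesgue. \<bar>u x\<bar> powr p) = enn2real (lp_integral p u)"
    by (simp add: lp_integral_def set_lebesgue_integral_def integral_eq_nn_integral)
  then have "Lp_norm p UNIV u powr p = enn2real (lp_integral p u)"
    using p by (simp add: Lp_norm_def powr_powr)
  then have "Wsp_norm s p u powr p = enn2real (G u) + enn2real (lp_integral p u)"
    using p by (simp add: Wsp_norm_def powr_powr gagliardo_powr)
  also have "\<dots> = enn2real (G u + lp_integral p u)"
    using assms by (simp add: Wsp_iff enn2real_plus)
  finally show ?thesis .
qed

lemma Wsp_norm_nonneg: "Wsp_norm s p u \<ge> 0"
  by (simp add: Wsp_norm_def)

lemma Wsp_norm_tendsto_0_iff: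
  assumes "\<And>n. u n \<in> Wsp s p"
  shows "(\<lambda>n. Wsp_norm s p (u n)) \<longlonglongrightarrow> 0 \<longleftrightarrow> (\<lambda>n. G (u n) + lp_integral p (u n)) \<longlonglongrightarrow> 0"
proof -
  have eq: "enn2real (G (u n) + lp_integral p (u n)) = Wsp_norm s p (u n) powr p" for n
    using Wsp_norm_powr[OF assms] by simp
  have "(\<lambda>n. G (u n) + lp_integral p (u n)) \<longlonglongrightarrow> 0 \<longleftrightarrow> (\<lambda>n. Wsp_norm s p (u n) powr p) \<longlonglongrightarrow> 0"
    using assms by (subst enn2real_tendsto_0_iff[symmetric]) (auto simp: Wsp_iff eq)
  moreover have "(\<lambda>n. Wsp_norm s p (u n) powr p) \<longlonglongrightarrow> 0 \<longleftrightarrow> (\<lambda>n. Wsp_norm s p (u n)) \<longlonglongrightarrow> 0"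
  proof
    assume "(\<lambda>n. Wsp_norm s p (u n) powr p) \<longlonglongrightarrow> 0"
    then have "(\<lambda>n. (Wsp_norm s p (u n) powr p) powr (1 / p)) \<longlonglongrightarrow> 0 powr (1 / p)"
      using p by (intro tendsto_powr') auto
    then show "(\<lambda>n. Wsp_norm s p (u n)) \<longlonglongrightarrow> 0"
      using p by (simp add: powr_powr Wsp_norm_nonneg)
  next
    assume "(\<lambda>n. Wsp_norm s p (u n)) \<longlonglongrightarrow> 0"
    then have "(\<lambda>n. Wsp_norm s p (u n) powr p) \<longlonglongrightarrow> 0 powr p"
      using p by (intro tendsto_powr') (auto simp: Wsp_norm_nonneg)
    then show "(\<lambda>n. Wsp_norm s p (u n) powr p) \<longlonglongrightarrow> 0" by simp
  qed
  ultimately show ?thesis by simp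
qed

lemma Wsp_diff:
  fixes u v :: "'a \<Rightarrow> real"
  assumes u: "u \<in> Wsp s p" and v: "v \<in> Wsp s p"
  shows "(\<lambda>x. u x - v x) \<in> Wsp s p"
proof -
  have m [measurable]: "u \<in> borel_measurable lebesgue" "v \<in> borel_measurable lebesgue" using u v by (auto simp: Wsp_iff)
  have m': "(\<lambda>x. (-1) * v x) \<in> borel_measurable lebesgue" by measurable
  have "G (\<lambda>x. u x + (-1) * v x) \<le> ennreal (2 powr p) * (G u + G (\<lambda>x. (-1) * v x))"
    by (rule gagliardo_integral_add_le[OF p0 m(1) m'])
  also have "\<dots> < \<infinity>" using u v gagliardo_integral_scale[OF m(2), of s p "-1"]
    by (simp add: Wsp_iff ennreal_mult_less_top)
  finally have "G (\<lambda>x. u x - v x) < \<infinity>" by simp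
  moreover have "lp_integral p (\<lambda>x. u x + - v x) \<le> ennreal (2 powr p) * (lp_integral p u + lp_integral p (\<lambda>x. - v x))"
    unfolding lp_integral_def by (rule nn_integral_abs_add_powr_le[OF p0]) measurable
  then have "lp_integral p (\<lambda>x. u x - v x) < \<infinity>" using u v
    by (simp add: Wsp_iff lp_integral_def ennreal_mult_less_top order_le_less_trans)
  ultimately show ?thesis by (simp add: Wsp_iff)
qed

lemma test_functions_Wsp: "f \<in> test_functions \<Omega> \<Longrightarrow> f \<in> Wsp s p"
  using test_function_lp_finite test_function_gagliardo_finite test_functions_measurable
  by (auto simp: Wsp_iff)

lemma lp_integral_eq_0D:
  assumes "lp_integral p u = 0" "u \<in> borel_measurable lebesgue"
  shows "AE x in lebesgue. u x = 0"
proof -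
  have "AE x in lebesgue. ennreal (\<bar>u x\<bar> powr p) = 0"
    using assms unfolding lp_integral_def by (subst (asm) nn_integral_0_iff_AE) auto
  then show ?thesis by eventually_elim (simp add: ennreal_eq_0_iff)
qed

text \<open>By the Poincare inequality only the Gagliardo seminorm matters on functions vanishing outside \<open>\<Omega>\<close>.\<close>

lemma W0sp_iff:
  "u \<in> W0sp s p \<Omega> \<longleftrightarrow> u \<in> borel_measurable lebesgue \<and> G u < \<infinity> \<and>
    (AE x in lebesgue. x \<notin> \<Omega> \<longrightarrow> u x = 0) \<and>
    (\<exists>\<phi>. (\<forall>n::nat. \<phi> n \<in> test_functions \<Omega>) \<and> (\<lambda>n. G (\<lambda>x. \<phi> n x - u x)) \<longlonglongrightarrow> 0)"
    (is "?l \<longleftrightarrow> ?r")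
proof
  assume ?l
  then obtain \<phi> where u: "u \<in> Wsp s p" and \<phi>: "\<And>n::nat. \<phi> n \<in> test_functions \<Omega>"
    and lim: "(\<lambda>n. Wsp_norm s p (\<lambda>x. \<phi> n x - u x)) \<longlonglongrightarrow> 0"
    by (auto simp: W0sp_def)
  have um [measurable]: "u \<in> borel_measurable lebesgue" using u by (simp add: Wsp_iff)
  have lim': "(\<lambda>n. G (\<lambda>x. \<phi> n x - u x) + lp_integral p (\<lambda>x. \<phi> n x - u x)) \<longlonglongrightarrow> 0"
    using lim by (subst (asm) Wsp_norm_tendsto_0_iff) (auto intro: Wsp_diff test_functions_Wsp \<phi> u)
  have l1: "(\<lambda>n. G (\<lambda>x. \<phi> n x - u x)) \<longlonglongrightarrow> 0"
    by (rule tendsto_sandwich[OF _ _ tendsto_const lim']) auto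
  have l2: "(\<lambda>n. lp_integral p (\<lambda>x. \<phi> n x - u x)) \<longlonglongrightarrow> 0"
    by (rule tendsto_sandwich[OF _ _ tendsto_const lim']) auto
  have \<Omega>m [measurable]: "\<Omega> \<in> sets lebesgue" using open_\<Omega> by simp
  \<comment> \<open>Outside \<open>\<Omega>\<close> every approximating test function is
    \<open>0\<close>, so there the approximation error is \<open>u\<close> itself.\<close>
  have "lp_integral p (\<lambda>x. indicator (- \<Omega>) x * u x) \<le> lp_integral p (\<lambda>x. \<phi> n x - u x)" for n
    unfolding lp_integral_def
  proof (intro nn_integral_mono ennreal_leI powr_mono2)
    fix x show "\<bar>indicator (- \<Omega>) x * u x\<bar> \<le> \<bar>\<phi> n x - u x\<bar>"
      using test_functions_outside[OF \<phi>, of x n] by (auto simp: indicator_def)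
  qed (use p in auto)
  then have "lp_integral p (\<lambda>x. indicator (- \<Omega>) x * u x) \<le> 0"
    by (intro LIMSEQ_le_const[OF l2]) auto
  then have "AE x in lebesgue. indicator (- \<Omega>) x * u x = 0"
    by (intro lp_integral_eq_0D) auto
  then have "AE x in lebesgue. x \<notin> \<Omega> \<longrightarrow> u x = 0"
    by eventually_elim (auto simp: indicator_def)
  then show ?r using u \<phi> l1 by (auto simp: Wsp_iff)
next
  assume r: ?r
  then obtain \<phi> where \<phi>: "\<And>n::nat. \<phi> n \<in> test_functions \<Omega>" "(\<lambda>n. G (\<lambda>x. \<phi> n x - u x)) \<longlonglongrightarrow> 0" by blast
  have um [measurable]: "u \<in> borel_measurable lebesgue" and Gu: "G u < \<infinity>"
    and u0: "AE x in lebesgue. x \<notin> \<Omega> \<longrightarrow> u x = 0" using r by auto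
  obtain C where C: "C > 0" "\<And>u. u \<in> borel_measurable lebesgue \<Longrightarrow>
    AE x in lebesgue. x \<notin> \<Omega> \<longrightarrow> u x = 0 \<Longrightarrow> lp_integral p u \<le> ennreal C * G u"
    using poincare by blast
  have "lp_integral p u \<le> ennreal C * G u" by (rule C(2)[OF um u0])
  also have "\<dots> < \<infinity>" using Gu by (simp add: ennreal_mult_less_top)
  finally have u: "u \<in> Wsp s p" using Gu by (simp add: Wsp_iff)
  have \<phi>m [measurable]: "\<phi> n \<in> borel_measurable lebesgue" for n using \<phi>(1) by (rule test_functions_measurable)
  have le: "lp_integral p (\<lambda>x. \<phi> n x - u x) \<le> ennreal C * G (\<lambda>x. \<phi> n x - u x)" for n
  proof (rule C(2))
    show "AE x in lebesgue. x \<notin> \<Omega> \<longrightarrow> \<phi> n x - u x = 0"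
      using u0 by eventually_elim (use test_functions_outside[OF \<phi>(1)] in auto)
  qed measurable
  define g where "g n = G (\<lambda>x. \<phi> n x - u x)" for n
  have g: "g \<longlonglongrightarrow> 0" using \<phi>(2) by (simp add: g_def[abs_def])
  have Cg: "(\<lambda>n. ennreal C * g n) \<longlonglongrightarrow> ennreal C * 0"
    by (rule ennreal_tendsto_cmult[OF _ g]) simp
  have "(\<lambda>n. g n + ennreal C * g n) \<longlonglongrightarrow> 0"
    using tendsto_add[OF g Cg] by simp
  then have "(\<lambda>n. G (\<lambda>x. \<phi> n x - u x) + lp_integral p (\<lambda>x. \<phi> n x - u x)) \<longlonglongrightarrow> 0"
    by (rule tendsto_sandwich[OF _ _ tendsto_const, rotated 2])
      (use le in \<open>simp_all add: g_def add_left_mono\<close>)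
  then have "(\<lambda>n. Wsp_norm s p (\<lambda>x. \<phi> n x - u x)) \<longlonglongrightarrow> 0"
    by (subst Wsp_norm_tendsto_0_iff) (auto intro: Wsp_diff test_functions_Wsp \<phi> u)
  then show ?l using u \<phi> by (auto simp: W0sp_def)
qed

end

declare incr_measurable [measurable] incr_measurable_frac [measurable]

section \<open>Pointwise inequalities for the power nonlinearity\<close>

lemma jp_nonneg: "a \<ge> 0 \<Longrightarrow> jp p a = a powr (p - 1)"
  by (cases "a = 0") (simp_all add: jp_def powr_mult_base mult.commute)

lemma jp_minus: "jp p (- a) = - jp p a"
  by (simp add: jp_def)

lemma abs_jp: "\<bar>jp p a\<bar> = \<bar>a\<bar> powr (p - 1)"
  by (cases "a = 0") (simp_all add: jp_def abs_mult powr_mult_base mult.commute)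

lemma jp_mult_self: "jp p a * a = \<bar>a\<bar> powr p"
proof -
  have "jp p a * a = \<bar>a\<bar> powr (p - 2) * \<bar>a\<bar> powr 2"
    by (simp add: jp_def power2_eq_square)
  also have "\<dots> = \<bar>a\<bar> powr p" by (simp only: powr_add[symmetric]) simp
  finally show ?thesis .
qed

lemma jp_less:
  assumes "p > 1" "a < b"
  shows "jp p a < jp p b"
proof -
  have pos: "jp p a < jp p b" if "0 \<le> a" "a < b" for a b
    using that assms(1) by (simp add: jp_nonneg powr_less_mono2)
  have sgn: "jp p a \<ge> 0 \<longleftrightarrow> a \<ge> 0" for a
    by (auto simp: jp_def zero_le_mult_iff)
  consider "0 \<le> a" | "a < 0" "0 < b" | "b \<le> 0" using assms by linarith
  then show ?thesis
  proof cases
    case 1 then show ?thesis using pos assms by blast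
  next
    case 2
    then show ?thesis using sgn[of a] sgn[of b] by simp
  next
    case 3
    then show ?thesis using pos[of "- b" "- a"] assms by (simp add: jp_minus)
  qed
qed

lemma jp_mono: "p > 1 \<Longrightarrow> a \<le> b \<Longrightarrow> jp p a \<le> jp p b"
  using jp_less[of p a b] by (cases "a = b") auto

text \<open>A Young inequality with free parameter, read off by comparing
  \<open>\<bar>b\<bar>\<close> with \<open>d * \<bar>a\<bar>\<close>. Letting the energy of
  \<open>b\<close> tend to \<open>0\<close> first and \<open>d\<close> afterwards makes the bound
  vanish although the energy of \<open>a\<close> stays fixed.\<close>

lemma jp_mult_le_delta:
  assumes p: "p > 1" and d: "d > 0"
  shows "\<bar>jp p a * b\<bar> \<le> d * \<bar>a\<bar> powr p + (1 / d) powr (p - 1) * \<bar>b\<bar> powr p"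
proof (cases "\<bar>b\<bar> \<le> d * \<bar>a\<bar>")
  case True
  have "\<bar>jp p a * b\<bar> \<le> \<bar>a\<bar> powr (p - 1) * (d * \<bar>a\<bar>)"
    unfolding abs_mult abs_jp using True by (intro mult_left_mono) auto
  also have "\<dots> = d * \<bar>a\<bar> powr p"
    by (cases "a = 0") (simp_all add: powr_mult_base mult.commute mult.left_commute)
  finally show ?thesis by (rule order_trans) simp
next
  case False
  have "\<bar>a\<bar> powr (p - 1) \<le> (1 / d * \<bar>b\<bar>) powr (p - 1)"
    using False p d by (intro powr_mono2) (auto simp: field_simps)
  then have "\<bar>jp p a * b\<bar> \<le> (1 / d * \<bar>b\<bar>) powr (p - 1) * \<bar>b\<bar>"
    unfolding abs_mult abs_jp by (intro mult_right_mono) auto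
  also have "\<dots> = (1 / d) powr (p - 1) * (\<bar>b\<bar> * \<bar>b\<bar> powr (p - 1))"
    using d by (simp add: powr_mult del: times_divide_eq_left)
  also have "\<bar>b\<bar> * \<bar>b\<bar> powr (p - 1) = \<bar>b\<bar> powr p"
    by (cases "b = 0") (simp_all add: powr_mult_base)
  finally show ?thesis by (rule order_trans) (use d in simp)
qed

text \<open>Here the constants are sharp, with equality at \<open>a = b\<close>; the comparison of
  the eigenvalues with the energy would otherwise lose a factor in the limit.\<close>

lemma jp_mult_le_young:
  assumes p: "p > 1"
  shows "jp p a * b \<le> (1 - 1 / p) * \<bar>a\<bar> powr p + \<bar>b\<bar> powr p / p"
proof -
  define q where "q = p / (p - 1)"
  have q: "q > 1" "1 / q + 1 / p = 1" using p by (simp_all add: q_def field_simps)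
  have "jp p a * b \<le> \<bar>jp p a\<bar> * \<bar>b\<bar>" by (metis abs_ge_self abs_mult)
  also have "\<dots> \<le> \<bar>jp p a\<bar> powr q / q + \<bar>b\<bar> powr p / p"
    using q p by (intro Youngs_inequality) auto
  also have "\<bar>jp p a\<bar> powr q = \<bar>a\<bar> powr p"
    using p by (simp add: abs_jp powr_powr q_def)
  also have "\<bar>a\<bar> powr p / q = (1 - 1 / p) * \<bar>a\<bar> powr p"
    using p by (simp add: q_def field_simps)
  finally show ?thesis by simp
qed

lemma has_real_derivative_abs_powr:
  assumes p: "p > 1"
  shows "((\<lambda>x. \<bar>x\<bar> powr p) has_real_derivative p * jp p a) (at a)"
proof (cases "a = 0")
  case True
  have "((\<lambda>h::real. \<bar>h\<bar> powr (p - 1)) \<longlongrightarrow> \<bar>0\<bar> powr (p - 1)) (at 0)"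
    using p by (intro tendsto_powr' tendsto_intros) auto
  moreover have "eventually (\<lambda>h::real. \<bar>h\<bar> powr (p - 1) = \<bar>\<bar>h\<bar> powr p / h\<bar>) (at 0)"
    unfolding eventually_at_filter
    by (intro always_eventually) (auto simp: powr_diff abs_divide)
  ultimately have "((\<lambda>h::real. \<bar>\<bar>h\<bar> powr p / h\<bar>) \<longlongrightarrow> \<bar>0\<bar> powr (p - 1)) (at 0)"
    by (rule Lim_transform_eventually)
  then have "((\<lambda>h::real. \<bar>\<bar>h\<bar> powr p / h\<bar>) \<longlongrightarrow> 0) (at 0)" by simp
  then have "((\<lambda>h::real. \<bar>h\<bar> powr p / h) \<longlongrightarrow> 0) (at 0)" by (rule tendsto_rabs_zero_cancel)
  then show ?thesis using True p by (simp add: DERIV_def jp_def)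
next
  case False
  show ?thesis
  proof (cases "a > 0")
    case True
    have "((\<lambda>x. x powr p) has_real_derivative p * a powr (p - 1)) (at a)"
      by (rule has_real_derivative_powr[OF True])
    then have "((\<lambda>x. x powr p) has_real_derivative p * jp p a) (at a)"
      using True by (simp add: jp_nonneg)
    then show ?thesis
      by (rule DERIV_cong_ev[OF refl _ refl, THEN iffD1, rotated])
        (use True in \<open>auto intro!: eventually_mono[OF eventually_nhds_in_open[of "{0<..}"]]\<close>)
  next
    case neg: False
    then have a: "- a > 0" using False by simp
    have *: "((\<lambda>x. (- x) powr p) has_real_derivative (p * (- a) powr (p - 1)) * (- 1)) (at a)"
      by (rule DERIV_chain2[OF has_real_derivative_powr[OF a] DERIV_minus[OF DERIV_ident]])
    have "((\<lambda>x. (- x) powr p) has_real_derivative p * jp p a) (at a)"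
    proof -
      have "jp p a = - ((- a) powr (p - 1))" using a jp_nonneg[of "- a" p] by (simp add: jp_minus)
      then show ?thesis using * by simp
    qed
    then show ?thesis
      by (rule DERIV_cong_ev[OF refl _ refl, THEN iffD1, rotated])
        (use a in \<open>auto intro!: eventually_mono[OF eventually_nhds_in_open[of "{..<0}"]]\<close>)
  qed
qed

text \<open>Mean value bound that provides the integrable majorant for differentiating the energy
  under the integral.\<close>

lemma abs_powr_diff_le:
  fixes a h :: real
  assumes p: "p > 1"
  shows "\<bar>\<bar>a + h\<bar> powr p - \<bar>a\<bar> powr p\<bar> \<le> p * (\<bar>a\<bar> + \<bar>h\<bar>) powr (p - 1) * \<bar>h\<bar>"
proof -
  have "norm (\<bar>a + h\<bar> powr p - \<bar>a\<bar> powr p) \<le> p * (\<bar>a\<bar> + \<bar>h\<bar>) powr (p - 1) * norm ((a + h) - a)"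
  proof (rule field_differentiable_bound[where S="{min a (a + h)..max a (a + h)}" and f'="\<lambda>x. p * jp p x"])
    fix x assume x: "x \<in> {min a (a + h)..max a (a + h)}"
    show "((\<lambda>x. \<bar>x\<bar> powr p) has_field_derivative p * jp p x) (at x within {min a (a + h)..max a (a + h)})"
      by (intro DERIV_subset[OF has_real_derivative_abs_powr[OF p]]) simp
    have "\<bar>x\<bar> \<le> \<bar>a\<bar> + \<bar>h\<bar>" using x by (auto simp: min_def max_def split: if_splits)
    then show "norm (p * jp p x) \<le> p * (\<bar>a\<bar> + \<bar>h\<bar>) powr (p - 1)"
      using p by (simp add: abs_mult abs_jp powr_mono2)
  qed auto
  then show ?thesis by simp
qed

text \<open>The root is the Euclidean norm of the pair \<open>(a - l, e)\<close>, so this is the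
  reverse triangle inequality in the plane.\<close>

lemma sqrt_shift_lipschitz:
  "\<bar>sqrt ((a - l)\<^sup>2 + e\<^sup>2) - sqrt ((b - l)\<^sup>2 + e\<^sup>2)\<bar> \<le> \<bar>a - b\<bar>" for a b l e :: real
proof -
  have "\<bar>norm (a - l, e) - norm (b - l, e)\<bar> \<le> norm ((a - l, e) - (b - l, e))"
    by (rule norm_triangle_ineq3)
  then show ?thesis by (simp add: norm_Pair)
qed

text \<open>If the integrals are summable, the pointwise series is finite almost everywhere, and its
  terms tend to \<open>0\<close>.\<close>

lemma AE_tendsto_0_of_suminf:
  assumes [measurable]: "\<And>n. f n \<in> borel_measurable M"
    and "(\<Sum>n. \<integral>\<^sup>+x. ennreal (f n x) \<partial>M) < \<infinity>" and "\<And>n x. f n x \<ge> 0"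
  shows "AE x in M. (\<lambda>n. f n x) \<longlonglongrightarrow> 0"
proof -
  have "(\<integral>\<^sup>+x. (\<Sum>n. ennreal (f n x)) \<partial>M) = (\<Sum>n. \<integral>\<^sup>+x. ennreal (f n x) \<partial>M)"
    by (rule nn_integral_suminf) measurable
  then have "AE x in M. (\<Sum>n. ennreal (f n x)) \<noteq> \<infinity>"
    using assms(2) by (intro nn_integral_PInf_AE) auto
  then show ?thesis
  proof eventually_elim
    case (elim x)
    then have "summable (\<lambda>n. f n x)" using assms(3) by (intro summable_suminf_not_top) auto
    then show ?case by (rule summable_LIMSEQ_zero)
  qed
qed

lemma tendsto_0_of_abs_powr:
  assumes "(\<lambda>n. \<bar>f n\<bar> powr p) \<longlonglongrightarrow> 0" "p > 0"
  shows "f \<longlonglongrightarrow> (0::real)"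
proof -
  have "(\<lambda>n. (\<bar>f n\<bar> powr p) powr (1 / p)) \<longlonglongrightarrow> 0 powr (1 / p)"
    using assms by (intro tendsto_powr') auto
  then have "(\<lambda>n. \<bar>f n\<bar>) \<longlonglongrightarrow> 0" using assms by (simp add: powr_powr)
  then show ?thesis by (rule tendsto_rabs_zero_cancel)
qed

section \<open>Linear and lattice operations on the Sobolev space\<close>

context frac_sobolev
begin

lemma W0spD:
  assumes "u \<in> W0sp s p \<Omega>"
  shows W0sp_measurable: "u \<in> borel_measurable lebesgue"
    and W0sp_finite: "G u < \<infinity>"
    and W0sp_outside: "AE x in lebesgue. x \<notin> \<Omega> \<longrightarrow> u x = 0"
  using assms by (auto simp: W0sp_iff)

lemma test_functions_W0sp:
  assumes "f \<in> test_functions \<Omega>"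
  shows "f \<in> W0sp s p \<Omega>"
proof -
  have "G (\<lambda>x. f x - f x) = 0"
    using p by (subst gagliardo_integral_eq) (auto simp: incr_def)
  then have "\<exists>\<phi>. (\<forall>n::nat. \<phi> n \<in> test_functions \<Omega>) \<and> (\<lambda>n. G (\<lambda>x. \<phi> n x - f x)) \<longlonglongrightarrow> 0"
    using assms by (intro exI[of _ "\<lambda>n. f"]) simp
  then show ?thesis
    using test_functions_measurable[OF assms] test_function_gagliardo_finite[OF assms]
      test_functions_outside[OF assms] by (auto simp: W0sp_iff)
qed

lemma W0sp_scale:
  assumes "u \<in> W0sp s p \<Omega>"
  shows "(\<lambda>x. c * u x) \<in> W0sp s p \<Omega>"
proof -
  note um[measurable] = W0sp_measurable[OF assms]
  obtain \<phi> where \<phi>: "\<And>n::nat. \<phi> n \<in> test_functions \<Omega>" "(\<lambda>n. G (\<lambda>x. \<phi> n x - u x)) \<longlonglongrightarrow> 0"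
    using assms by (auto simp: W0sp_iff)
  have [measurable]: "\<phi> n \<in> borel_measurable lebesgue" for n by (rule test_functions_measurable[OF \<phi>(1)])
  have "G (\<lambda>x. c * \<phi> n x - c * u x) = ennreal (\<bar>c\<bar> powr p) * G (\<lambda>x. \<phi> n x - u x)" for n
    by (subst gagliardo_integral_scale[symmetric]) (auto simp: right_diff_distrib)
  moreover have "(\<lambda>n. ennreal (\<bar>c\<bar> powr p) * G (\<lambda>x. \<phi> n x - u x)) \<longlonglongrightarrow> ennreal (\<bar>c\<bar> powr p) * 0"
    by (rule ennreal_tendsto_cmult[OF _ \<phi>(2)]) simp
  ultimately have "(\<lambda>n. G (\<lambda>x. c * \<phi> n x - c * u x)) \<longlonglongrightarrow> 0" by simp
  then have "\<exists>\<psi>. (\<forall>n::nat. \<psi> n \<in> test_functions \<Omega>) \<and> (\<lambda>n. G (\<lambda>x. \<psi> n x - c * u x)) \<longlonglongrightarrow> 0"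
    using test_functions_scale[OF \<phi>(1), of c] by (intro exI[of _ "\<lambda>n x. c * \<phi> n x"]) simp
  moreover have "G (\<lambda>x. c * u x) < \<infinity>"
    using W0sp_finite[OF assms] by (simp add: gagliardo_integral_scale[OF um] ennreal_mult_less_top)
  moreover have "AE x in lebesgue. x \<notin> \<Omega> \<longrightarrow> c * u x = 0"
    using W0sp_outside[OF assms] by eventually_elim simp
  ultimately show ?thesis by (simp add: W0sp_iff)
qed

lemma W0sp_add:
  assumes u: "u \<in> W0sp s p \<Omega>" and v: "v \<in> W0sp s p \<Omega>"
  shows "(\<lambda>x. u x + v x) \<in> W0sp s p \<Omega>"
proof -
  note um[measurable] = W0sp_measurable[OF u] and vm[measurable] = W0sp_measurable[OF v]
  obtain \<phi> where \<phi>: "\<And>n::nat. \<phi> n \<in> test_functions \<Omega>" "(\<lambda>n. G (\<lambda>x. \<phi> n x - u x)) \<longlonglongrightarrow> 0"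
    using u by (auto simp: W0sp_iff)
  obtain \<psi> where \<psi>: "\<And>n::nat. \<psi> n \<in> test_functions \<Omega>" "(\<lambda>n. G (\<lambda>x. \<psi> n x - v x)) \<longlonglongrightarrow> 0"
    using v by (auto simp: W0sp_iff)
  have [measurable]: "\<phi> n \<in> borel_measurable lebesgue" "\<psi> n \<in> borel_measurable lebesgue" for n
    by (rule test_functions_measurable[OF \<phi>(1)], rule test_functions_measurable[OF \<psi>(1)])
  have le: "G (\<lambda>x. (\<phi> n x + \<psi> n x) - (u x + v x))
      \<le> ennreal (2 powr p) * (G (\<lambda>x. \<phi> n x - u x) + G (\<lambda>x. \<psi> n x - v x))" for n
  proof -
    have "(\<lambda>x. (\<phi> n x + \<psi> n x) - (u x + v x)) = (\<lambda>x. (\<phi> n x - u x) + (\<psi> n x - v x))" by auto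
    then show ?thesis by (simp only:) (rule gagliardo_integral_add_le[OF p0], measurable)
  qed
  have "(\<lambda>n. ennreal (2 powr p) * (G (\<lambda>x. \<phi> n x - u x) + G (\<lambda>x. \<psi> n x - v x))) \<longlonglongrightarrow> ennreal (2 powr p) * (0 + 0)"
    by (rule ennreal_tendsto_cmult[OF _ tendsto_add[OF \<phi>(2) \<psi>(2)]]) simp
  then have b: "(\<lambda>n. ennreal (2 powr p) * (G (\<lambda>x. \<phi> n x - u x) + G (\<lambda>x. \<psi> n x - v x))) \<longlonglongrightarrow> 0" by simp
  have "(\<lambda>n. G (\<lambda>x. (\<phi> n x + \<psi> n x) - (u x + v x))) \<longlonglongrightarrow> 0"
    by (rule tendsto_sandwich[OF _ _ tendsto_const b]) (use le in simp_all)
  then have "\<exists>\<eta>. (\<forall>n::nat. \<eta> n \<in> test_functions \<Omega>) \<and> (\<lambda>n. G (\<lambda>x. \<eta> n x - (u x + v x))) \<longlonglongrightarrow> 0"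
    using test_functions_add[OF \<phi>(1) \<psi>(1)] by (intro exI[of _ "\<lambda>n x. \<phi> n x + \<psi> n x"]) simp
  moreover have "G (\<lambda>x. u x + v x) < \<infinity>"
    by (rule order_le_less_trans[OF gagliardo_integral_add_le[OF p0 um vm]])
      (use W0sp_finite[OF u] W0sp_finite[OF v] in \<open>simp add: ennreal_mult_less_top\<close>)
  moreover have "AE x in lebesgue. x \<notin> \<Omega> \<longrightarrow> u x + v x = 0"
    using W0sp_outside[OF u] W0sp_outside[OF v] by eventually_elim simp
  ultimately show ?thesis by (simp add: W0sp_iff)
qed

lemma W0sp_diff:
  "u \<in> W0sp s p \<Omega> \<Longrightarrow> v \<in> W0sp s p \<Omega> \<Longrightarrow> (\<lambda>x. u x - v x) \<in> W0sp s p \<Omega>"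
  using W0sp_add[OF _ W0sp_scale[of v "-1"], of u] by simp

text \<open>A geometric rate of approximation makes the sum of all errors finite. By the Poincare
  inequality this also holds for the \<open>p\<close>-th power integrals, which forces pointwise
  convergence and later supplies a common majorant.\<close>

lemma W0sp_rapid_sequence:
  assumes u: "u \<in> W0sp s p \<Omega>"
  obtains \<phi> where "\<And>n::nat. \<phi> n \<in> test_functions \<Omega>" "\<And>n. G (\<lambda>x. \<phi> n x - u x) \<le> ennreal ((1/2) ^ n)"
    "AE x in lebesgue. (\<lambda>n. \<phi> n x) \<longlonglongrightarrow> u x"
proof -
  note um[measurable] = W0sp_measurable[OF u]
  obtain \<phi>' where \<phi>': "\<And>n::nat. \<phi>' n \<in> test_functions \<Omega>" "(\<lambda>n. G (\<lambda>x. \<phi>' n x - u x)) \<longlonglongrightarrow> 0"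
    using u by (auto simp: W0sp_iff)
  have "\<exists>k. G (\<lambda>x. \<phi>' k x - u x) < ennreal ((1/2) ^ n)" for n
  proof -
    have "eventually (\<lambda>k. G (\<lambda>x. \<phi>' k x - u x) < ennreal ((1/2) ^ n)) sequentially"
      by (rule order_tendstoD(2)[OF \<phi>'(2)]) simp
    then show ?thesis by (rule eventually_happens'[OF sequentially_bot])
  qed
  then obtain k where k: "\<And>n. G (\<lambda>x. \<phi>' (k n) x - u x) < ennreal ((1/2) ^ n)" by metis
  define \<phi> where "\<phi> n = \<phi>' (k n)" for n
  have \<phi>: "\<phi> n \<in> test_functions \<Omega>" "G (\<lambda>x. \<phi> n x - u x) \<le> ennreal ((1/2) ^ n)" for n
    using \<phi>'(1) k[of n] by (auto simp: \<phi>_def)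
  have \<phi>m[measurable]: "\<phi> n \<in> borel_measurable lebesgue" for n by (rule test_functions_measurable[OF \<phi>(1)])
  obtain C where C: "C > 0" "\<And>u. u \<in> borel_measurable lebesgue \<Longrightarrow>
    AE x in lebesgue. x \<notin> \<Omega> \<longrightarrow> u x = 0 \<Longrightarrow> lp_integral p u \<le> ennreal C * G u"
    using poincare by blast
  have le: "lp_integral p (\<lambda>x. \<phi> n x - u x) \<le> ennreal (C * (1/2) ^ n)" for n
  proof -
    have "AE x in lebesgue. x \<notin> \<Omega> \<longrightarrow> \<phi> n x - u x = 0"
      using W0sp_outside[OF u] by eventually_elim (use test_functions_outside[OF \<phi>(1)] in auto)
    then have "lp_integral p (\<lambda>x. \<phi> n x - u x) \<le> ennreal C * G (\<lambda>x. \<phi> n x - u x)"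
      by (intro C(2)) measurable
    also have "\<dots> \<le> ennreal C * ennreal ((1/2) ^ n)" by (intro mult_left_mono \<phi>(2)) simp
    finally show ?thesis using C(1) by (simp add: ennreal_mult'[symmetric])
  qed
  have "(\<Sum>n. \<integral>\<^sup>+x. ennreal (\<bar>\<phi> n x - u x\<bar> powr p) \<partial>lebesgue) \<le> (\<Sum>n. ennreal (C * (1/2) ^ n))"
    using le by (intro suminf_le) (auto simp: lp_integral_def)
  also have "\<dots> = ennreal (\<Sum>n. C * (1/2) ^ n)"
    using C(1) by (intro suminf_ennreal2 summable_mult summable_geometric) auto
  also have "\<dots> < \<infinity>" by simp
  finally have "AE x in lebesgue. (\<lambda>n. \<bar>\<phi> n x - u x\<bar> powr p) \<longlonglongrightarrow> 0"
    by (intro AE_tendsto_0_of_suminf) auto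
  then have "AE x in lebesgue. (\<lambda>n. \<phi> n x) \<longlonglongrightarrow> u x"
  proof eventually_elim
    case (elim x)
    have "(\<lambda>n. \<phi> n x - u x) \<longlonglongrightarrow> 0" by (rule tendsto_0_of_abs_powr[OF elim p0])
    then show ?case by (simp add: LIM_zero_iff)
  qed
  then show ?thesis using that \<phi> by blast
qed

text \<open>
  Composition with a \<open>1\<close>-Lipschitz function is continuous on the Sobolev space, but not uniformly;
  dominated convergence applies because the approximating sequence is chosen summable.
\<close>

lemma W0sp_abs_shift:
  assumes u: "u \<in> W0sp s p \<Omega>"
  shows "(\<lambda>x. \<bar>u x - l\<bar> - \<bar>l\<bar>) \<in> W0sp s p \<Omega>"
proof -
  note um[measurable] = W0sp_measurable[OF u]
  obtain \<phi> where \<phi>: "\<And>n::nat. \<phi> n \<in> test_functions \<Omega>"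
    "\<And>n. G (\<lambda>x. \<phi> n x - u x) \<le> ennreal ((1/2) ^ n)" "AE x in lebesgue. (\<lambda>n. \<phi> n x) \<longlonglongrightarrow> u x"
    using W0sp_rapid_sequence[OF u] by blast
  define e where "e n = inverse (real (Suc n))" for n
  define \<psi> where "\<psi> n t = sqrt ((t - l)\<^sup>2 + (e n)\<^sup>2) - sqrt (l\<^sup>2 + (e n)\<^sup>2)" for n t
  define w where "w n x = \<psi> n (\<phi> n x)" for n x
  define v where "v x = \<bar>u x - l\<bar> - \<bar>l\<bar>" for x
  have e: "e n > 0" for n by (simp add: e_def)
  have e0: "e \<longlonglongrightarrow> 0" unfolding e_def by (rule LIMSEQ_inverse_real_of_nat)
  have w: "w n \<in> test_functions \<Omega>" for n
    unfolding w_def[abs_def] \<psi>_def by (rule test_functions_sqrt[OF \<phi>(1) e])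
  have lip: "\<bar>\<psi> n a - \<psi> n b\<bar> \<le> \<bar>a - b\<bar>" for n a b
    using sqrt_shift_lipschitz[of a l "e n" b] by (simp add: \<psi>_def)
  have [measurable]: "\<phi> n \<in> borel_measurable lebesgue" "w n \<in> borel_measurable lebesgue" for n
    by (rule test_functions_measurable[OF \<phi>(1)], rule test_functions_measurable[OF w])
  have [measurable]: "v \<in> borel_measurable lebesgue" unfolding v_def[abs_def] by measurable
  have vu: "\<bar>v x - v y\<bar> \<le> \<bar>u x - u y\<bar>" for x y by (auto simp: v_def)
  define S where "S z = (\<Sum>n. ennreal (\<bar>incr (\<lambda>x. \<phi> n x - u x) z\<bar> powr p))" for z
  \<comment> \<open>A majorant for all \<open>n\<close> at once: both compositions are
    \<open>1\<close>-Lipschitz, so the increment of \<open>w n - v\<close> is at most that of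
    \<open>\<phi> n - u\<close> in absolute value plus twice that of \<open>u\<close>.
    \<open>S\<close> dominates the first term for every \<open>n\<close> and is integrable by the
    geometric rate.\<close>
  define H where "H z = ennreal (2 powr p) * (S z + ennreal (2 powr p) * ennreal (\<bar>incr u z\<bar> powr p))" for z
  have [measurable]: "S \<in> borel_measurable \<nu>" unfolding S_def by measurable
  have Hm: "H \<in> borel_measurable \<nu>" unfolding H_def by measurable
  have "(\<integral>\<^sup>+z. S z \<partial>\<nu>) = (\<Sum>n. G (\<lambda>x. \<phi> n x - u x))"
    unfolding S_def by (subst nn_integral_suminf) (auto simp: gagliardo_integral_eq)
  also have "\<dots> \<le> (\<Sum>n. ennreal ((1/2) ^ n))" by (intro suminf_le \<phi>(2)) auto
  also have "\<dots> = ennreal (\<Sum>n. (1/2) ^ n)" by (intro suminf_ennreal2 summable_geometric) auto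
  also have "\<dots> < \<infinity>" by simp
  finally have Sfin: "(\<integral>\<^sup>+z. S z \<partial>\<nu>) < \<infinity>" .
  have "(\<integral>\<^sup>+z. H z \<partial>\<nu>) = ennreal (2 powr p) * ((\<integral>\<^sup>+z. S z \<partial>\<nu>) + ennreal (2 powr p) * G u)"
    unfolding H_def gagliardo_integral_eq[OF um] by (simp add: nn_integral_cmult nn_integral_add)
  also have "\<dots> < \<infinity>" using Sfin W0sp_finite[OF u] by (simp add: ennreal_mult_less_top)
  finally have Hfin: "(\<integral>\<^sup>+z. H z \<partial>\<nu>) < \<infinity>" .
  have bound: "ennreal (\<bar>incr (\<lambda>x. w n x - v x) z\<bar> powr p) \<le> H z" for n z
  proof -
    have "\<bar>incr (\<lambda>x. w n x - v x) z\<bar> \<le> \<bar>\<bar>incr (\<lambda>x. \<phi> n x - u x) z\<bar> + 2 * \<bar>incr u z\<bar>\<bar>"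
    proof -
      have tri: "\<bar>a - c\<bar> \<le> \<bar>\<bar>b - d\<bar> + 2 * \<bar>d\<bar>\<bar>" if "\<bar>a\<bar> \<le> \<bar>b\<bar>" "\<bar>c\<bar> \<le> \<bar>d\<bar>" for a b c d :: real
        using that abs_triangle_ineq4[of a c] abs_triangle_ineq2[of b d] by simp
      have "\<bar>incr (w n) z\<bar> \<le> \<bar>incr (\<phi> n) z\<bar>" "\<bar>incr v z\<bar> \<le> \<bar>incr u z\<bar>"
        using lip[of n "\<phi> n (fst z)" "\<phi> n (snd z)"] vu[of "fst z" "snd z"]
        by (simp_all add: incr_def w_def)
      from tri[OF this] show ?thesis by (simp only: incr_diff)
    qed
    then have "\<bar>incr (\<lambda>x. w n x - v x) z\<bar> powr p \<le> \<bar>\<bar>incr (\<lambda>x. \<phi> n x - u x) z\<bar> + 2 * \<bar>incr u z\<bar>\<bar> powr p"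
      using p by (intro powr_mono2) auto
    also have "\<dots> \<le> 2 powr p * (\<bar>incr (\<lambda>x. \<phi> n x - u x) z\<bar> powr p + 2 powr p * \<bar>incr u z\<bar> powr p)"
      using abs_add_powr_le[OF p0, of "\<bar>incr (\<lambda>x. \<phi> n x - u x) z\<bar>" "2 * \<bar>incr u z\<bar>"]
      by (simp add: abs_mult powr_mult)
    finally have "ennreal (\<bar>incr (\<lambda>x. w n x - v x) z\<bar> powr p) \<le> ennreal (2 powr p) *
        (ennreal (\<bar>incr (\<lambda>x. \<phi> n x - u x) z\<bar> powr p) + ennreal (2 powr p) * ennreal (\<bar>incr u z\<bar> powr p))"
      by (simp add: ennreal_plus[symmetric] ennreal_mult'[symmetric] ennreal_leI del: ennreal_plus)
    also have "\<dots> \<le> H z"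
      unfolding H_def S_def by (intro mult_left_mono add_right_mono)
        (auto intro: ennreal_term_le_suminf[of "\<lambda>n. ennreal (\<bar>incr (\<lambda>x. \<phi> n x - u x) z\<bar> powr p)"])
    finally show ?thesis .
  qed
  have w_conv: "AE x in lebesgue. (\<lambda>n. w n x) \<longlonglongrightarrow> v x"
    using \<phi>(3)
  proof eventually_elim
    case (elim x)
    have "(\<lambda>n. w n x) \<longlonglongrightarrow> sqrt ((u x - l)\<^sup>2 + 0\<^sup>2) - sqrt (l\<^sup>2 + 0\<^sup>2)"
      unfolding w_def \<psi>_def by (intro tendsto_intros elim e0)
    then show ?case by (simp add: v_def)
  qed
  have conv: "AE z in \<nu>. (\<lambda>n. ennreal (\<bar>incr (\<lambda>x. w n x - v x) z\<bar> powr p)) \<longlonglongrightarrow> 0"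
    using AE_frac_measure_fst[OF w_conv] AE_frac_measure_snd[OF w_conv]
  proof eventually_elim
    case (elim z)
    have "(\<lambda>n. \<bar>incr (\<lambda>x. w n x - v x) z\<bar>) \<longlonglongrightarrow> \<bar>(v (fst z) - v (fst z)) - (v (snd z) - v (snd z))\<bar>"
      unfolding incr_def by (intro tendsto_intros elim)
    then have "(\<lambda>n. \<bar>incr (\<lambda>x. w n x - v x) z\<bar> powr p) \<longlonglongrightarrow> 0 powr p"
      using p by (intro tendsto_powr') auto
    then have "(\<lambda>n. ennreal (\<bar>incr (\<lambda>x. w n x - v x) z\<bar> powr p)) \<longlonglongrightarrow> ennreal (0 powr p)"
      by (rule tendsto_ennrealI)
    then show ?case by simp
  qed
  have "(\<lambda>n. \<integral>\<^sup>+z. ennreal (\<bar>incr (\<lambda>x. w n x - v x) z\<bar> powr p) \<partial>\<nu>) \<longlonglongrightarrow> (\<integral>\<^sup>+z. 0 \<partial>\<nu>)"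
    by (rule nn_integral_dominated_convergence[where w=H])
      (use bound Hfin conv Hm in simp_all)
  then have "(\<lambda>n. G (\<lambda>x. w n x - v x)) \<longlonglongrightarrow> 0"
    by (simp add: gagliardo_integral_eq)
  then have "\<exists>\<phi>. (\<forall>n::nat. \<phi> n \<in> test_functions \<Omega>) \<and> (\<lambda>n. G (\<lambda>x. \<phi> n x - v x)) \<longlonglongrightarrow> 0"
    using w by blast
  moreover have "G v < \<infinity>"
    by (rule order_le_less_trans[OF gagliardo_integral_mono[OF p0 _ um vu] W0sp_finite[OF u]]) simp
  moreover have "AE x in lebesgue. x \<notin> \<Omega> \<longrightarrow> v x = 0"
    using W0sp_outside[OF u] by eventually_elim (auto simp: v_def)
  ultimately have "v \<in> W0sp s p \<Omega>" by (simp add: W0sp_iff)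
  then show ?thesis by (simp add: v_def[abs_def])
qed

lemma W0sp_abs: "u \<in> W0sp s p \<Omega> \<Longrightarrow> (\<lambda>x. \<bar>u x\<bar>) \<in> W0sp s p \<Omega>"
  using W0sp_abs_shift[of u 0] by simp

lemma W0sp_pos_part:
  assumes "u \<in> W0sp s p \<Omega>" "l \<ge> 0"
  shows "(\<lambda>x. max (u x - l) 0) \<in> W0sp s p \<Omega>"
proof -
  have "(\<lambda>x. 1/2 * (u x + (\<bar>u x - l\<bar> - \<bar>l\<bar>))) \<in> W0sp s p \<Omega>"
    by (intro W0sp_scale W0sp_add W0sp_abs_shift assms)
  moreover have "(\<lambda>x. 1/2 * (u x + (\<bar>u x - l\<bar> - \<bar>l\<bar>))) = (\<lambda>x. max (u x - l) 0)"
    using assms(2) by (auto simp: fun_eq_iff max_def)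
  ultimately show ?thesis by simp
qed

end

section \<open>The energy and its derivative\<close>

context frac_sobolev
begin

definition energy :: "('a \<Rightarrow> real) \<Rightarrow> real" where
  "energy u = enn2real (G u)"

abbreviation P :: "('a \<Rightarrow> real) \<Rightarrow> ('a \<Rightarrow> real) \<Rightarrow> real" where
  "P \<equiv> plap_pairing s p"

lemma energy_nonneg: "energy u \<ge> 0"
  by (simp add: energy_def)

lemma gagliardo_powr_energy: "gagliardo s p u powr p = energy u"
  by (simp add: gagliardo_powr[OF p0] energy_def)

lemma G_energy: "u \<in> W0sp s p \<Omega> \<Longrightarrow> G u = ennreal (energy u)"
  using W0sp_finite[of u] by (simp add: energy_def)

lemma energy_integral:
  assumes "u \<in> W0sp s p \<Omega>"
  shows integrable_energy: "integrable \<nu> (\<lambda>z. \<bar>incr u z\<bar> powr p)"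
    and energy_eq: "energy u = (\<integral>z. \<bar>incr u z\<bar> powr p \<partial>\<nu>)"
proof -
  note um[measurable] = W0sp_measurable[OF assms]
  show "integrable \<nu> (\<lambda>z. \<bar>incr u z\<bar> powr p)"
    using W0sp_finite[OF assms] by (intro integrableI_nonneg) (auto simp: gagliardo_integral_eq[OF um])
  show "energy u = (\<integral>z. \<bar>incr u z\<bar> powr p \<partial>\<nu>)"
    unfolding energy_def gagliardo_integral_eq[OF um]
    by (rule integral_eq_nn_integral[symmetric]) auto
qed

lemma energy_scale: "u \<in> borel_measurable lebesgue \<Longrightarrow> energy (\<lambda>x. c * u x) = \<bar>c\<bar> powr p * energy u"
  by (simp add: energy_def gagliardo_integral_scale enn2real_mult)

lemma energy_abs_le:
  assumes "u \<in> W0sp s p \<Omega>"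
  shows "energy (\<lambda>x. \<bar>u x\<bar>) \<le> energy u"
proof -
  note um[measurable] = W0sp_measurable[OF assms]
  have "G (\<lambda>x. \<bar>u x\<bar>) \<le> G u"
    by (rule gagliardo_integral_mono[OF p0]) (auto intro: abs_triangle_ineq3)
  then show ?thesis
    unfolding energy_def using W0sp_finite[OF assms] by (intro enn2real_mono) auto
qed

lemma pairing_integral:
  assumes "u \<in> W0sp s p \<Omega>" "v \<in> W0sp s p \<Omega>"
  shows integrable_pairing: "integrable \<nu> (\<lambda>z. jp p (incr u z) * incr v z)"
    and pairing_eq: "P u v = (\<integral>z. jp p (incr u z) * incr v z \<partial>\<nu>)"
proof -
  note um[measurable] = W0sp_measurable[OF assms(1)] and vm[measurable] = W0sp_measurable[OF assms(2)]
  have "integrable \<nu> (\<lambda>z. \<bar>incr u z\<bar> powr p + \<bar>incr v z\<bar> powr p)"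
    by (intro Bochner_Integration.integrable_add integrable_energy assms)
  then show "integrable \<nu> (\<lambda>z. jp p (incr u z) * incr v z)"
    by (rule Bochner_Integration.integrable_bound)
      (use jp_mult_le_delta[OF p, of 1] in \<open>auto\<close>)
  show "P u v = (\<integral>z. jp p (incr u z) * incr v z \<partial>\<nu>)"
    by (rule plap_pairing_eq[OF um vm])
qed

lemma pairing_diff:
  assumes "u \<in> W0sp s p \<Omega>" "v \<in> W0sp s p \<Omega>" "w \<in> W0sp s p \<Omega>"
  shows "P u (\<lambda>x. v x - w x) = P u v - P u w"
  using assms by (simp add: pairing_eq W0sp_diff incr_diff right_diff_distrib
      Bochner_Integration.integral_diff integrable_pairing)

lemma pairing_scale:
  assumes "u \<in> W0sp s p \<Omega>" "v \<in> W0sp s p \<Omega>"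
  shows "P u (\<lambda>x. c * v x) = c * P u v"
proof -
  have "(\<integral>z. jp p (incr u z) * (c * incr v z) \<partial>\<nu>) = (\<integral>z. c * (jp p (incr u z) * incr v z) \<partial>\<nu>)"
    by (intro Bochner_Integration.integral_cong) auto
  then show ?thesis using assms by (simp add: pairing_eq W0sp_scale incr_scale)
qed

lemma pairing_self: "u \<in> W0sp s p \<Omega> \<Longrightarrow> P u u = energy u"
  by (simp add: pairing_eq energy_eq jp_mult_self)

lemma pairing_le_delta:
  assumes "u \<in> W0sp s p \<Omega>" "v \<in> W0sp s p \<Omega>" "d > 0"
  shows "\<bar>P u v\<bar> \<le> d * energy u + (1 / d) powr (p - 1) * energy v"
proof -
  have "\<bar>P u v\<bar> \<le> (\<integral>z. \<bar>jp p (incr u z) * incr v z\<bar> \<partial>\<nu>)"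
    unfolding pairing_eq[OF assms(1,2)] by (rule integral_abs_bound)
  also have "\<dots> \<le> (\<integral>z. d * \<bar>incr u z\<bar> powr p + (1 / d) powr (p - 1) * \<bar>incr v z\<bar> powr p \<partial>\<nu>)"
    using assms by (intro integral_mono integrable_abs integrable_pairing jp_mult_le_delta p
        Bochner_Integration.integrable_add integrable_mult_right integrable_energy)
  also have "\<dots> = d * energy u + (1 / d) powr (p - 1) * energy v"
    using assms by (simp add: energy_eq integrable_energy Bochner_Integration.integral_add)
  finally show ?thesis .
qed

lemma pairing_le_young:
  assumes "u \<in> W0sp s p \<Omega>" "v \<in> W0sp s p \<Omega>"
  shows "P u v \<le> (1 - 1 / p) * energy u + energy v / p"
proof -
  have "P u v \<le> (\<integral>z. (1 - 1 / p) * \<bar>incr u z\<bar> powr p + \<bar>incr v z\<bar> powr p / p \<partial>\<nu>)"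
    unfolding pairing_eq[OF assms]
    using assms by (intro integral_mono integrable_pairing jp_mult_le_young p
        Bochner_Integration.integrable_add integrable_mult_right integrable_energy integrable_divide)
  also have "\<dots> = (1 - 1 / p) * energy u + energy v / p"
    using assms by (simp add: energy_eq integrable_energy Bochner_Integration.integral_add)
  finally show ?thesis .
qed

text \<open>\<open>jp\<close> is strictly increasing, so the integrand of the difference is
  nonnegative and vanishes only where the two increments agree. The hypothesis forces its integral
  to be \<open>0\<close>, so \<open>u - v\<close> has zero energy, and the Poincare inequality
  excludes nonzero constants.\<close>

lemma pairing_monotone:
  assumes u: "u \<in> W0sp s p \<Omega>" and v: "v \<in> W0sp s p \<Omega>"
    and le: "P u (\<lambda>x. u x - v x) \<le> P v (\<lambda>x. u x - v x)"
  shows "AE x in lebesgue. u x = v x"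
proof -
  define w where "w x = u x - v x" for x
  have w: "w \<in> W0sp s p \<Omega>" unfolding w_def[abs_def] by (rule W0sp_diff[OF u v])
  note [measurable] = W0sp_measurable[OF u] W0sp_measurable[OF v] W0sp_measurable[OF w]
  define F where "F z = (jp p (incr u z) - jp p (incr v z)) * incr w z" for z
  have iw: "incr w z = incr u z - incr v z" for z by (simp add: w_def[abs_def] incr_diff)
  have Fpos: "F z > 0" if "incr u z \<noteq> incr v z" for z
    using that jp_less[OF p, of "incr u z" "incr v z"] jp_less[OF p, of "incr v z" "incr u z"]
    unfolding F_def iw by (cases "incr u z < incr v z") (auto intro: mult_pos_pos mult_neg_neg)
  have F0: "F z \<ge> 0" for z using Fpos[of z] by (cases "incr u z = incr v z") (auto simp: F_def iw)
  have Fi: "integrable \<nu> F"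
    unfolding F_def left_diff_distrib
    by (intro Bochner_Integration.integrable_diff integrable_pairing u v w)
  have "(\<integral>z. F z \<partial>\<nu>) = P u w - P v w"
    unfolding F_def left_diff_distrib pairing_eq[OF u w] pairing_eq[OF v w]
    by (intro Bochner_Integration.integral_diff integrable_pairing u v w)
  also have "\<dots> \<le> 0" using le by (simp add: w_def[abs_def])
  finally have "(\<integral>z. F z \<partial>\<nu>) \<le> 0" .
  moreover have "0 \<le> (\<integral>z. F z \<partial>\<nu>)" using F0 by simp
  ultimately have "(\<integral>z. F z \<partial>\<nu>) = 0" by simp
  then have "AE z in \<nu>. F z = 0" using F0 Fi by (subst (asm) integral_nonneg_eq_0_iff_AE) auto
  then have "AE z in \<nu>. ennreal (\<bar>incr w z\<bar> powr p) = 0"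
  proof eventually_elim
    case (elim z)
    then show ?case using Fpos[of z] by (cases "incr u z = incr v z") (auto simp: iw)
  qed
  then have "G w = 0"
    by (simp add: gagliardo_integral_eq nn_integral_0_iff_AE)
  moreover obtain C where C: "C > 0" "\<And>u. u \<in> borel_measurable lebesgue \<Longrightarrow>
    AE x in lebesgue. x \<notin> \<Omega> \<longrightarrow> u x = 0 \<Longrightarrow> lp_integral p u \<le> ennreal C * G u"
    using poincare by blast
  ultimately have "lp_integral p w = 0"
    using C(2)[OF W0sp_measurable[OF w] W0sp_outside[OF w]] by simp
  then have "AE x in lebesgue. w x = 0" by (rule lp_integral_eq_0D) measurable
  then show ?thesis by eventually_elim (simp add: w_def)
qed

lemma energy_eq_0D:
  assumes u: "u \<in> W0sp s p \<Omega>" and "energy u = 0"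
  shows "AE x in lebesgue. u x = 0"
proof -
  obtain C where C: "C > 0" "\<And>u. u \<in> borel_measurable lebesgue \<Longrightarrow>
    AE x in lebesgue. x \<notin> \<Omega> \<longrightarrow> u x = 0 \<Longrightarrow> lp_integral p u \<le> ennreal C * G u"
    using poincare by blast
  have "G u = 0" using assms by (simp add: G_energy)
  then have "lp_integral p u = 0"
    using C(2)[OF W0sp_measurable[OF u] W0sp_outside[OF u]] by simp
  then show ?thesis by (rule lp_integral_eq_0D) (rule W0sp_measurable[OF u])
qed

text \<open>Differentiation under the integral along sequences, by dominated convergence. The bound
  \<open>t n \<le> 1\<close> keeps the increments of \<open>t n * v\<close> below those of
  \<open>v\<close>, so the majorant is free of \<open>n\<close>.\<close>

lemma energy_derivative:
  assumes u: "u \<in> W0sp s p \<Omega>" and v: "v \<in> W0sp s p \<Omega>"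
    and t: "\<And>n. 0 < t n" "\<And>n. t n \<le> 1" "t \<longlonglongrightarrow> 0"
  shows "(\<lambda>n. (energy (\<lambda>x. u x + t n * v x) - energy u) / t n) \<longlonglongrightarrow> p * P u v"
proof -
  note [measurable] = W0sp_measurable[OF u] W0sp_measurable[OF v]
  define F where "F n z = (\<bar>incr u z + t n * incr v z\<bar> powr p - \<bar>incr u z\<bar> powr p) / t n" for n z
  have ut: "(\<lambda>x. u x + t n * v x) \<in> W0sp s p \<Omega>" for n
    by (intro W0sp_add W0sp_scale u v)
  have eqF: "(\<integral>z. F n z \<partial>\<nu>) = (energy (\<lambda>x. u x + t n * v x) - energy u) / t n" for n
    using integrable_energy[OF ut[of n]] integrable_energy[OF u]
    by (simp add: F_def energy_eq[OF ut] energy_eq[OF u] incr_add incr_scale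
        Bochner_Integration.integral_diff)
  have "(\<lambda>n. \<integral>z. F n z \<partial>\<nu>) \<longlonglongrightarrow> (\<integral>z. p * (jp p (incr u z) * incr v z) \<partial>\<nu>)"
  proof (rule integral_dominated_convergence[where w="\<lambda>z. p * (2 powr p * (\<bar>incr u z\<bar> powr p + \<bar>incr v z\<bar> powr p))"])
    show "integrable \<nu> (\<lambda>z. p * (2 powr p * (\<bar>incr u z\<bar> powr p + \<bar>incr v z\<bar> powr p)))"
      by (intro integrable_mult_right Bochner_Integration.integrable_add integrable_energy u v)
    show "AE z in \<nu>. (\<lambda>n. F n z) \<longlonglongrightarrow> p * (jp p (incr u z) * incr v z)"
    proof (rule AE_I2)
      fix z
      have "((\<lambda>h. \<bar>incr u z + h * incr v z\<bar> powr p) has_real_derivative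
          (p * jp p (incr u z + 0 * incr v z)) * incr v z) (at 0)"
        by (rule DERIV_chain2[OF has_real_derivative_abs_powr[OF p]])
          (auto intro!: derivative_eq_intros)
      then have "((\<lambda>h. (\<bar>incr u z + h * incr v z\<bar> powr p - \<bar>incr u z\<bar> powr p) / h) \<longlongrightarrow>
          p * (jp p (incr u z) * incr v z)) (at 0)"
        by (simp add: DERIV_def mult.assoc)
      moreover have "filterlim t (at 0) sequentially"
      proof -
        have "t n \<noteq> 0" for n using t(1)[of n] by simp
        then show ?thesis using t(3) by (simp add: filterlim_at)
      qed
      ultimately show "(\<lambda>n. F n z) \<longlonglongrightarrow> p * (jp p (incr u z) * incr v z)"
        unfolding F_def by (rule filterlim_compose)
    qed
    show "AE z in \<nu>. norm (F n z) \<le> p * (2 powr p * (\<bar>incr u z\<bar> powr p + \<bar>incr v z\<bar> powr p))" for n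
    proof (rule AE_I2)
      fix z
      define a b where "a = incr u z" and "b = incr v z"
      have tb: "\<bar>t n * b\<bar> \<le> \<bar>b\<bar>" using t(1,2)[of n] by (simp add: abs_mult mult_left_le_one_le)
      have "\<bar>\<bar>a + t n * b\<bar> powr p - \<bar>a\<bar> powr p\<bar> \<le> p * (\<bar>a\<bar> + \<bar>t n * b\<bar>) powr (p - 1) * \<bar>t n * b\<bar>"
        by (rule abs_powr_diff_le[OF p])
      also have "\<dots> \<le> p * (\<bar>a\<bar> + \<bar>b\<bar>) powr (p - 1) * \<bar>t n * b\<bar>"
        using p tb by (intro mult_right_mono mult_left_mono powr_mono2) auto
      also have "\<dots> = t n * (p * ((\<bar>a\<bar> + \<bar>b\<bar>) powr (p - 1) * \<bar>b\<bar>))"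
        using t(1)[of n] by (simp add: abs_mult)
      also have "\<dots> \<le> t n * (p * ((\<bar>a\<bar> + \<bar>b\<bar>) powr (p - 1) * (\<bar>a\<bar> + \<bar>b\<bar>)))"
        using p t(1)[of n] by (intro mult_left_mono) auto
      also have "(\<bar>a\<bar> + \<bar>b\<bar>) powr (p - 1) * (\<bar>a\<bar> + \<bar>b\<bar>) = \<bar>\<bar>a\<bar> + \<bar>b\<bar>\<bar> powr p"
        by (cases "\<bar>a\<bar> + \<bar>b\<bar> = 0") (simp_all add: powr_mult_base mult.commute)
      also have "t n * (p * \<bar>\<bar>a\<bar> + \<bar>b\<bar>\<bar> powr p) \<le> t n * (p * (2 powr p * (\<bar>a\<bar> powr p + \<bar>b\<bar> powr p)))"
        using p t(1)[of n] abs_add_powr_le[OF p0, of "\<bar>a\<bar>" "\<bar>b\<bar>"] by (intro mult_left_mono) auto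
      finally show "norm (F n z) \<le> p * (2 powr p * (\<bar>incr u z\<bar> powr p + \<bar>incr v z\<bar> powr p))"
        using t(1)[of n] unfolding a_def b_def F_def by (simp add: abs_divide divide_le_eq mult.commute)
    qed
  qed (unfold F_def, measurable)
  then show ?thesis by (simp add: eqF pairing_eq[OF u v])
qed

end

section \<open>The logarithmic constraint\<close>

lemma ln_le_powr:
  fixes t q :: real
  assumes "t > 0" "q > 0"
  shows "ln t \<le> (t powr q - 1) / q"
proof -
  have "q * ln t = ln (t powr q)" using assms by (simp add: ln_powr)
  also have "\<dots> \<le> t powr q - 1" using assms by (intro ln_le_minus_one) simp
  finally show ?thesis using assms by (simp add: field_simps)
qed

section \<open>The weighted measure and integrability of powers and logarithms\<close>

locale weighted_frac_sobolev = frac_sobolev s p \<Omega>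
  for s p and \<Omega> :: "'a::euclidean_space set" +
  fixes \<omega> :: "'a \<Rightarrow> real" and r :: real
  assumes r: "r > 1" and \<omega>: "\<omega> \<in> Lp_space r \<Omega>"
    and \<omega>_nonneg: "AE x\<in>\<Omega> in lebesgue. \<omega> x \<ge> 0"
    and \<omega>_nonzero: "\<not> (AE x\<in>\<Omega> in lebesgue. \<omega> x = 0)"
begin

definition wt :: "'a \<Rightarrow> real" where "wt x = indicator \<Omega> x * \<omega> x"

text \<open>The measure with density \<open>\<omega>\<close> on \<open>\<Omega>\<close>. Since
  \<open>\<omega>\<close> is nonnegative only almost everywhere, \<open>ennreal\<close> cuts off
  negative values on a null set.\<close>

definition \<tau> :: "'a measure" where "\<tau> = density lebesgue (\<lambda>x. ennreal (wt x))"

definition W :: real where "W = measure \<tau> UNIV"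

lemma sets_\<tau> [simp, measurable_cong]: "sets \<tau> = sets lebesgue"
  and space_\<tau> [simp]: "space \<tau> = UNIV"
  by (simp_all add: \<tau>_def)

lemma \<Omega>_measurable [measurable]: "\<Omega> \<in> sets lebesgue"
  using open_\<Omega> by simp

lemma \<Omega>_finite: "emeasure lebesgue \<Omega> < \<infinity>"
  using fmeasurableD2[OF bounded_set_imp_lmeasurable[OF bounded_\<Omega> \<Omega>_measurable]]
  by (simp add: less_top)

lemma wt_measurable [measurable]: "wt \<in> borel_measurable lebesgue"
  using \<omega> by (simp add: wt_def[abs_def] Lp_space_def set_borel_measurable_def)

lemma wt_nonneg: "AE x in lebesgue. 0 \<le> wt x"
  using \<omega>_nonneg by eventually_elim (auto simp: wt_def indicator_def)

lemma AE_\<tau>_iff: "(AE x in \<tau>. Q x) \<longleftrightarrow> (AE x in lebesgue. wt x > 0 \<longrightarrow> Q x)"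
  unfolding \<tau>_def by (subst AE_density) auto

lemma AE_\<tau>: "AE x in lebesgue. Q x \<Longrightarrow> AE x in \<tau>. Q x"
  unfolding AE_\<tau>_iff by (auto elim: eventually_mono)

lemma integrable_\<tau>_iff:
  fixes f :: "'a \<Rightarrow> real"
  assumes [measurable]: "f \<in> borel_measurable lebesgue"
  shows "integrable \<tau> f \<longleftrightarrow> set_integrable lebesgue \<Omega> (\<lambda>x. f x * \<omega> x)"
proof -
  have "(\<lambda>x. wt x *\<^sub>R f x) = (\<lambda>x. indicator \<Omega> x *\<^sub>R (f x * \<omega> x))"
    by (auto simp: wt_def)
  then show ?thesis
    unfolding \<tau>_def set_integrable_def using wt_nonneg by (subst integrable_density) auto
qed

lemma integral_\<tau>:
  fixes f :: "'a \<Rightarrow> real"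
  assumes [measurable]: "f \<in> borel_measurable lebesgue"
  shows "(\<integral>x. f x \<partial>\<tau>) = (LINT x:\<Omega>|lebesgue. f x * \<omega> x)"
proof -
  have "(\<lambda>x. wt x *\<^sub>R f x) = (\<lambda>x. indicator \<Omega> x *\<^sub>R (f x * \<omega> x))"
    by (auto simp: wt_def)
  then show ?thesis
    unfolding \<tau>_def set_lebesgue_integral_def using wt_nonneg by (subst integral_density) auto
qed

lemma wt_powr_integrable: "integrable lebesgue (\<lambda>x. \<bar>wt x\<bar> powr r)"
proof -
  have "(\<lambda>x. indicator \<Omega> x *\<^sub>R \<bar>\<omega> x\<bar> powr r) = (\<lambda>x. \<bar>wt x\<bar> powr r)"
    using r by (auto simp: wt_def indicator_def)
  then show ?thesis using \<omega> by (simp add: Lp_space_def set_integrable_def)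
qed

text \<open>The exponent \<open>p\<close> divided by the Hoelder conjugate of \<open>r\<close>: for
  \<open>q\<close> up to this value, \<open>\<bar>u\<bar> powr q\<close> lies in the Lebesgue space
  dual to that of \<open>\<omega>\<close>.\<close>

definition q0 :: real where "q0 = p * (r - 1) / r"

lemma q0: "q0 > 0" using p r by (simp add: q0_def)

text \<open>Young's inequality bounds the integrand by
  \<open>\<bar>u x\<bar> powr (q * r') + \<bar>wt x\<bar> powr r\<close>; as
  \<open>q * r' \<le> p\<close>, the first term is at most
  \<open>1 + \<bar>u x\<bar> powr p\<close>, and the constant is integrable on the bounded set
  \<open>\<Omega>\<close>.\<close>

lemma integrable_powr_\<tau>:
  assumes um [measurable]: "u \<in> borel_measurable lebesgue" and fin: "lp_integral p u < \<infinity>"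
    and q: "0 \<le> q" "q \<le> q0"
  shows "integrable \<tau> (\<lambda>x. \<bar>u x\<bar> powr q)"
proof -
  define r' where "r' = r / (r - 1)"
  have r': "r' > 1" "1 / r' + 1 / r = 1" using r by (simp_all add: r'_def field_simps)
  have qr: "q * r' \<le> p" using q r by (simp add: q0_def r'_def field_simps)
  have "integrable lebesgue (\<lambda>x. \<bar>u x\<bar> powr p)"
    using fin unfolding lp_integral_def by (intro integrableI_nonneg) auto
  moreover have "integrable lebesgue (indicator \<Omega> :: 'a \<Rightarrow> real)"
    by (intro integrable_real_indicator \<Omega>_measurable \<Omega>_finite)
  ultimately have B: "integrable lebesgue (\<lambda>x. indicator \<Omega> x + \<bar>u x\<bar> powr p + \<bar>wt x\<bar> powr r)"
    by (intro Bochner_Integration.integrable_add wt_powr_integrable)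
  have "integrable lebesgue (\<lambda>x. indicator \<Omega> x *\<^sub>R (\<bar>u x\<bar> powr q * \<omega> x))"
  proof (rule Bochner_Integration.integrable_bound[OF B])
    have "(\<lambda>x. indicator \<Omega> x *\<^sub>R (\<bar>u x\<bar> powr q * \<omega> x)) = (\<lambda>x. \<bar>u x\<bar> powr q * wt x)"
      by (auto simp: wt_def)
    then show "(\<lambda>x. indicator \<Omega> x *\<^sub>R (\<bar>u x\<bar> powr q * \<omega> x)) \<in> borel_measurable lebesgue" by simp
    have "\<bar>\<bar>u x\<bar> powr q * wt x\<bar> \<le> indicator \<Omega> x + \<bar>u x\<bar> powr p + \<bar>wt x\<bar> powr r" for x
    proof (cases "x \<in> \<Omega>")
      case True
      have "\<bar>\<bar>u x\<bar> powr q * wt x\<bar> = \<bar>u x\<bar> powr q * \<bar>wt x\<bar>" by (simp add: abs_mult)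
      also have "\<dots> \<le> (\<bar>u x\<bar> powr q) powr r' / r' + \<bar>wt x\<bar> powr r / r"
        using r r' by (intro Youngs_inequality) auto
      also have "\<dots> \<le> \<bar>u x\<bar> powr (q * r') + \<bar>wt x\<bar> powr r"
      proof -
        have "X / c \<le> X" if "X \<ge> 0" "c > 1" for X c :: real
          using that by (simp add: divide_le_eq mult_le_cancel_left1)
        then show ?thesis using r r' by (intro add_mono) (simp_all add: powr_powr)
      qed
      also have "\<bar>u x\<bar> powr (q * r') \<le> 1 + \<bar>u x\<bar> powr p"
      proof (cases "\<bar>u x\<bar> \<le> 1")
        case True
        then have "\<bar>u x\<bar> powr (q * r') \<le> 1" using q r' by (intro powr_le1) auto
        then show ?thesis by (rule order_trans) simp
      next
        case False
        then have "\<bar>u x\<bar> powr (q * r') \<le> \<bar>u x\<bar> powr p" using qr by (intro powr_mono) auto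
        then show ?thesis by simp
      qed
      finally show ?thesis using True by simp
    qed (simp add: wt_def)
    then show "AE x in lebesgue. norm (indicator \<Omega> x *\<^sub>R (\<bar>u x\<bar> powr q * \<omega> x))
        \<le> norm (indicator \<Omega> x + \<bar>u x\<bar> powr p + \<bar>wt x\<bar> powr r)"
      by (intro AE_I2) (simp add: wt_def mult.left_commute)
  qed
  then show ?thesis by (subst integrable_\<tau>_iff) (auto simp: set_integrable_def)
qed

lemma W0sp_lp_finite: "u \<in> W0sp s p \<Omega> \<Longrightarrow> lp_integral p u < \<infinity>"
  by (auto simp: W0sp_def Wsp_iff)

lemma W0sp_integrable_powr:
  "u \<in> W0sp s p \<Omega> \<Longrightarrow> 0 \<le> q \<Longrightarrow> q \<le> q0 \<Longrightarrow> integrable \<tau> (\<lambda>x. \<bar>u x\<bar> powr q)"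
  by (intro integrable_powr_\<tau> W0sp_measurable W0sp_lp_finite)

lemma finite_measure_\<tau>: "finite_measure \<tau>"
proof -
  have "lp_integral p (indicator \<Omega>) = (\<integral>\<^sup>+x. indicator \<Omega> x \<partial>lebesgue)"
    unfolding lp_integral_def using p by (intro nn_integral_cong) (auto simp: indicator_def)
  then have "integrable \<tau> (\<lambda>x. \<bar>indicator \<Omega> x :: real\<bar> powr q0)"
    using \<Omega>_finite q0 by (intro integrable_powr_\<tau>) auto
  moreover have "AE x in \<tau>. \<bar>indicator \<Omega> x :: real\<bar> powr q0 = 1"
    unfolding AE_\<tau>_iff by (intro AE_I2) (auto simp: wt_def indicator_def)
  ultimately have "integrable \<tau> (\<lambda>x. 1 :: real)"
    by (subst integrable_cong_AE[where g="\<lambda>x. \<bar>indicator \<Omega> x :: real\<bar> powr q0"]) auto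
  then have "(\<integral>\<^sup>+x. 1 \<partial>\<tau>) < \<infinity>"
    by (simp add: integrable_iff_bounded)
  then show ?thesis by (intro finite_measureI) simp
qed

sublocale \<tau>: finite_measure \<tau>
  by (rule finite_measure_\<tau>)

lemma measure_\<tau> [simp]: "measure \<tau> UNIV = W"
  by (simp add: W_def)

lemma W_eq: "Lp_norm 1 \<Omega> \<omega> = W"
proof -
  have "(LINT x:\<Omega>|lebesgue. \<bar>\<omega> x\<bar> powr 1) = (\<integral>x. wt x \<partial>lebesgue)"
    unfolding set_lebesgue_integral_def
  proof (rule integral_cong_AE)
    have "(\<lambda>x. indicator \<Omega> x *\<^sub>R \<bar>\<omega> x\<bar> powr 1) = (\<lambda>x. \<bar>wt x\<bar>)"
      by (auto simp: wt_def indicator_def)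
    then show "(\<lambda>x. indicator \<Omega> x *\<^sub>R \<bar>\<omega> x\<bar> powr 1) \<in> borel_measurable lebesgue" by simp
    show "AE x in lebesgue. indicator \<Omega> x *\<^sub>R \<bar>\<omega> x\<bar> powr 1 = wt x"
      using wt_nonneg by eventually_elim (auto simp: wt_def indicator_def)
  qed measurable
  also have "\<dots> = (\<integral>x. 1 \<partial>\<tau>)"
    unfolding \<tau>_def using wt_nonneg by (subst integral_density) auto
  also have "\<dots> = W" by simp
  finally show ?thesis using measure_nonneg[of \<tau> UNIV] by (simp add: Lp_norm_def)
qed

lemma W_pos: "W > 0"
proof (rule ccontr)
  assume "\<not> W > 0"
  then have "measure \<tau> UNIV = 0" using measure_nonneg[of \<tau> UNIV] by simp
  then have "emeasure \<tau> (space \<tau>) = 0" by (simp add: \<tau>.emeasure_eq_measure)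
  then have "AE x in \<tau>. False" by (intro AE_I[of _ _ "space \<tau>"]) auto
  then have "AE x in lebesgue. \<not> wt x > 0" by (simp add: AE_\<tau>_iff)
  then have "AE x in lebesgue. x \<in> \<Omega> \<longrightarrow> \<omega> x = 0"
    using wt_nonneg by eventually_elim (auto simp: wt_def)
  then show False using \<omega>_nonzero by simp
qed

lemma log_constraint_iff:
  "v \<in> log_constraint s p \<Omega> \<omega> \<longleftrightarrow> v \<in> W0sp s p \<Omega> \<and> (AE x in \<tau>. v x \<noteq> 0) \<and>
    integrable \<tau> (\<lambda>x. ln \<bar>v x\<bar>) \<and> (\<integral>x. ln \<bar>v x\<bar> \<partial>\<tau>) = 0"
proof -
  have ae: "(AE x in \<tau>. v x \<noteq> 0) \<longleftrightarrow> (AE x\<in>\<Omega> in lebesgue. \<omega> x \<noteq> 0 \<longrightarrow> v x \<noteq> 0)"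
    unfolding AE_\<tau>_iff
  proof
    assume "AE x in lebesgue. 0 < wt x \<longrightarrow> v x \<noteq> 0"
    then show "AE x\<in>\<Omega> in lebesgue. \<omega> x \<noteq> 0 \<longrightarrow> v x \<noteq> 0"
      using wt_nonneg by eventually_elim (auto simp: wt_def)
  next
    assume "AE x\<in>\<Omega> in lebesgue. \<omega> x \<noteq> 0 \<longrightarrow> v x \<noteq> 0"
    then show "AE x in lebesgue. 0 < wt x \<longrightarrow> v x \<noteq> 0"
      by eventually_elim (auto simp: wt_def indicator_def split: if_splits)
  qed
  show ?thesis
  proof (cases "v \<in> W0sp s p \<Omega>")
    case True
    note [measurable] = W0sp_measurable[OF True]
    have "(\<lambda>x. ln \<bar>v x\<bar>) \<in> borel_measurable lebesgue" by measurable
    then show ?thesis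
      unfolding log_constraint_def ae using True by (auto simp: integrable_\<tau>_iff integral_\<tau>)
  qed (simp add: log_constraint_def)
qed

end

section \<open>The minimizer and its Euler-Lagrange inequality\<close>

locale log_minimizer = weighted_frac_sobolev +
  fixes V :: "'a \<Rightarrow> real"
  assumes V: "V \<in> log_constraint s p \<Omega> \<omega>" and V_nonneg: "AE x in lebesgue. V x \<ge> 0"
    and V_min: "\<And>v. v \<in> log_constraint s p \<Omega> \<omega> \<Longrightarrow> gagliardo s p V powr p \<le> gagliardo s p v powr p"
begin

abbreviation E :: real where "E \<equiv> energy V"

lemma V_W0sp: "V \<in> W0sp s p \<Omega>"
  and V_log_integrable: "integrable \<tau> (\<lambda>x. ln \<bar>V x\<bar>)"
  and V_log_integral: "(\<integral>x. ln \<bar>V x\<bar> \<partial>\<tau>) = 0"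
  using V by (auto simp: log_constraint_iff)

lemma V_measurable [measurable]: "V \<in> borel_measurable lebesgue"
  by (rule W0sp_measurable[OF V_W0sp])

lemma V_pos_\<tau>: "AE x in \<tau>. V x > 0"
proof -
  have "AE x in \<tau>. V x \<noteq> 0" using V by (simp add: log_constraint_iff)
  then show ?thesis using AE_\<tau>[OF V_nonneg] by eventually_elim simp
qed

lemma E_pos: "E > 0"
proof (rule ccontr)
  assume "\<not> E > 0"
  then have "E = 0" using energy_nonneg[of V] by simp
  then have "AE x in \<tau>. V x = 0" by (intro AE_\<tau> energy_eq_0D[OF V_W0sp])
  then have "AE x in \<tau>. False" using V_pos_\<tau> by eventually_elim simp
  then have "emeasure \<tau> UNIV = 0" by (subst (asm) AE_iff_measurable[OF _ refl]) auto
  then have "measure \<tau> UNIV = 0" by (simp add: measure_def del: measure_\<tau>)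
  then show False using W_pos by simp
qed

text \<open>Multiplying \<open>v\<close> by \<open>exp (- L / W)\<close> subtracts the mean of the
  logarithm and lands in the constraint; the energy is homogeneous of degree \<open>p\<close>. This
  replaces constrained minimality by an inequality for unconstrained competitors.\<close>

lemma energy_log_bound:
  assumes v: "v \<in> W0sp s p \<Omega>" and v0: "AE x in \<tau>. v x \<noteq> 0" and vi: "integrable \<tau> (\<lambda>x. ln \<bar>v x\<bar>)"
  shows "E * exp (p * (\<integral>x. ln \<bar>v x\<bar> \<partial>\<tau>) / W) \<le> energy v"
proof -
  define L where "L = (\<integral>x. ln \<bar>v x\<bar> \<partial>\<tau>)"
  define c where "c = exp (- L / W)"
  have c: "c > 0" by (simp add: c_def)
  note [measurable] = W0sp_measurable[OF v]
  have ln_c: "AE x in \<tau>. ln \<bar>c * v x\<bar> = - L / W + ln \<bar>v x\<bar>"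
    using v0 by eventually_elim (simp add: c_def abs_mult ln_mult)
  have i: "integrable \<tau> (\<lambda>x. - L / W + ln \<bar>v x\<bar>)"
    using vi by simp
  have "(\<lambda>x. c * v x) \<in> log_constraint s p \<Omega> \<omega>"
    unfolding log_constraint_iff
  proof (intro conjI)
    show "(\<lambda>x. c * v x) \<in> W0sp s p \<Omega>" by (rule W0sp_scale[OF v])
    show "AE x in \<tau>. c * v x \<noteq> 0" using v0 by eventually_elim (use c in simp)
    show "integrable \<tau> (\<lambda>x. ln \<bar>c * v x\<bar>)"
      using i by (rule integrable_cong_AE_imp) (use ln_c in \<open>auto elim: eventually_mono\<close>)
    have "(\<integral>x. ln \<bar>c * v x\<bar> \<partial>\<tau>) = (\<integral>x. - L / W + ln \<bar>v x\<bar> \<partial>\<tau>)"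
      by (rule integral_cong_AE[OF _ _ ln_c]) measurable
    also have "\<dots> = W * (- L / W) + L"
      using vi unfolding L_def by (subst Bochner_Integration.integral_add) auto
    also have "\<dots> = 0" using W_pos by simp
    finally show "(\<integral>x. ln \<bar>c * v x\<bar> \<partial>\<tau>) = 0" .
  qed
  from V_min[OF this] have "E \<le> c powr p * energy v"
    using c by (simp add: gagliardo_powr_energy energy_scale)
  then have "E * exp (p * L / W) \<le> c powr p * energy v * exp (p * L / W)"
    by (rule mult_right_mono) simp
  also have "\<dots> = energy v * (c powr p * exp (p * L / W))" by simp
  also have "c powr p * exp (p * L / W) = 1"
    by (simp add: c_def powr_def exp_add[symmetric])
  finally show ?thesis by (simp add: L_def)
qed

text \<open>
  Scaling \<open>V + t \<phi>\<close> back into the constraint and letting \<open>t\<close> tend to \<open>0\<close>. Fatou's lemma makes a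
  lower bound for \<open>V\<close> unnecessary here, at the price of an inequality.
\<close>

lemma Euler_Lagrange_ineq:
  assumes \<phi>: "\<phi> \<in> W0sp s p \<Omega>" and \<phi>0: "AE x in lebesgue. \<phi> x \<ge> 0"
  shows pairing_nonneg: "P V \<phi> \<ge> 0"
    and integrable_div_V: "integrable \<tau> (\<lambda>x. \<phi> x / V x)"
    and Euler_Lagrange_le: "E / W * (\<integral>x. \<phi> x / V x \<partial>\<tau>) \<le> P V \<phi>"
proof -
  note [measurable] = W0sp_measurable[OF \<phi>]
  define t where "t n = inverse (real (Suc n))" for n
  have t: "0 < t n" "t n \<le> 1" for n by (simp_all add: t_def inverse_le_1_iff)
  have t0: "t \<longlonglongrightarrow> 0" unfolding t_def by (rule LIMSEQ_inverse_real_of_nat)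
  define v where "v n x = V x + t n * \<phi> x" for n x
  define L where "L n = (\<integral>x. ln \<bar>v n x\<bar> \<partial>\<tau>)" for n
  define D where "D n = (energy (v n) - E) / t n" for n
  define h where "h n x = (ln \<bar>v n x\<bar> - ln \<bar>V x\<bar>) / t n" for n x
  have v: "v n \<in> W0sp s p \<Omega>" for n
    unfolding v_def[abs_def] by (intro W0sp_add W0sp_scale V_W0sp \<phi>)
  have [measurable]: "v n \<in> borel_measurable lebesgue" for n by (rule W0sp_measurable[OF v])
  have pos: "AE x in \<tau>. 0 < V x \<and> 0 \<le> \<phi> x"
    using V_pos_\<tau> AE_\<tau>[OF \<phi>0] by eventually_elim simp
  have Vv: "V x \<le> v n x" if "0 \<le> \<phi> x" for n x using that t(1)[of n] by (simp add: v_def)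
  \<comment> \<open>Because \<open>\<phi>\<close> is nonnegative, \<open>ln (v n)\<close> lies above
    \<open>ln V\<close>; from above it is controlled by a power that is integrable against the
    weight.\<close>
  have lni: "integrable \<tau> (\<lambda>x. ln \<bar>v n x\<bar>)" for n
  proof (rule Bochner_Integration.integrable_bound)
    show "integrable \<tau> (\<lambda>x. \<bar>ln \<bar>V x\<bar>\<bar> + \<bar>v n x\<bar> powr q0 / q0)"
      using q0 by (intro Bochner_Integration.integrable_add integrable_abs V_log_integrable
          integrable_divide W0sp_integrable_powr v) auto
    show "AE x in \<tau>. norm (ln \<bar>v n x\<bar>) \<le> norm (\<bar>ln \<bar>V x\<bar>\<bar> + \<bar>v n x\<bar> powr q0 / q0)"
      using pos
    proof eventually_elim
      case (elim x)
      then have vp: "v n x > 0" using Vv[of x n] by simp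
      have "ln (v n x) \<le> (v n x powr q0 - 1) / q0" by (rule ln_le_powr[OF vp q0])
      also have "\<dots> \<le> v n x powr q0 / q0" using q0 by (intro divide_right_mono) auto
      finally have "ln (v n x) \<le> v n x powr q0 / q0" .
      moreover have "ln (V x) \<le> ln (v n x)" using elim Vv[of x n] by (subst ln_le_cancel_iff) auto
      moreover have "0 \<le> v n x powr q0 / q0" using q0 by simp
      ultimately have "\<bar>ln (v n x)\<bar> \<le> \<bar>ln (V x)\<bar> + v n x powr q0 / q0" by linarith
      then show ?case using vp elim q0 by simp
    qed
  qed measurable
  have L: "L n / t n = (\<integral>x. h n x \<partial>\<tau>)" for n
    unfolding h_def L_def using lni V_log_integrable V_log_integral
    by (simp add: Bochner_Integration.integral_diff)
  have hi: "integrable \<tau> (h n)" for n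
    unfolding h_def using lni V_log_integrable by (intro integrable_divide Bochner_Integration.integrable_diff)
  have h0: "AE x in \<tau>. 0 \<le> h n x" for n
    using pos
  proof eventually_elim
    case (elim x)
    then have "ln (V x) \<le> ln (v n x)" using Vv[of x n] by (subst ln_le_cancel_iff) auto
    then show ?case using elim Vv[of x n] t(1)[of n] by (simp add: h_def)
  qed
  \<comment> \<open>The exponential bound, linearised by \<open>1 + x \<le> exp x\<close>, compares
    the quotient of the logarithmic integral with the quotient of the energy before any limit is
    taken.\<close>
  have D: "p * E / W * (L n / t n) \<le> D n" for n
  proof -
    have "AE x in \<tau>. v n x \<noteq> 0" using pos
    proof eventually_elim
      case (elim x) then show ?case using Vv[of x n] by simp
    qed
    then have "E * exp (p * L n / W) \<le> energy (v n)"
      unfolding L_def by (rule energy_log_bound[OF v _ lni])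
    moreover have "E * (1 + p * L n / W) \<le> E * exp (p * L n / W)"
      using E_pos exp_ge_add_one_self[of "p * L n / W"] by (intro mult_left_mono) auto
    ultimately have "E * (p * L n / W) \<le> energy (v n) - E" by (simp add: distrib_left)
    then have "E * (p * L n / W) / t n \<le> D n"
      unfolding D_def using t(1)[of n] by (intro divide_right_mono) auto
    then show ?thesis by (simp add: mult.commute mult.left_commute)
  qed
  have Dlim: "D \<longlonglongrightarrow> p * P V \<phi>"
    unfolding D_def v_def[abs_def] by (rule energy_derivative[OF V_W0sp \<phi> t t0])
  have D0: "D n \<ge> 0" for n
  proof -
    have "0 \<le> L n / t n" unfolding L using h0[of n] by (rule integral_nonneg_AE)
    then have "0 \<le> p * E / W * (L n / t n)" using p E_pos W_pos by (intro mult_nonneg_nonneg) auto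
    then show ?thesis using D[of n] by simp
  qed
  have "p * P V \<phi> \<ge> 0" using D0 by (intro LIMSEQ_le_const[OF Dlim]) auto
  then show "P V \<phi> \<ge> 0" using p by (simp add: zero_le_mult_iff)
  have hlim: "AE x in \<tau>. (\<lambda>n. h n x) \<longlonglongrightarrow> \<phi> x / V x"
    using pos
  proof eventually_elim
    case (elim x)
    have "((\<lambda>a. ln (V x + a * \<phi> x)) has_real_derivative inverse (V x + 0 * \<phi> x) * \<phi> x) (at 0)"
      using elim by (intro DERIV_chain2[OF DERIV_ln]) (auto intro!: derivative_eq_intros)
    then have d: "((\<lambda>a. (ln (V x + a * \<phi> x) - ln (V x)) / a) \<longlongrightarrow> \<phi> x / V x) (at 0)"
      by (simp add: DERIV_def divide_inverse mult.commute)
    have "t n \<noteq> 0" for n using t(1)[of n] by simp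
    then have "filterlim t (at 0) sequentially" using t0 by (simp add: filterlim_at)
    from filterlim_compose[OF d this]
    have "(\<lambda>n. (ln (V x + t n * \<phi> x) - ln (V x)) / t n) \<longlonglongrightarrow> \<phi> x / V x" .
    moreover have "h n x = (ln (V x + t n * \<phi> x) - ln (V x)) / t n" for n
      using elim t(1)[of n] by (simp add: h_def v_def)
    ultimately show ?case by simp
  qed
  have hD: "(\<integral>\<^sup>+x. ennreal (h n x) \<partial>\<tau>) \<le> ennreal (D n * (W / (p * E)))" for n
  proof -
    have "(\<integral>\<^sup>+x. ennreal (h n x) \<partial>\<tau>) = ennreal (L n / t n)"
      unfolding L by (rule nn_integral_eq_integral[OF hi h0])
    also have "L n / t n = p * E / W * (L n / t n) * (W / (p * E))"
      using p E_pos W_pos by simp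
    also have "\<dots> \<le> D n * (W / (p * E))"
      using D[of n] p E_pos W_pos by (intro mult_right_mono) auto
    finally show ?thesis by (simp add: ennreal_leI)
  qed
  \<comment> \<open>Fatou needs only that the quotients \<open>h n\<close> are nonnegative and
    converge to \<open>\<phi> / V\<close>; their integrals are bounded by the convergent energy
    quotients. Integrability of \<open>\<phi> / V\<close> is part of the result.\<close>
  have "(\<integral>\<^sup>+x. ennreal (\<phi> x / V x) \<partial>\<tau>) = (\<integral>\<^sup>+x. liminf (\<lambda>n. ennreal (h n x)) \<partial>\<tau>)"
  proof (rule nn_integral_cong_AE)
    show "AE x in \<tau>. ennreal (\<phi> x / V x) = liminf (\<lambda>n. ennreal (h n x))"
      using hlim
    proof eventually_elim
      case (elim x)
      then have "(\<lambda>n. ennreal (h n x)) \<longlonglongrightarrow> ennreal (\<phi> x / V x)" by (rule tendsto_ennrealI)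
      then show ?case by (rule lim_imp_Liminf[OF sequentially_bot, symmetric])
    qed
  qed
  also have "\<dots> \<le> liminf (\<lambda>n. \<integral>\<^sup>+x. ennreal (h n x) \<partial>\<tau>)"
    unfolding h_def by (rule nn_integral_liminf) measurable
  also have "\<dots> \<le> liminf (\<lambda>n. ennreal (D n * (W / (p * E))))"
    by (intro Liminf_mono always_eventually allI hD)
  also have "\<dots> = ennreal (p * P V \<phi> * (W / (p * E)))"
    by (intro lim_imp_Liminf sequentially_bot tendsto_ennrealI tendsto_mult Dlim tendsto_const)
  finally have fin: "(\<integral>\<^sup>+x. ennreal (\<phi> x / V x) \<partial>\<tau>) \<le> ennreal (p * P V \<phi> * (W / (p * E)))" .
  have q0': "AE x in \<tau>. 0 \<le> \<phi> x / V x" using pos by eventually_elim simp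
  show i: "integrable \<tau> (\<lambda>x. \<phi> x / V x)"
  proof (rule integrableI_nonneg)
    show "(\<integral>\<^sup>+x. ennreal (\<phi> x / V x) \<partial>\<tau>) < \<infinity>" using fin by (rule order_le_less_trans) simp
  qed (use q0' in auto)
  have "ennreal (\<integral>x. \<phi> x / V x \<partial>\<tau>) \<le> ennreal (p * P V \<phi> * (W / (p * E)))"
    using fin by (simp add: nn_integral_eq_integral[OF i q0'])
  then have "(\<integral>x. \<phi> x / V x \<partial>\<tau>) \<le> p * P V \<phi> * (W / (p * E))"
    using \<open>P V \<phi> \<ge> 0\<close> p W_pos E_pos by (subst (asm) ennreal_le_iff) auto
  then have "E / W * (\<integral>x. \<phi> x / V x \<partial>\<tau>) \<le> E / W * (p * P V \<phi> * (W / (p * E)))"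
    using E_pos W_pos by (intro mult_left_mono) auto
  also have "\<dots> = P V \<phi>" using p E_pos W_pos by simp
  finally show "E / W * (\<integral>x. \<phi> x / V x \<partial>\<tau>) \<le> P V \<phi>" .
qed

text \<open>Equality holds for \<open>\<phi> = V\<close>, so it propagates to all \<open>\<phi>\<close> with \<open>K V \<plusminus> \<phi> \<ge> 0\<close>.\<close>

lemma Euler_Lagrange_eq:
  assumes \<phi>: "\<phi> \<in> W0sp s p \<Omega>" and K: "AE x in lebesgue. \<bar>\<phi> x\<bar> \<le> K * V x"
  shows "P V \<phi> = E / W * (\<integral>x. \<phi> x / V x \<partial>\<tau>)"
proof -
  note [measurable] = W0sp_measurable[OF \<phi>]
  have one: "E / W * (\<integral>x. f x / V x \<partial>\<tau>) \<le> P V f \<and> integrable \<tau> (\<lambda>x. f x / V x)"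
    if f: "f \<in> W0sp s p \<Omega>" and Kf: "AE x in lebesgue. \<bar>f x\<bar> \<le> K * V x" for f
  proof -
    note [measurable] = W0sp_measurable[OF f]
    \<comment> \<open>This is \<open>K * V + f\<close>, nonnegative by assumption. Its
      \<open>K\<close>-parts contribute \<open>K * E\<close> on both sides of the inequality and
      cancel, leaving the inequality for \<open>f\<close> of either sign.\<close>
    define g where "g x = K * V x - (- 1) * f x" for x
    have mf: "(\<lambda>x. (- 1) * f x) \<in> W0sp s p \<Omega>" by (rule W0sp_scale[OF f])
    have KV: "(\<lambda>x. K * V x) \<in> W0sp s p \<Omega>" by (rule W0sp_scale[OF V_W0sp])
    have g: "g \<in> W0sp s p \<Omega>" unfolding g_def[abs_def] by (rule W0sp_diff[OF KV mf])
    have g0: "AE x in lebesgue. 0 \<le> g x" using Kf by eventually_elim (auto simp: g_def)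
    have Pg: "P V g = K * E + P V f"
      unfolding g_def[abs_def] pairing_diff[OF V_W0sp KV mf] pairing_scale[OF V_W0sp V_W0sp]
        pairing_scale[OF V_W0sp f] pairing_self[OF V_W0sp] by simp
    have eq: "AE x in \<tau>. g x / V x = K + f x / V x"
      using V_pos_\<tau> by eventually_elim (simp add: g_def field_simps)
    have gm [measurable]: "g \<in> borel_measurable lebesgue" by (rule W0sp_measurable[OF g])
    have i: "integrable \<tau> (\<lambda>x. g x / V x)" by (rule integrable_div_V[OF g g0])
    have "integrable \<tau> (\<lambda>x. K + f x / V x)"
      using i by (rule integrable_cong_AE_imp) (use eq in \<open>auto elim: eventually_mono\<close>)
    then have "integrable \<tau> (\<lambda>x. (K + f x / V x) - K)"
      by (rule Bochner_Integration.integrable_diff) simp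
    then have fi: "integrable \<tau> (\<lambda>x. f x / V x)" by simp
    have "(\<integral>x. g x / V x \<partial>\<tau>) = (\<integral>x. K + f x / V x \<partial>\<tau>)"
      by (rule integral_cong_AE[OF _ _ eq]) measurable
    also have "\<dots> = W * K + (\<integral>x. f x / V x \<partial>\<tau>)"
      using fi by (subst Bochner_Integration.integral_add) auto
    finally have "E / W * (W * K + (\<integral>x. f x / V x \<partial>\<tau>)) \<le> K * E + P V f"
      using Euler_Lagrange_le[OF g g0] Pg by simp
    then show ?thesis using fi W_pos by (simp add: distrib_left mult.commute)
  qed
  have "E / W * (\<integral>x. \<phi> x / V x \<partial>\<tau>) \<le> P V \<phi>" using one[OF \<phi> K] by simp
  \<comment> \<open>The same inequality for \<open>- \<phi>\<close> reverses the direction.\<close>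
  moreover have "E / W * (\<integral>x. (- 1 * \<phi> x) / V x \<partial>\<tau>) \<le> P V (\<lambda>x. - 1 * \<phi> x)"
    using one[OF W0sp_scale[OF \<phi>, of "-1"]] K by simp
  then have "P V \<phi> \<le> E / W * (\<integral>x. \<phi> x / V x \<partial>\<tau>)"
    unfolding pairing_scale[OF V_W0sp \<phi>] by simp
  ultimately show ?thesis by simp
qed

end

section \<open>The strong minimum principle\<close>

text \<open>Induction shows \<open>y j \<le> y 0 * \<theta> ^ j\<close> for
  \<open>\<theta> = b powr (- 1 / \<beta>)\<close>. This ratio is chosen so that
  \<open>b * \<theta> powr \<beta> = 1\<close>: the superlinear power then exactly absorbs the
  growth \<open>b ^ j\<close>, and the smallness of \<open>y 0\<close> pays for one factor
  \<open>\<theta>\<close>.\<close>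

lemma de_giorgi_iteration:
  fixes y :: "nat \<Rightarrow> real"
  assumes y: "\<And>j. 0 \<le> y j" and B: "B > 0" and b: "b > 1" and \<beta>: "\<beta> > 0"
    and step: "\<And>j. y (Suc j) \<le> B * b ^ j * y j powr (1 + \<beta>)"
    and start: "B * y 0 powr \<beta> \<le> b powr (- 1 / \<beta>)"
  shows "y \<longlonglongrightarrow> 0"
proof -
  define \<theta> where "\<theta> = b powr (- 1 / \<beta>)"
  have \<theta>: "\<theta> > 0" "\<theta> < 1" using b \<beta> by (simp_all add: \<theta>_def powr_less_one divide_neg_pos)
  have "\<theta> powr \<beta> = b powr (- 1)" unfolding \<theta>_def powr_powr using \<beta> by simp
  then have b\<theta>: "b * \<theta> powr \<beta> = 1" using b by (simp add: powr_minus_divide)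
  have le: "y j \<le> y 0 * \<theta> ^ j" for j
  proof (induction j)
    case (Suc j)
    have "y (Suc j) \<le> B * b ^ j * y j powr (1 + \<beta>)" by (rule step)
    also have "\<dots> \<le> B * b ^ j * (y 0 * \<theta> ^ j) powr (1 + \<beta>)"
      using Suc y B b \<beta> by (intro mult_left_mono powr_mono2) auto
    also have "(y 0 * \<theta> ^ j) powr (1 + \<beta>) = (y 0 * \<theta> ^ j) * (y 0 powr \<beta> * (\<theta> powr \<beta>) ^ j)"
    proof -
      have "(y 0 * \<theta> ^ j) powr (1 + \<beta>) = (y 0 * \<theta> ^ j) * (y 0 * \<theta> ^ j) powr \<beta>"
        using y[of 0] \<theta> by (cases "y 0 = 0") (simp_all add: powr_add)
      also have "(y 0 * \<theta> ^ j) powr \<beta> = y 0 powr \<beta> * (\<theta> powr \<beta>) ^ j"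
        using y[of 0] \<theta> by (simp add: powr_mult powr_realpow[symmetric] powr_powr mult.commute)
      finally show ?thesis .
    qed
    also have "B * b ^ j * ((y 0 * \<theta> ^ j) * (y 0 powr \<beta> * (\<theta> powr \<beta>) ^ j))
        = (y 0 * \<theta> ^ j) * ((B * y 0 powr \<beta>) * (b * \<theta> powr \<beta>) ^ j)"
      by (simp add: power_mult_distrib)
    also have "\<dots> \<le> (y 0 * \<theta> ^ j) * \<theta>"
      unfolding b\<theta> using start y[of 0] \<theta> by (intro mult_left_mono) (auto simp: \<theta>_def)
    finally show ?case by (simp add: mult_ac)
  qed simp
  have "(\<lambda>j. y 0 * \<theta> ^ j) \<longlonglongrightarrow> y 0 * 0"
    using \<theta> by (intro tendsto_mult LIMSEQ_power_zero) auto
  then have lim: "(\<lambda>j. y 0 * \<theta> ^ j) \<longlonglongrightarrow> 0" by simp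
  show ?thesis by (rule tendsto_sandwich[OF _ _ tendsto_const lim]) (use le y in simp_all)
qed

text \<open>If \<open>\<bar>a\<bar>\<close> is at least \<open>2 * \<bar>b\<bar>\<close>, then
  \<open>b - a\<close> has the sign opposite to \<open>a\<close> and size at least
  \<open>\<bar>a\<bar> / 2\<close>. Otherwise
  \<open>\<bar>b - a\<bar> \<le> 3 * \<bar>b\<bar>\<close> and
  \<open>\<bar>a\<bar> \<le> 2 * \<bar>b\<bar>\<close>, and the last summand \<open>2\<close> of the
  constant pays for the negative term. It will be used with \<open>a\<close> the increment of a
  truncation and \<open>b\<close> that of the cut-off.\<close>

lemma jp_diff_mult_le:
  fixes a b :: real
  assumes p: "p > 1"
  shows "jp p (b - a) * a \<le> - ((1/2) powr (p - 1) * \<bar>a\<bar> powr p) + (2 * 3 powr (p - 1) + 2) * \<bar>b\<bar> powr p"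
proof (cases "2 * \<bar>b\<bar> \<le> \<bar>a\<bar>")
  case True
  have "(1/2) powr (p - 1) * \<bar>a\<bar> powr p = (\<bar>a\<bar> / 2) powr (p - 1) * \<bar>a\<bar>"
    using p by (cases "a = 0") (simp_all add: powr_divide powr_mult_base mult.commute)
  also have "\<dots> \<le> \<bar>b - a\<bar> powr (p - 1) * \<bar>a\<bar>"
  proof -
    have "\<bar>a\<bar> / 2 \<le> \<bar>b - a\<bar>" using True abs_triangle_ineq2[of a b] abs_minus_commute[of a b] by linarith
    then show ?thesis using p by (intro mult_right_mono powr_mono2) auto
  qed
  also have "\<dots> = \<bar>jp p (b - a)\<bar> * \<bar>a\<bar>" by (simp only: abs_jp)
  also have "\<dots> = - (jp p (b - a) * a)"
  proof -
    have "jp p (b - a) * a \<le> 0"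
    proof (cases "a \<ge> 0")
      case nn: True
      then have "jp p (b - a) \<le> jp p 0" using True by (intro jp_mono[OF p]) auto
      then show ?thesis using nn by (simp add: jp_def mult_nonpos_nonneg)
    next
      case False
      then have "jp p (b - a) \<ge> jp p 0" using True by (intro jp_mono[OF p]) auto
      then show ?thesis using False by (simp add: jp_def mult_nonneg_nonpos)
    qed
    then show ?thesis by (simp add: abs_mult[symmetric])
  qed
  finally have "jp p (b - a) * a \<le> - ((1/2) powr (p - 1) * \<bar>a\<bar> powr p)" by simp
  also have "\<dots> \<le> - ((1/2) powr (p - 1) * \<bar>a\<bar> powr p) + (2 * 3 powr (p - 1) + 2) * \<bar>b\<bar> powr p"
    by simp
  finally show ?thesis .
next
  case False
  have bb: "\<bar>b\<bar> powr (p - 1) * \<bar>b\<bar> = \<bar>b\<bar> powr p"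
    by (cases "b = 0") (simp_all add: powr_mult_base mult.commute)
  have "jp p (b - a) * a \<le> \<bar>jp p (b - a)\<bar> * \<bar>a\<bar>" by (metis abs_ge_self abs_mult)
  also have "\<dots> = \<bar>b - a\<bar> powr (p - 1) * \<bar>a\<bar>" by (simp only: abs_jp)
  also have "\<dots> \<le> (3 * \<bar>b\<bar>) powr (p - 1) * (2 * \<bar>b\<bar>)"
    using False p by (intro mult_mono powr_mono2) auto
  also have "\<dots> = 2 * 3 powr (p - 1) * (\<bar>b\<bar> powr (p - 1) * \<bar>b\<bar>)" by (simp add: powr_mult)
  finally have 1: "jp p (b - a) * a \<le> 2 * 3 powr (p - 1) * \<bar>b\<bar> powr p" unfolding bb .
  have "(1/2) powr (p - 1) * \<bar>a\<bar> powr p \<le> (1/2) powr (p - 1) * (2 * \<bar>b\<bar>) powr p"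
    using False p by (intro mult_left_mono powr_mono2) auto
  also have "\<dots> = 2 * \<bar>b\<bar> powr p"
  proof -
    have "(1/2::real) powr (p - 1) * 2 powr p = 2"
      by (simp add: powr_divide powr_diff)
    then show ?thesis by (simp add: powr_mult mult.assoc[symmetric])
  qed
  finally show ?thesis using 1 by (simp add: distrib_right)
qed

context frac_sobolev
begin

text \<open>Turns a lower bound on the kernel mass of \<open>B\<close>, uniform over points of
  \<open>D\<close>, into a lower bound for the interaction of the two sets.\<close>

lemma kernel_mass_product:
  assumes [measurable]: "D \<in> sets lebesgue" "B \<in> sets lebesgue"
    and \<kappa>: "\<And>x :: 'a. x \<in> D \<Longrightarrow> \<kappa> \<le> (\<integral>\<^sup>+y. ennreal (frac_kernel s p (x, y)) * indicator B y \<partial>lebesgue)"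
  shows "\<kappa> * emeasure lebesgue D \<le> (\<integral>\<^sup>+z. indicator (D \<times> B) z \<partial>\<nu>)"
proof -
  have D: "(\<lambda>z::'a\<times>'a. indicator D (fst z) :: ennreal) \<in> borel_measurable lebesgue"
    by (rule measurable_compose[OF measurable_fst_lebesgue]) simp
  have B: "(\<lambda>z::'a\<times>'a. indicator B (snd z) :: ennreal) \<in> borel_measurable lebesgue"
    by (rule measurable_compose[OF measurable_snd_lebesgue]) simp
  have eq: "(\<lambda>z. indicator (D \<times> B) z :: ennreal) = (\<lambda>z. indicator D (fst z) * indicator B (snd z))"
    by (auto simp: indicator_def)
  have m [measurable]: "(\<lambda>z. indicator (D \<times> B) z :: ennreal) \<in> borel_measurable lebesgue"
    unfolding eq using D B by (rule borel_measurable_times_ennreal)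
  have "\<kappa> * emeasure lebesgue D = (\<integral>\<^sup>+x. \<kappa> * indicator D x \<partial>lebesgue)"
    by (simp add: nn_integral_cmult_indicator)
  also have "\<dots> \<le> (\<integral>\<^sup>+x. (\<integral>\<^sup>+y. ennreal (frac_kernel s p (x, y)) * indicator (D \<times> B) (x, y) \<partial>lebesgue) \<partial>lebesgue)"
  proof (rule nn_integral_mono)
    fix x show "\<kappa> * indicator D x \<le> (\<integral>\<^sup>+y. ennreal (frac_kernel s p (x, y)) * indicator (D \<times> B) (x, y) \<partial>lebesgue)"
    proof (cases "x \<in> D")
      case True
      then show ?thesis using \<kappa>[OF True] by (simp add: indicator_times)
    qed simp
  qed
  also have "\<dots> = (\<integral>\<^sup>+z. ennreal (frac_kernel s p z) * indicator (D \<times> B) z \<partial>lebesgue)"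
    by (rule nn_integral_lebesgue_fst[symmetric]) measurable
  also have "\<dots> = (\<integral>\<^sup>+z. indicator (D \<times> B) z \<partial>\<nu>)"
    by (rule nn_integral_frac_measure[symmetric]) measurable
  finally show ?thesis .
qed

text \<open>
  De Giorgi iteration for \<open>U = k g - V\<close> with levels increasing from \<open>k/4\<close> to \<open>k/2\<close>. The initial
  smallness comes from the long-range interaction with the set \<open>A\<close> where \<open>V \<ge> \<delta>\<close>: it forces the
  measure of \<open>{U > k/4}\<close> to be of order \<open>k powr (p - 1)\<close>, while the threshold of the iteration
  does not depend on \<open>k\<close>.
\<close>

lemma minimum_principle_aux:
  assumes V: "V \<in> W0sp s p \<Omega>" and V0: "\<And>x. V x \<ge> 0" and Vnz: "\<not> (AE x in lebesgue. V x = 0)"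
    and super: "\<And>\<phi>. \<phi> \<in> W0sp s p \<Omega> \<Longrightarrow> AE x in lebesgue. \<phi> x \<ge> 0 \<Longrightarrow> P V \<phi> \<ge> 0"
    and \<rho>: "\<rho> > 0" "cball x0 \<rho> \<subseteq> \<Omega>"
  obtains C where "C > 0" "AE x in lebesgue. x \<in> ball x0 (\<rho> / 2) \<longrightarrow> V x \<ge> C"
proof -
  note Vm [measurable] = W0sp_measurable[OF V]
  have [measurable]: "\<Omega> \<in> sets lebesgue" using open_\<Omega> by simp
  have \<Omega>l: "\<Omega> \<in> lmeasurable" by (rule bounded_set_imp_lmeasurable[OF bounded_\<Omega>]) measurable
  define N where "N = real DIM('a)"
  have N: "N > 0" by (simp add: N_def)
  define \<beta> where "\<beta> = s * p / N"
  have \<beta>: "\<beta> > 0" using s p N by (simp add: \<beta>_def)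
  obtain g where g: "g \<in> test_functions \<Omega>" "\<And>x. g x \<ge> 0" "\<And>x. x \<in> ball x0 (\<rho> / 2) \<Longrightarrow> g x \<ge> 1"
    using test_functions_ball[OF \<rho>] by blast
  note gm [measurable] = test_functions_measurable[OF g(1)]
  have gW: "g \<in> W0sp s p \<Omega>" by (rule test_functions_W0sp[OF g(1)])
  obtain M where M: "M > 0" "\<And>x. \<bar>g x\<bar> \<le> M" using test_functions_bounded[OF g(1)] by blast
  obtain L where L: "L > 0" "\<And>x y. \<bar>g x - g y\<bar> \<le> L * norm (x - y)" using test_functions_lipschitz[OF g(1)] by blast
  obtain C1 where C1: "C1 > 0" "\<And>D. D \<in> lmeasurable \<Longrightarrow>
    (\<integral>\<^sup>+z. ennreal (\<bar>incr g z\<bar> powr p) * indicator {z. fst z \<in> D \<or> snd z \<in> D} z \<partial>\<nu>)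
      \<le> ennreal (C1 * measure lebesgue D)"
    using incr_integral_near[OF gm M(2) less_imp_le[OF L(1)] L(2)] by blast
  obtain c2 where c2: "c2 > 0" "\<And>(x :: 'a) D. D \<in> lmeasurable \<Longrightarrow> measure lebesgue D > 0 \<Longrightarrow>
    ennreal (c2 * measure lebesgue D powr (- (s * p / DIM('a))))
      \<le> (\<integral>\<^sup>+y. ennreal (frac_kernel s p (x, y)) * indicator (- D) y \<partial>lebesgue)"
    using frac_kernel_integral_compl[OF s(1) p0] by blast
  define c0 where "c0 = (1/2::real) powr (p - 1)"
  define C0 where "C0 = 2 * 3 powr (p - 1) + (2::real)"
  have c0: "c0 > 0" and C0: "C0 > 0" by (simp_all add: c0_def C0_def add_pos_pos)
  obtain R where R: "R > 0" "\<And>x. x \<in> \<Omega> \<Longrightarrow> norm x < R"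
    using bounded_\<Omega> by (meson bounded_pos_less)
  \<comment> \<open>If all level sets at heights \<open>1 / (n + 1)\<close> were null, so would be
    their union, where \<open>V\<close> is positive.\<close>
  obtain \<delta> where \<delta>: "\<delta> > 0" "\<not> (AE x in lebesgue. \<not> (x \<in> \<Omega> \<and> V x \<ge> \<delta>))"
  proof (rule ccontr)
    assume "\<not> thesis"
    then have "AE x in lebesgue. \<not> (x \<in> \<Omega> \<and> V x \<ge> \<delta>)" if "\<delta> > 0" for \<delta> using that \<open>\<And>\<delta>. \<lbrakk>0 < \<delta>; \<not> (AE x in lebesgue. \<not> (x \<in> \<Omega> \<and> \<delta> \<le> V x))\<rbrakk> \<Longrightarrow> thesis\<close> by blast
    then have "AE x in lebesgue. \<forall>n. \<not> (x \<in> \<Omega> \<and> V x \<ge> inverse (real (Suc n)))"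
      by (subst AE_all_countable) simp
    then have "AE x in lebesgue. V x = 0"
      using W0sp_outside[OF V]
    proof eventually_elim
      case (elim x)
      show ?case
      proof (rule ccontr)
        assume "V x \<noteq> 0"
        then have "V x > 0" using V0[of x] by simp
        then obtain n where "inverse (real (Suc n)) < V x" using reals_Archimedean by blast
        then show False using elim(1)[rule_format, of n] elim(2) \<open>V x \<noteq> 0\<close> by auto
      qed
    qed
    then show False using Vnz by simp
  qed
  define A where "A = {x \<in> \<Omega>. V x \<ge> \<delta>}"
  have Am [measurable]: "A \<in> sets lebesgue"
  proof -
    have "{x \<in> space lebesgue. x \<in> \<Omega> \<and> V x \<ge> \<delta>} \<in> sets lebesgue" by measurable
    then show ?thesis by (simp add: A_def)
  qed
  have Al: "A \<in> lmeasurable" using fmeasurableI2[OF \<Omega>l _ Am] by (auto simp: A_def)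
  have mA: "measure lebesgue A > 0"
  proof (rule ccontr)
    assume "\<not> measure lebesgue A > 0"
    then have "measure lebesgue A = 0" using measure_nonneg[of lebesgue A] by simp
    then have "A \<in> null_sets lebesgue" using Al by (simp add: null_sets_def emeasure_eq_measure2)
    then have "AE x in lebesgue. x \<notin> A" by (rule AE_not_in)
    then show False using \<delta>(2) by (simp add: A_def)
  qed
  define q where "q = N + s * p"
  \<comment> \<open>The least kernel mass of \<open>A\<close> seen from a point of
    \<open>\<Omega>\<close>: two points of \<open>\<Omega>\<close> are at most \<open>2 * R\<close>
    apart.\<close>
  define cA where "cA = 1 / (2 * R) powr q * measure lebesgue A"
  have cA: "cA > 0" using mA R by (simp add: cA_def)
  \<comment> \<open>For \<open>x\<close> in the superlevel set and \<open>y\<close> in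
    \<open>A\<close>, the increment of \<open>V\<close> contributes
    \<open>(\<delta> / 2) powr (p - 1)\<close>, that of the truncation \<open>k / 4\<close>, and the
    kernel \<open>cA\<close>.\<close>
  define Z where "Z = (\<delta> / 2) powr (p - 1) * (1/4) * cA"
  have Z: "Z > 0" using \<delta>(1) cA by (simp add: Z_def)

  \<comment> \<open>For \<open>l \<ge> 0\<close> these sets lie in \<open>\<Omega>\<close>, because
    \<open>V\<close> is nonnegative and \<open>g\<close> vanishes outside; so they have finite
    measure and the truncations at level \<open>l\<close> are admissible directions.\<close>
  define D where "D k l = {x. k * g x - V x > l}" for k l
  define \<phi> where "\<phi> k l x = max ((k * g x - V x) - l) 0" for k l x
  have Dm [measurable]: "D k l \<in> sets lebesgue" for k l
  proof -
    have "{x \<in> space lebesgue. k * g x - V x > l} \<in> sets lebesgue" by measurable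
    then show ?thesis by (simp add: D_def)
  qed
  have Dc [measurable]: "- D k l \<in> sets lebesgue" for k l
    using sets.compl_sets[OF Dm[of k l]] by (simp add: Compl_eq_Diff_UNIV)
  have D\<Omega>: "D k l \<subseteq> \<Omega>" if "l \<ge> 0" for k l
  proof
    fix x assume "x \<in> D k l"
    then have "g x \<noteq> 0" using that V0[of x] by (auto simp: D_def)
    then show "x \<in> \<Omega>" using test_functions_outside[OF g(1), of x] by blast
  qed
  have Dl: "D k l \<in> lmeasurable" if "l \<ge> 0" for k l
    using fmeasurableI2[OF \<Omega>l D\<Omega>[OF that] Dm] .
  have \<phi>W: "\<phi> k l \<in> W0sp s p \<Omega>" if "l \<ge> 0" for k l
    unfolding \<phi>_def[abs_def] by (intro W0sp_pos_part W0sp_diff W0sp_scale gW V that)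
  have \<phi>0: "\<phi> k l x \<ge> 0" for k l x by (simp add: \<phi>_def)
  have PV: "P V (\<phi> k l) \<ge> 0" if "l \<ge> 0" for k l
    by (rule super[OF \<phi>W[OF that]]) (simp add: \<phi>0)
  define F where "F k l z = \<bar>incr g z\<bar> powr p * indicator {z. fst z \<in> D k l \<or> snd z \<in> D k l} z" for k l z
  have Sm [measurable]: "{z. fst z \<in> D k l \<or> snd z \<in> D k l} \<in> sets lebesgue" for k l
  proof -
    have "{z. fst z \<in> D k l \<or> snd z \<in> D k l} = fst -` D k l \<inter> space lebesgue \<union> snd -` D k l \<inter> space lebesgue" by auto
    also have "\<dots> \<in> sets lebesgue"
      using measurable_sets[OF measurable_fst_lebesgue Dm] measurable_sets[OF measurable_snd_lebesgue Dm] by (intro sets.Un)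
    finally show ?thesis .
  qed
  have Fm [measurable]: "F k l \<in> borel_measurable \<nu>" for k l unfolding F_def by measurable
  have F0: "F k l z \<ge> 0" for k l z by (simp add: F_def)
  have Fi: "integrable \<nu> (F k l)" for k l
    by (rule Bochner_Integration.integrable_bound[OF integrable_energy[OF gW]])
      (auto simp: F_def indicator_def)
  have FI: "(\<integral>z. F k l z \<partial>\<nu>) \<le> C1 * measure lebesgue (D k l)" if "l \<ge> 0" for k l
  proof -
    have "ennreal (\<integral>z. F k l z \<partial>\<nu>) = (\<integral>\<^sup>+z. ennreal (F k l z) \<partial>\<nu>)"
      by (rule nn_integral_eq_integral[symmetric, OF Fi]) (simp add: F0)
    also have "\<dots> = (\<integral>\<^sup>+z. ennreal (\<bar>incr g z\<bar> powr p) * indicator {z. fst z \<in> D k l \<or> snd z \<in> D k l} z \<partial>\<nu>)"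
      by (intro nn_integral_cong) (simp add: F_def indicator_def)
    also have "\<dots> \<le> ennreal (C1 * measure lebesgue (D k l))" by (rule C1(2)[OF Dl[OF that]])
    finally show ?thesis using C1(1) by (subst (asm) ennreal_le_iff) auto
  qed

  \<comment> \<open>When both points are in the superlevel set, the increment of \<open>V\<close> is
    exactly \<open>b - a\<close>. When only one is, they differ, but on the side that monotonicity
    of \<open>jp\<close> and the sign of \<open>a\<close> make favourable. When neither is, both
    sides are trivial.\<close>
  have pt: "jp p (incr V z) * incr (\<phi> k l) z \<le> - (c0 * \<bar>incr (\<phi> k l) z\<bar> powr p) + C0 * k powr p * F k l z"
    if k: "k > 0" for k l z
  proof -
    define a b where "a = incr (\<phi> k l) z" and "b = k * incr g z"
    obtain x y where z: "z = (x, y)" by (cases z)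
    show ?thesis
    proof (cases "x \<in> D k l \<or> y \<in> D k l")
      case True
      have "jp p (incr V z) * a \<le> jp p (b - a) * a"
      proof -
        have x': "x \<in> D k l \<Longrightarrow> \<phi> k l x = k * g x - V x - l" "x \<notin> D k l \<Longrightarrow> \<phi> k l x = 0 \<and> V x \<ge> k * g x - l"
          by (auto simp: D_def \<phi>_def max_def)
        have y': "y \<in> D k l \<Longrightarrow> \<phi> k l y = k * g y - V y - l" "y \<notin> D k l \<Longrightarrow> \<phi> k l y = 0 \<and> V y \<ge> k * g y - l"
          by (auto simp: D_def \<phi>_def max_def)
        have ab: "a = \<phi> k l x - \<phi> k l y" "b = k * g x - k * g y" "incr V z = V x - V y"
          by (simp_all add: a_def b_def z incr_def algebra_simps)
        consider "x \<in> D k l" "y \<in> D k l" | "x \<in> D k l" "y \<notin> D k l" | "x \<notin> D k l" "y \<in> D k l"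
          using True by blast
        then show ?thesis
        proof cases
          case 1
          then have "incr V z = b - a" using x' y' ab by simp
          then show ?thesis by simp
        next
          case 2
          then have "incr V z \<le> b - a" "a \<ge> 0" using x' y' ab \<phi>0[of k l x] by auto
          then show ?thesis by (intro mult_right_mono jp_mono[OF p])
        next
          case 3
          then have "b - a \<le> incr V z" "a \<le> 0" using x' y' ab \<phi>0[of k l y] by auto
          then show ?thesis by (intro mult_right_mono_neg jp_mono[OF p])
        qed
      qed
      also have "\<dots> \<le> - (c0 * \<bar>a\<bar> powr p) + C0 * \<bar>b\<bar> powr p"
        unfolding c0_def C0_def by (rule jp_diff_mult_le[OF p])
      also have "\<bar>b\<bar> powr p = k powr p * F k l z"
        using True k by (simp add: b_def F_def z abs_mult powr_mult)
      finally show ?thesis by (simp add: a_def mult.assoc)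
    next
      case False
      then have "incr (\<phi> k l) z = 0" by (auto simp: z incr_def \<phi>_def D_def max_def)
      then show ?thesis using C0 F0[of k l z] by simp
    qed
  qed

  \<comment> \<open>Supersolution inequality tested with the truncation; only pairs meeting the
    superlevel set feel the cut-off, hence the measure on the right.\<close>
  have caccioppoli: "c0 * energy (\<phi> k l) \<le> C0 * k powr p * (C1 * measure lebesgue (D k l))"
    if k: "k > 0" and l: "l \<ge> 0" for k l
  proof -
    have "0 \<le> P V (\<phi> k l)" by (rule PV[OF l])
    also have "\<dots> \<le> (\<integral>z. - (c0 * \<bar>incr (\<phi> k l) z\<bar> powr p) + C0 * k powr p * F k l z \<partial>\<nu>)"
      unfolding pairing_eq[OF V \<phi>W[OF l]]
      by (intro integral_mono integrable_pairing V \<phi>W l pt k Bochner_Integration.integrable_add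
          Bochner_Integration.integrable_minus integrable_mult_right integrable_energy Fi)
    also have "\<dots> = - (c0 * energy (\<phi> k l)) + C0 * k powr p * (\<integral>z. F k l z \<partial>\<nu>)"
      using Fi integrable_energy[OF \<phi>W[OF l]] by (simp add: energy_eq[OF \<phi>W[OF l]])
    also have "\<dots> \<le> - (c0 * energy (\<phi> k l)) + C0 * k powr p * (C1 * measure lebesgue (D k l))"
      using FI[OF l] C0 by (intro add_left_mono mult_left_mono) auto
    finally show ?thesis by simp
  qed

  \<comment> \<open>Between a point above level \<open>l + h\<close> and a point not above level
    \<open>l\<close> the truncation jumps by at least \<open>h\<close>. The kernel mass off
    \<open>D k l\<close> grows as that set shrinks, which yields the negative power of its
    measure.\<close>
  have gain: "h powr p * (c2 * measure lebesgue (D k l) powr (- \<beta>)) * measure lebesgue (D k (l + h)) \<le> energy (\<phi> k l)"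
    if l: "l \<ge> 0" and h: "h > 0" and pos: "measure lebesgue (D k l) > 0" for k l h
  proof -
    have "ennreal (c2 * measure lebesgue (D k l) powr (- \<beta>)) * emeasure lebesgue (D k (l + h))
        \<le> (\<integral>\<^sup>+z. indicator (D k (l + h) \<times> (- D k l)) z \<partial>\<nu>)"
      using c2(2)[OF Dl[OF l] pos] by (intro kernel_mass_product) (auto simp: \<beta>_def N_def)
    then have "ennreal (h powr p) * (ennreal (c2 * measure lebesgue (D k l) powr (- \<beta>)) * emeasure lebesgue (D k (l + h)))
        \<le> ennreal (h powr p) * (\<integral>\<^sup>+z. indicator (D k (l + h) \<times> (- D k l)) z \<partial>\<nu>)"
      by (rule mult_left_mono) simp
    also have "\<dots> = (\<integral>\<^sup>+z. ennreal (h powr p) * indicator (D k (l + h) \<times> (- D k l)) z \<partial>\<nu>)"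
    proof (rule nn_integral_cmult[symmetric])
      have "D k (l + h) \<times> (- D k l) = (fst -` D k (l + h) \<inter> space lebesgue) \<inter> (snd -` (- D k l) \<inter> space lebesgue)" by auto
      also have "\<dots> \<in> sets lebesgue"
        by (intro sets.Int measurable_sets[OF measurable_fst_lebesgue] measurable_sets[OF measurable_snd_lebesgue]) auto
      finally show "indicator (D k (l + h) \<times> (- D k l)) \<in> borel_measurable \<nu>" by simp
    qed
    also have "\<dots> \<le> G (\<phi> k l)"
      unfolding gagliardo_integral_eq[OF W0sp_measurable[OF \<phi>W[OF l]]]
    proof (rule nn_integral_mono)
      fix z :: "'a \<times> 'a"
      obtain x y where z: "z = (x, y)" by (cases z)
      show "ennreal (h powr p) * indicator (D k (l + h) \<times> (- D k l)) z \<le> ennreal (\<bar>incr (\<phi> k l) z\<bar> powr p)"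
      proof (cases "x \<in> D k (l + h) \<and> y \<notin> D k l")
        case True
        then have "h \<le> \<bar>incr (\<phi> k l) z\<bar>" using h by (auto simp: z incr_def \<phi>_def D_def max_def)
        then have "h powr p \<le> \<bar>incr (\<phi> k l) z\<bar> powr p" using h p by (intro powr_mono2) auto
        then show ?thesis using True by (simp add: z ennreal_leI)
      qed (auto simp: z)
    qed
    also have "\<dots> = ennreal (energy (\<phi> k l))" by (rule G_energy[OF \<phi>W[OF l]])
    finally have "ennreal (h powr p * (c2 * measure lebesgue (D k l) powr (- \<beta>)) * measure lebesgue (D k (l + h))) \<le> ennreal (energy (\<phi> k l))"
      using Dl[of "l + h" k] l h c2 by (simp add: emeasure_eq_measure2 ennreal_mult'[symmetric] mult.assoc)
    then show ?thesis using energy_nonneg by (subst (asm) ennreal_le_iff) auto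
  qed

  \<comment> \<open>The supersolution inequality at level \<open>0\<close>, keeping the interaction
    with \<open>A\<close>. The condition on \<open>k\<close> keeps \<open>k * g\<close> at most
    \<open>\<delta> / 2\<close>, so that the truncation vanishes on \<open>A\<close> and
    \<open>V\<close> rises by at least \<open>\<delta> / 2\<close> from the superlevel set to
    \<open>A\<close>.\<close>
  have initial: "Z * k * measure lebesgue (D k (k / 4)) \<le> C0 * k powr p * (C1 * measure lebesgue \<Omega>)"
    if k: "k > 0" "k * M \<le> \<delta> / 2" for k
  proof -
    define B where "B = D k (k / 4) \<times> A"
    have Bm [measurable]: "B \<in> sets lebesgue"
    proof -
      have "B = (fst -` D k (k / 4) \<inter> space lebesgue) \<inter> (snd -` A \<inter> space lebesgue)" by (auto simp: B_def)
      also have "\<dots> \<in> sets lebesgue"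
        by (intro sets.Int measurable_sets[OF measurable_fst_lebesgue] measurable_sets[OF measurable_snd_lebesgue]) auto
      finally show ?thesis .
    qed
    have kg: "k * g x \<le> \<delta> / 2" for x
    proof -
      have "k * g x \<le> k * M" using M(2)[of x] k by (intro mult_left_mono) auto
      then show ?thesis using k(2) by linarith
    qed
    have kk: "0 \<le> k / 4" using k by simp
    define \<eta> where "\<eta> = (\<delta> / 2) powr (p - 1) * (k / 4)"
    have \<eta>: "\<eta> \<ge> 0" using k by (simp add: \<eta>_def)
    \<comment> \<open>On \<open>B\<close> both increments are bounded quantitatively; off
      \<open>B\<close> only the sign of the integrand is needed, which \<open>pt\<close> gives after
      dropping its negative term.\<close>
    have pt0: "\<eta> * indicator B z \<le> C0 * k powr p * F k 0 z - jp p (incr V z) * incr (\<phi> k 0) z" for z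
    proof (cases "z \<in> B")
      case True
      obtain x y where z: "z = (x, y)" by (cases z)
      have x: "k * g x - V x > k / 4" and y: "V y \<ge> \<delta>" using True by (auto simp: z B_def D_def A_def)
      have a: "incr (\<phi> k 0) z \<ge> k / 4"
        using x y kg[of y] \<delta>(1) k by (auto simp: z incr_def \<phi>_def max_def)
      have "incr V z \<le> - (\<delta> / 2)" using x y kg[of x] k by (simp add: z incr_def)
      then have "jp p (incr V z) \<le> jp p (- (\<delta> / 2))" by (rule jp_mono[OF p])
      also have "\<dots> = - ((\<delta> / 2) powr (p - 1))" using \<delta>(1) by (simp add: jp_minus jp_nonneg)
      finally have j: "jp p (incr V z) \<le> - ((\<delta> / 2) powr (p - 1))" .
      have "jp p (incr V z) * incr (\<phi> k 0) z \<le> - ((\<delta> / 2) powr (p - 1)) * incr (\<phi> k 0) z"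
        using j a k by (intro mult_right_mono) auto
      also have "\<dots> \<le> - ((\<delta> / 2) powr (p - 1)) * (k / 4)"
        using a by (intro mult_left_mono_neg) auto
      finally have "jp p (incr V z) * incr (\<phi> k 0) z \<le> - \<eta>" by (simp add: \<eta>_def)
      moreover have "0 \<le> C0 * k powr p * F k 0 z" using C0 F0 by simp
      ultimately show ?thesis using True by simp
    next
      case False
      have "0 \<le> c0 * \<bar>incr (\<phi> k 0) z\<bar> powr p" using c0 by simp
      then have "jp p (incr V z) * incr (\<phi> k 0) z \<le> C0 * k powr p * F k 0 z"
        using pt[OF k(1), of z 0] by linarith
      then show ?thesis using False by simp
    qed
    have i: "integrable \<nu> (\<lambda>z. C0 * k powr p * F k 0 z - jp p (incr V z) * incr (\<phi> k 0) z)"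
      by (intro Bochner_Integration.integrable_diff integrable_mult_right Fi integrable_pairing V \<phi>W) simp
    have "ennreal cA * emeasure lebesgue (D k (k / 4)) \<le> (\<integral>\<^sup>+z. indicator (D k (k / 4) \<times> A) z \<partial>\<nu>)"
    proof (rule kernel_mass_product)
      fix x assume x: "x \<in> D k (k / 4)"
      have "ennreal cA = (\<integral>\<^sup>+y. ennreal (1 / (2 * R) powr q) * indicator A y \<partial>lebesgue)"
        using Al by (simp add: cA_def nn_integral_cmult_indicator emeasure_eq_measure2 ennreal_mult'[symmetric])
      also have "\<dots> \<le> (\<integral>\<^sup>+y. ennreal (frac_kernel s p (x, y)) * indicator A y \<partial>lebesgue)"
      proof (rule nn_integral_mono)
        fix y show "ennreal (1 / (2 * R) powr q) * indicator A y \<le> ennreal (frac_kernel s p (x, y)) * indicator A y"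
        proof (cases "y \<in> A")
          case True
          have "x \<noteq> y" using x True kg[of x] k \<delta>(1) by (auto simp: D_def A_def)
          moreover have "norm (x - y) \<le> 2 * R"
          proof -
            have "x \<in> \<Omega>" "y \<in> \<Omega>" using D\<Omega>[OF kk, of k] x True by (auto simp: A_def)
            then show ?thesis using norm_triangle_ineq4[of x y] R(2)[of x] R(2)[of y] by simp
          qed
          ultimately have "1 / (2 * R) powr q \<le> frac_kernel s p (x, y)"
            unfolding q_def N_def using s p by (intro frac_kernel_ge) auto
          then show ?thesis using True by (simp add: ennreal_leI)
        qed simp
      qed
      finally show "ennreal cA \<le> (\<integral>\<^sup>+y. ennreal (frac_kernel s p (x, y)) * indicator A y \<partial>lebesgue)" .
    qed measurable
    then have "ennreal \<eta> * (ennreal cA * emeasure lebesgue (D k (k / 4))) \<le> ennreal \<eta> * (\<integral>\<^sup>+z. indicator B z \<partial>\<nu>)"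
      unfolding B_def by (rule mult_left_mono) simp
    also have "\<dots> = (\<integral>\<^sup>+z. ennreal \<eta> * indicator B z \<partial>\<nu>)"
      by (rule nn_integral_cmult[symmetric]) simp
    also have "\<dots> \<le> (\<integral>\<^sup>+z. ennreal (C0 * k powr p * F k 0 z - jp p (incr V z) * incr (\<phi> k 0) z) \<partial>\<nu>)"
    proof (rule nn_integral_mono)
      fix z show "ennreal \<eta> * indicator B z \<le> ennreal (C0 * k powr p * F k 0 z - jp p (incr V z) * incr (\<phi> k 0) z)"
        using pt0[of z] by (cases "z \<in> B") (simp_all add: ennreal_leI)
    qed
    also have "\<dots> = ennreal (\<integral>z. C0 * k powr p * F k 0 z - jp p (incr V z) * incr (\<phi> k 0) z \<partial>\<nu>)"
    proof (rule nn_integral_eq_integral[OF i])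
      have "0 \<le> C0 * k powr p * F k 0 z - jp p (incr V z) * incr (\<phi> k 0) z" for z
        by (rule order_trans[OF _ pt0]) (use \<eta> in simp)
      then show "AE z in \<nu>. 0 \<le> C0 * k powr p * F k 0 z - jp p (incr V z) * incr (\<phi> k 0) z" by simp
    qed
    also have "(\<integral>z. C0 * k powr p * F k 0 z - jp p (incr V z) * incr (\<phi> k 0) z \<partial>\<nu>)
        = C0 * k powr p * (\<integral>z. F k 0 z \<partial>\<nu>) - P V (\<phi> k 0)"
      unfolding pairing_eq[OF V \<phi>W[OF order_refl]]
      by (subst Bochner_Integration.integral_diff) (simp_all add: Fi integrable_pairing V \<phi>W)
    also have "\<dots> \<le> C0 * k powr p * (C1 * measure lebesgue \<Omega>)"
    proof -
      have "(\<integral>z. F k 0 z \<partial>\<nu>) \<le> C1 * measure lebesgue (D k 0)" by (rule FI) simp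
      also have "\<dots> \<le> C1 * measure lebesgue \<Omega>"
        using C1(1) D\<Omega>[of 0 k] \<Omega>l by (intro mult_left_mono measure_mono_fmeasurable) auto
      finally have "C0 * k powr p * (\<integral>z. F k 0 z \<partial>\<nu>) \<le> C0 * k powr p * (C1 * measure lebesgue \<Omega>)"
        using C0 by (intro mult_left_mono) auto
      then show ?thesis using PV[of 0 k] by simp
    qed
    finally have "ennreal (\<eta> * (cA * measure lebesgue (D k (k / 4)))) \<le> ennreal (C0 * k powr p * (C1 * measure lebesgue \<Omega>))"
      using Dl[OF kk, of k] \<eta> cA by (simp add: emeasure_eq_measure2 ennreal_mult'[symmetric] ennreal_leI)
    then have "\<eta> * (cA * measure lebesgue (D k (k / 4))) \<le> C0 * k powr p * (C1 * measure lebesgue \<Omega>)"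
      using C0 C1(1) by (subst (asm) ennreal_le_iff) auto
    then show ?thesis by (simp add: \<eta>_def Z_def mult_ac)
  qed

  \<comment> \<open>\<open>B\<close> and \<open>b\<close> come from dividing the Caccioppoli
    estimate by the gain for steps \<open>h j = k / 8 * (1/2) ^ j\<close>: the factor
    \<open>k powr p\<close> cancels and leaves \<open>8 powr p\<close> and \<open>b ^ j\<close>, so
    neither constant depends on \<open>k\<close>.\<close>
  define Y where "Y = C0 * C1 * measure lebesgue \<Omega> / Z"
  define B where "B = C0 * C1 * 8 powr p / (c0 * c2)"
  define b where "b = 2 powr p"
  have B: "B > 0" using C0 C1 c0 c2 by (simp add: B_def)
  have b: "b > 1" using p by (simp add: b_def gr_one_powr)
  have Y0: "Y \<ge> 0" using C0 C1 Z by (simp add: Y_def)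
  have yinit: "measure lebesgue (D k (k / 4)) \<le> Y * k powr (p - 1)" if k: "k > 0" "k * M \<le> \<delta> / 2" for k
  proof -
    have "k powr p = k * k powr (p - 1)" using k by (simp add: powr_mult_base)
    then have "k * (Z * measure lebesgue (D k (k / 4))) \<le> k * (C0 * C1 * measure lebesgue \<Omega> * k powr (p - 1))"
      using initial[OF k] by (simp add: mult_ac)
    then have "Z * measure lebesgue (D k (k / 4)) \<le> C0 * C1 * measure lebesgue \<Omega> * k powr (p - 1)"
      using k by simp
    then show ?thesis using Z by (simp add: Y_def pos_le_divide_eq mult.commute)
  qed
  \<comment> \<open>The initial measure is of order \<open>k powr (p - 1)\<close> and
    \<open>p > 1\<close>, so a small \<open>k\<close> meets the fixed threshold.\<close>
  obtain k where k: "k > 0" "k * M \<le> \<delta> / 2" "B * (Y * k powr (p - 1)) powr \<beta> \<le> b powr (- 1 / \<beta>)"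
  proof -
    have "((\<lambda>k. B * (Y * k powr (p - 1)) powr \<beta>) \<longlongrightarrow> B * (Y * 0 powr (p - 1)) powr \<beta>) (at_right 0)"
    proof (intro tendsto_mult tendsto_const tendsto_powr')
      show "((\<lambda>k. k) \<longlongrightarrow> 0) (at_right (0::real))" by (rule tendsto_ident_at)
    qed (use p \<beta> Y0 in \<open>auto simp: eventually_at_filter\<close>)
    moreover have "B * (Y * 0 powr (p - 1)) powr \<beta> < b powr (- 1 / \<beta>)" using b by simp
    ultimately have "eventually (\<lambda>k. B * (Y * k powr (p - 1)) powr \<beta> < b powr (- 1 / \<beta>)) (at_right 0)"
      by (rule order_tendstoD(2))
    moreover have "eventually (\<lambda>k. k * M < \<delta> / 2) (at_right (0::real))"
    proof (rule order_tendstoD(2))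
      show "((\<lambda>k. k * M) \<longlongrightarrow> 0 * M) (at_right (0::real))" by (intro tendsto_intros)
    qed (use \<delta>(1) in simp)
    moreover have "eventually (\<lambda>k::real. k > 0) (at_right 0)" by (rule eventually_at_right_less)
    ultimately have "eventually (\<lambda>k. k > 0 \<and> k * M \<le> \<delta> / 2 \<and> B * (Y * k powr (p - 1)) powr \<beta> \<le> b powr (- 1 / \<beta>)) (at_right (0::real))"
      by eventually_elim simp
    then obtain k where "k > 0 \<and> k * M \<le> \<delta> / 2 \<and> B * (Y * k powr (p - 1)) powr \<beta> \<le> b powr (- 1 / \<beta>)"
      using eventually_happens'[OF trivial_limit_at_right_real] by blast
    then show ?thesis using that by blast
  qed
  define l where "l j = k / 2 - k / 4 * (1/2) ^ j" for j :: nat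
  define y where "y j = measure lebesgue (D k (l j))" for j
  have l0: "l j \<ge> 0" for j
  proof -
    have "(1/2::real) ^ j \<le> 1" by (intro power_le_one) auto
    then have "k / 4 * (1/2) ^ j \<le> k / 4 * 1" using k by (intro mult_left_mono) auto
    then show ?thesis using k by (simp add: l_def)
  qed
  define h where "h j = k / 8 * (1/2) ^ j" for j :: nat
  have h: "h j > 0" for j using k by (simp add: h_def)
  have lS: "l (Suc j) = l j + h j" for j by (simp add: l_def h_def)
  have "y \<longlonglongrightarrow> 0"
  proof (rule de_giorgi_iteration[OF _ B b \<beta>])
    show "0 \<le> y j" for j by (simp add: y_def)
    have "y 0 \<le> Y * k powr (p - 1)" using yinit[OF k(1,2)] by (simp add: y_def l_def)
    then have "B * y 0 powr \<beta> \<le> B * (Y * k powr (p - 1)) powr \<beta>"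
      using B \<beta> by (intro mult_left_mono powr_mono2) (auto simp: y_def)
    then show "B * y 0 powr \<beta> \<le> b powr (- 1 / \<beta>)" using k(3) by simp
    show "y (Suc j) \<le> B * b ^ j * y j powr (1 + \<beta>)" for j
    proof (cases "y j > 0")
      case False
      \<comment> \<open>The gain estimate needs positive measure; once the measure is
        \<open>0\<close> it stays \<open>0\<close> by monotonicity in the level.\<close>
      have "y (Suc j) \<le> y j" unfolding y_def
      proof (rule measure_mono_fmeasurable[OF _ Dm Dl[OF l0]])
        show "D k (l (Suc j)) \<subseteq> D k (l j)" using h[of j] by (auto simp: D_def lS)
      qed
      then have "y (Suc j) = 0"
        using False measure_nonneg[of lebesgue "D k (l (Suc j))"] unfolding y_def by linarith
      then show ?thesis using B b by (simp add: zero_le_mult_iff)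
    next
      case True
      have "c0 * (h j powr p * (c2 * y j powr (- \<beta>)) * y (Suc j)) \<le> c0 * energy (\<phi> k (l j))"
        using gain[OF l0 h, of k j j] True c0 unfolding y_def lS by (intro mult_left_mono) auto
      also have "\<dots> \<le> C0 * k powr p * (C1 * y j)"
        unfolding y_def by (rule caccioppoli[OF k(1) l0])
      finally have 1: "c0 * (h j powr p * (c2 * y j powr (- \<beta>)) * y (Suc j)) \<le> C0 * k powr p * (C1 * y j)" .
      have hk: "8 powr p * b ^ j * h j powr p = k powr p"
      proof -
        have "h j powr p = k powr p / 8 powr p * (1/2) powr (real j * p)"
          using k by (simp add: h_def powr_mult powr_divide powr_realpow[symmetric] powr_powr del: power_divide)
        moreover have "b ^ j = 2 powr (real j * p)"
          by (simp add: b_def powr_realpow[symmetric] powr_powr mult.commute)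
        ultimately show ?thesis by (simp add: powr_divide)
      qed
      have e: "y j powr (1 + \<beta>) * y j powr (- \<beta>) = y j"
        using True by (simp add: powr_add[symmetric])
      define X where "X = c0 * (h j powr p * (c2 * y j powr (- \<beta>)))"
      have X: "X > 0" using c0 c2 h[of j] True by (simp add: X_def)
      have "X * (B * b ^ j * y j powr (1 + \<beta>)) = (c0 * c2 * B) * (b ^ j * h j powr p) * (y j powr (1 + \<beta>) * y j powr (- \<beta>))"
        by (simp add: X_def mult_ac)
      also have "\<dots> = C0 * C1 * (8 powr p * b ^ j * h j powr p) * y j"
        using c0 c2 unfolding e by (simp add: B_def)
      also have "\<dots> = C0 * k powr p * (C1 * y j)" unfolding hk by (simp add: mult_ac)
      finally have "X * y (Suc j) \<le> X * (B * b ^ j * y j powr (1 + \<beta>))"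
        using 1 by (simp add: X_def mult_ac)
      then show ?thesis using X by simp
    qed
  qed
  moreover have "measure lebesgue (D k (k / 2)) \<le> y j" for j
    unfolding y_def
  proof (rule measure_mono_fmeasurable)
    have "l j \<le> k / 2" using k by (simp add: l_def)
    then show "D k (k / 2) \<subseteq> D k (l j)" by (auto simp: D_def)
  qed (use Dl[OF l0] in auto)
  ultimately have "measure lebesgue (D k (k / 2)) \<le> 0"
    by (intro LIMSEQ_le_const) auto
  then have "measure lebesgue (D k (k / 2)) = 0" using measure_nonneg[of lebesgue "D k (k / 2)"] by simp
  then have "D k (k / 2) \<in> null_sets lebesgue"
    using Dl[of "k / 2" k] k by (simp add: null_sets_def emeasure_eq_measure2)
  then have "AE x in lebesgue. x \<notin> D k (k / 2)" by (rule AE_not_in)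
  \<comment> \<open>Off the last superlevel set \<open>V \<ge> k * g - k / 2\<close>, and
    \<open>g \<ge> 1\<close> on the smaller ball.\<close>
  then have "AE x in lebesgue. x \<in> ball x0 (\<rho> / 2) \<longrightarrow> V x \<ge> k / 2"
  proof eventually_elim
    case (elim x)
    show ?case
    proof
      assume "x \<in> ball x0 (\<rho> / 2)"
      then have "k * 1 \<le> k * g x" using g(3)[of x] k by (intro mult_left_mono) auto
      then show "V x \<ge> k / 2" using elim by (simp add: D_def)
    qed
  qed
  then show ?thesis using that[of "k / 2"] k by simp
qed

lemma pairing_cong_AE:
  assumes [measurable]: "u \<in> borel_measurable lebesgue" "u' \<in> borel_measurable lebesgue"
      "v \<in> borel_measurable lebesgue"
    and ae: "AE x in lebesgue. u x = u' x"
  shows "P u v = P u' v"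
proof -
  have "AE z in \<nu>. jp p (incr u z) * incr v z = jp p (incr u' z) * incr v z"
    using AE_frac_measure_fst[OF ae] AE_frac_measure_snd[OF ae]
    by eventually_elim (simp add: incr_def)
  then show ?thesis
    unfolding plap_pairing_eq[OF assms(1,3)] plap_pairing_eq[OF assms(2,3)]
    by (intro integral_cong_AE) measurable
qed

text \<open>Finite subcovers turn local bounds into bounds on compact sets, both for the minimum
  principle and for comparing the two forms of the positivity condition on weak solutions.\<close>

lemma lower_bound_compact:
  fixes V :: "'a \<Rightarrow> real"
  assumes local: "\<And>x \<rho>. \<rho> > 0 \<Longrightarrow> cball x \<rho> \<subseteq> \<Omega> \<Longrightarrow>
      \<exists>C>0. AE y in lebesgue. y \<in> ball x (\<rho> / 2) \<longrightarrow> V y \<ge> C"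
    and K: "compact K" "K \<subseteq> \<Omega>"
  shows "\<exists>C>0. AE x in lebesgue. x \<in> K \<longrightarrow> V x \<ge> C"
proof -
  define Q where "Q x \<rho> c \<longleftrightarrow> \<rho> > 0 \<and> c > 0 \<and> (AE y in lebesgue. y \<in> ball x \<rho> \<longrightarrow> V y \<ge> c)" for x \<rho> c
  have "\<forall>x\<in>K. \<exists>\<rho> c. Q x \<rho> c"
  proof
    fix x assume "x \<in> K"
    then have "x \<in> \<Omega>" using K(2) by blast
    then obtain e where e: "e > 0" "cball x e \<subseteq> \<Omega>"
      using open_\<Omega> unfolding open_contains_cball by blast
    from local[OF this] obtain c where "c > 0" "AE y in lebesgue. y \<in> ball x (e / 2) \<longrightarrow> V y \<ge> c"
      by (elim exE conjE)
    then have "Q x (e / 2) c" using e(1) by (simp add: Q_def)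
    then show "\<exists>\<rho> c. Q x \<rho> c" by (intro exI)
  qed
  then obtain \<rho> c where Q: "\<And>x. x \<in> K \<Longrightarrow> Q x (\<rho> x) (c x)" by metis
  have cover: "K \<subseteq> (\<Union>x\<in>K. ball x (\<rho> x))"
  proof
    fix x assume "x \<in> K"
    then show "x \<in> (\<Union>x\<in>K. ball x (\<rho> x))" using Q[of x] by (intro UN_I[of x]) (auto simp: Q_def)
  qed
  obtain T where T: "T \<subseteq> K" "finite T" "K \<subseteq> (\<Union>x\<in>T. ball x (\<rho> x))"
  proof (rule compactE_image[OF K(1) _ cover])
    fix T assume "T \<subseteq> K" "finite T" "K \<subseteq> (\<Union>x\<in>T. ball x (\<rho> x))"
    then show thesis by (rule that)
  qed simp
  \<comment> \<open>The inserted \<open>1\<close> keeps the minimum defined when the cover is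
    empty.\<close>
  define C where "C = Min (insert 1 (c ` T))"
  have C: "C > 0" "\<And>x. x \<in> T \<Longrightarrow> C \<le> c x"
    using T Q by (auto simp: C_def Q_def subset_iff)
  have "AE y in lebesgue. \<forall>x\<in>T. y \<in> ball x (\<rho> x) \<longrightarrow> V y \<ge> c x"
  proof (rule AE_finite_allI[OF T(2)])
    fix x assume "x \<in> T"
    then show "AE y in lebesgue. y \<in> ball x (\<rho> x) \<longrightarrow> V y \<ge> c x" using Q[of x] T(1) by (auto simp: Q_def)
  qed
  then have "AE y in lebesgue. y \<in> K \<longrightarrow> V y \<ge> C"
  proof eventually_elim
    case (elim y)
    show ?case
    proof
      assume "y \<in> K"
      then obtain x where x: "x \<in> T" "y \<in> ball x (\<rho> x)" using T(3) by blast
      then have "c x \<le> V y" using elim by blast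
      then show "V y \<ge> C" using C(2)[OF x(1)] by simp
    qed
  qed
  then show ?thesis using C(1) by (intro exI[of _ C] conjI)
qed

text \<open>Passing to \<open>\<bar>V\<bar>\<close>, which equals \<open>V\<close> almost
  everywhere, makes nonnegativity hold at every point, as the iteration on superlevel sets requires;
  the pairing does not change.\<close>

lemma minimum_principle:
  assumes V: "V \<in> W0sp s p \<Omega>" and V0: "AE x in lebesgue. V x \<ge> 0" and Vnz: "\<not> (AE x in lebesgue. V x = 0)"
    and super: "\<And>\<phi>. \<phi> \<in> W0sp s p \<Omega> \<Longrightarrow> AE x in lebesgue. \<phi> x \<ge> 0 \<Longrightarrow> P V \<phi> \<ge> 0"
    and K: "compact K" "K \<subseteq> \<Omega>"
  shows "\<exists>C>0. AE x in lebesgue. x \<in> K \<longrightarrow> V x \<ge> C"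
proof (rule lower_bound_compact[OF _ K])
  fix x0 :: 'a and \<rho> :: real assume \<rho>: "\<rho> > 0" "cball x0 \<rho> \<subseteq> \<Omega>"
  define v where "v x = \<bar>V x\<bar>" for x
  have v: "v \<in> W0sp s p \<Omega>" unfolding v_def[abs_def] by (rule W0sp_abs[OF V])
  have vV: "AE x in lebesgue. V x = v x" using V0 by eventually_elim (simp add: v_def)
  have sup: "P v \<phi> \<ge> 0" if \<phi>: "\<phi> \<in> W0sp s p \<Omega>" "AE x in lebesgue. \<phi> x \<ge> 0" for \<phi>
    using super[OF \<phi>] pairing_cong_AE[OF W0sp_measurable[OF V] W0sp_measurable[OF v] W0sp_measurable[OF \<phi>(1)] vV]
    by simp
  have nz: "\<not> (AE x in lebesgue. v x = 0)" using Vnz by (simp add: v_def)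
  have nn: "v x \<ge> 0" for x by (simp add: v_def)
  obtain C where C: "C > 0" "AE x in lebesgue. x \<in> ball x0 (\<rho> / 2) \<longrightarrow> v x \<ge> C"
  proof (rule minimum_principle_aux[OF v nn nz sup \<rho>])
    fix C assume "C > 0" "AE x in lebesgue. x \<in> ball x0 (\<rho> / 2) \<longrightarrow> v x \<ge> C"
    then show thesis by (rule that)
  qed
  have "AE x in lebesgue. x \<in> ball x0 (\<rho> / 2) \<longrightarrow> V x \<ge> C"
    using C(2) vV by eventually_elim simp
  then show "\<exists>C>0. AE y in lebesgue. y \<in> ball x0 (\<rho> / 2) \<longrightarrow> V y \<ge> C" using C(1) by (intro exI[of _ C] conjI)
qed

end

section \<open>The limit of the eigenvalues\<close>

context weighted_frac_sobolev
begin

abbreviation feasible :: "real \<Rightarrow> ('a \<Rightarrow> real) set" where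
  "feasible \<alpha> \<equiv> {v \<in> W0sp s p \<Omega>. (LINT x:\<Omega>|lebesgue. \<bar>v x\<bar> powr (1 - \<alpha>) * \<omega> x) = 1}"

lemma feasible_iff:
  "v \<in> feasible \<alpha> \<longleftrightarrow> v \<in> W0sp s p \<Omega> \<and> (\<integral>x. \<bar>v x\<bar> powr (1 - \<alpha>) \<partial>\<tau>) = 1"
proof (cases "v \<in> W0sp s p \<Omega>")
  case True
  note [measurable] = W0sp_measurable[OF True]
  have "(\<integral>x. \<bar>v x\<bar> powr (1 - \<alpha>) \<partial>\<tau>) = (LINT x:\<Omega>|lebesgue. \<bar>v x\<bar> powr (1 - \<alpha>) * \<omega> x)"
    by (rule integral_\<tau>) measurable
  then show ?thesis by simp
qed simp

lemma lam_le:
  assumes "v \<in> feasible \<alpha>"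
  shows "lam s p \<Omega> \<omega> \<alpha> \<le> energy v"
  unfolding lam_def gagliardo_powr_energy
  by (rule cINF_lower[OF _ assms]) (auto intro: bdd_belowI2[of _ 0] energy_nonneg)

lemma le_lam:
  assumes "feasible \<alpha> \<noteq> {}" "\<And>v. v \<in> feasible \<alpha> \<Longrightarrow> B \<le> energy v"
  shows "B \<le> lam s p \<Omega> \<omega> \<alpha>"
  unfolding lam_def gagliardo_powr_energy by (rule cINF_greatest[OF assms])

end

context log_minimizer
begin

text \<open>Jensen's inequality in elementary form: integrate
  \<open>1 + q * ln V \<le> V powr q\<close> and use that the logarithm has integral
  \<open>0\<close>.\<close>

lemma moment_V_ge:
  assumes q: "0 < q" "q \<le> q0"
  shows "W \<le> (\<integral>x. \<bar>V x\<bar> powr q \<partial>\<tau>)"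
proof -
  have "W = (\<integral>x. 1 + q * ln \<bar>V x\<bar> \<partial>\<tau>)"
    using V_log_integrable V_log_integral by (subst Bochner_Integration.integral_add) auto
  also have "\<dots> \<le> (\<integral>x. \<bar>V x\<bar> powr q \<partial>\<tau>)"
  proof (rule integral_mono_AE)
    show "integrable \<tau> (\<lambda>x. 1 + q * ln \<bar>V x\<bar>)" using V_log_integrable by simp
    show "integrable \<tau> (\<lambda>x. \<bar>V x\<bar> powr q)" using q by (intro W0sp_integrable_powr V_W0sp) auto
    show "AE x in \<tau>. 1 + q * ln \<bar>V x\<bar> \<le> \<bar>V x\<bar> powr q"
      using V_pos_\<tau>
    proof eventually_elim
      case (elim x)
      then have "ln \<bar>V x\<bar> \<le> (\<bar>V x\<bar> powr q - 1) / q" using q by (intro ln_le_powr) auto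
      then show ?case using q by (simp add: pos_le_divide_eq mult.commute)
    qed
  qed
  finally show ?thesis .
qed

text \<open>The minimizer, scaled so that its \<open>q\<close>-th moment is \<open>1\<close>, is the
  competitor. The normalising power of \<open>W\<close> turns its energy into
  \<open>(W / m) powr (p / q) * E\<close>, and \<open>m \<ge> W\<close>. Nonemptiness is recorded
  because the infimum defining \<open>lam\<close> is taken in the reals.\<close>

lemma lam_upper:
  assumes q: "0 < q" "q \<le> q0" "q < 1" and \<alpha>: "\<alpha> = 1 - q"
  shows "feasible \<alpha> \<noteq> {}" "lam s p \<Omega> \<omega> \<alpha> * W powr (p / (1 - \<alpha>)) \<le> E"
proof -
  define m where "m = (\<integral>x. \<bar>V x\<bar> powr q \<partial>\<tau>)"
  have m: "m \<ge> W" "m > 0" using moment_V_ge[OF q(1,2)] W_pos by (auto simp: m_def)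
  define c where "c = m powr (- 1 / q)"
  have c: "c > 0" using m by (simp add: c_def)
  have "c powr q = m powr (- 1)" unfolding c_def powr_powr using q by simp
  then have cq: "c powr q = 1 / m" using m by (simp add: powr_minus_divide)
  have "c powr p = m powr (- (p / q))" unfolding c_def powr_powr by simp
  then have cp: "c powr p = 1 / m powr (p / q)" by (simp add: powr_minus_divide)
  have "(\<integral>x. \<bar>c * V x\<bar> powr q \<partial>\<tau>) = (\<integral>x. c powr q * \<bar>V x\<bar> powr q \<partial>\<tau>)"
    using c by (simp add: abs_mult powr_mult)
  also have "\<dots> = 1" using m unfolding cq by (simp add: m_def[symmetric])
  finally have f: "(\<lambda>x. c * V x) \<in> feasible \<alpha>"
    unfolding feasible_iff using W0sp_scale[OF V_W0sp] by (simp add: \<alpha>)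
  then show "feasible \<alpha> \<noteq> {}" by blast
  have "lam s p \<Omega> \<omega> \<alpha> \<le> c powr p * E"
    using lam_le[OF f] c by (simp add: energy_scale)
  then have "lam s p \<Omega> \<omega> \<alpha> * W powr (p / (1 - \<alpha>)) \<le> c powr p * E * W powr (p / (1 - \<alpha>))"
    by (rule mult_right_mono) simp
  also have "\<dots> = (W / m) powr (p / q) * E"
    using m W_pos unfolding cp by (simp add: powr_divide \<alpha>)
  also have "\<dots> \<le> 1 * E"
    using m W_pos q p E_pos by (intro mult_right_mono powr_le1) auto
  finally show "lam s p \<Omega> \<omega> \<alpha> * W powr (p / (1 - \<alpha>)) \<le> E" by simp
qed

text \<open>
  Tangent plane of the energy at \<open>V\<close>, the Euler-Lagrange inequality, and the weighted
  arithmetic-geometric mean inequality \<open>u powr q \<le> q u / V + (1 - q) V powr t\<close> where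
  \<open>t = q / (1 - q)\<close>.
\<close>

lemma lam_lower:
  assumes t: "0 < t" "t \<le> q0" and \<alpha>: "\<alpha> = 1 / (1 + t)"
  shows "E - p * E / W * (\<integral>x. (\<bar>V x\<bar> powr t - 1) / t \<partial>\<tau>) \<le> lam s p \<Omega> \<omega> \<alpha> * W powr (p / (1 - \<alpha>))"
proof -
  \<comment> \<open>Equivalent to \<open>t = q / (1 - q)\<close>, with
    \<open>\<alpha> = 1 - q\<close>; in this parametrisation the mean inequality below leaves
    precisely the moment of order \<open>t\<close>.\<close>
  define q where "q = t / (1 + t)"
  have "t / (1 + t) \<le> t / 1" using t by (intro divide_left_mono) auto
  then have "q \<le> q0" using t(2) by (simp add: q_def)
  then have q: "0 < q" "q < 1" "q \<le> q0" and \<alpha>q: "1 - \<alpha> = q" "\<alpha> = 1 - q"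
    using t(1) by (auto simp: q_def \<alpha> field_simps)
  have qt: "t * (1 - q) = q" using t by (simp add: q_def field_simps)
  define J where "J = (\<integral>x. (\<bar>V x\<bar> powr t - 1) / t \<partial>\<tau>)"
  define R where "R = (\<integral>x. \<bar>V x\<bar> powr t \<partial>\<tau>)"
  have Ri: "integrable \<tau> (\<lambda>x. \<bar>V x\<bar> powr t)" using t by (intro W0sp_integrable_powr V_W0sp) auto
  have J: "J = (R - W) / t"
    unfolding J_def R_def using Ri by (simp add: Bochner_Integration.integral_diff)
  define B where "B = (E - p * E / W * J) / W powr (p / q)"
  have Wp: "W powr (p / q) > 0" using W_pos by simp
  have "B \<le> energy v" if v: "v \<in> feasible \<alpha>" for v
  proof -
    have vW: "v \<in> W0sp s p \<Omega>" and v1: "(\<integral>x. \<bar>v x\<bar> powr q \<partial>\<tau>) = 1"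
      using v unfolding feasible_iff \<alpha>q by auto
    \<comment> \<open>Rescaled so that the \<open>q\<close>-th moment is \<open>W\<close> and the
      energy carries the factor \<open>W powr (p / q)\<close> of the claim. The absolute value makes
      \<open>u\<close> an admissible direction and does not raise the energy.\<close>
    define u where "u x = W powr (1 / q) * \<bar>v x\<bar>" for x
    have u: "u \<in> W0sp s p \<Omega>" unfolding u_def[abs_def] by (intro W0sp_scale W0sp_abs vW)
    note [measurable] = W0sp_measurable[OF vW] W0sp_measurable[OF u]
    have u0: "u x \<ge> 0" for x by (simp add: u_def)
    have "energy u = (W powr (1 / q)) powr p * energy (\<lambda>x. \<bar>v x\<bar>)"
      unfolding u_def[abs_def] by (subst energy_scale) auto
    also have "\<dots> \<le> (W powr (1 / q)) powr p * energy v"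
      by (intro mult_left_mono energy_abs_le vW) simp
    also have "(W powr (1 / q)) powr p = W powr (p / q)" by (simp add: powr_powr)
    finally have eu: "energy u \<le> W powr (p / q) * energy v" .
    have "(\<integral>x. \<bar>u x\<bar> powr q \<partial>\<tau>) = (\<integral>x. W * \<bar>v x\<bar> powr q \<partial>\<tau>)"
      using q W_pos by (simp add: u_def abs_mult powr_mult powr_powr)
    then have "W = (\<integral>x. \<bar>u x\<bar> powr q \<partial>\<tau>)" using v1 by simp
    also have "\<dots> \<le> (\<integral>x. q * (u x / V x) + (1 - q) * \<bar>V x\<bar> powr t \<partial>\<tau>)"
    proof (rule integral_mono_AE)
      show "integrable \<tau> (\<lambda>x. \<bar>u x\<bar> powr q)" using q by (intro W0sp_integrable_powr u) auto
      show "integrable \<tau> (\<lambda>x. q * (u x / V x) + (1 - q) * \<bar>V x\<bar> powr t)"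
        by (intro Bochner_Integration.integrable_add integrable_mult_right Ri integrable_div_V u) (simp add: u0)
      show "AE x in \<tau>. \<bar>u x\<bar> powr q \<le> q * (u x / V x) + (1 - q) * \<bar>V x\<bar> powr t"
        using V_pos_\<tau>
      proof eventually_elim
        case (elim x)
        show ?case
        proof (cases "u x = 0")
          case True
          then show ?thesis using q elim by simp
        next
          case False
          then have up: "u x > 0" using u0[of x] by simp
          have "(u x / V x) powr q * (V x powr t) powr (1 - q) \<le> q * (u x / V x) + (1 - q) * V x powr t"
            using q up elim by (intro Youngs_inequality_0) auto
          also have "(u x / V x) powr q * (V x powr t) powr (1 - q) = u x powr q"
            using up elim by (simp add: powr_powr qt powr_divide)
          finally show ?thesis using up elim by simp
        qed
      qed
    qed
    also have "\<dots> = q * (\<integral>x. u x / V x \<partial>\<tau>) + (1 - q) * R"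
    proof -
      have "integrable \<tau> (\<lambda>x. u x / V x)" by (rule integrable_div_V[OF u]) (simp add: u0)
      then show ?thesis
        unfolding R_def using Ri
        by (simp only: Bochner_Integration.integral_add integrable_mult_right integral_mult_right_zero)
    qed
    finally have "(W - (1 - q) * R) / q \<le> (\<integral>x. u x / V x \<partial>\<tau>)"
      using q by (simp add: field_simps)
    \<comment> \<open>Since \<open>t * (1 - q) = q\<close>, the loss is exactly \<open>J\<close>,
      which stays small although both \<open>q\<close> and \<open>t\<close> tend to
      \<open>0\<close>.\<close>
    moreover have "(W - (1 - q) * R) / q = W - J"
    proof -
      have "q * J = t * (1 - q) * ((R - W) / t)" by (simp only: qt J)
      also have "\<dots> = (1 - q) * (R - W)" using t by simp
      finally have "W - (1 - q) * R = q * (W - J)" by (simp add: algebra_simps)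
      then show ?thesis using q by simp
    qed
    ultimately have "E / W * (W - J) \<le> E / W * (\<integral>x. u x / V x \<partial>\<tau>)"
      using E_pos W_pos by (intro mult_left_mono) auto
    also have "\<dots> \<le> P V u" by (rule Euler_Lagrange_le[OF u]) (simp add: u0)
    \<comment> \<open>By convexity the energy lies above its tangent plane at \<open>V\<close>;
      multiplied by \<open>p\<close>, the remaining terms give \<open>E\<close> minus the
      loss.\<close>
    also have "\<dots> \<le> (1 - 1 / p) * E + energy u / p" by (rule pairing_le_young[OF V_W0sp u])
    finally have "E / W * (W - J) \<le> (1 - 1 / p) * E + energy u / p" .
    moreover have "E / W * (W - J) = E - E / W * J" using W_pos by (simp add: right_diff_distrib)
    moreover have "(1 - 1 / p) * E = E - E / p" by (simp add: left_diff_distrib)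
    ultimately have "E / p - E / W * J \<le> energy u / p" by linarith
    then have "p * (E / p - E / W * J) \<le> p * (energy u / p)" using p by (intro mult_left_mono) auto
    then have "E - p * E / W * J \<le> energy u" using p by (simp add: right_diff_distrib)
    then have "E - p * E / W * J \<le> W powr (p / q) * energy v" using eu by simp
    then show ?thesis using Wp by (simp add: B_def pos_divide_le_eq mult.commute)
  qed
  then have "B \<le> lam s p \<Omega> \<omega> \<alpha>"
    using lam_upper(1)[OF q(1,3,2) \<alpha>q(2)] by (intro le_lam) auto
  then have "B * W powr (p / q) \<le> lam s p \<Omega> \<omega> \<alpha> * W powr (p / q)"
    by (rule mult_right_mono) simp
  then show ?thesis using Wp by (simp add: B_def J_def \<alpha>q)
qed

text \<open>The integrands tend to \<open>ln V\<close>, whose integral is \<open>0\<close>. They lie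
  above \<open>ln V\<close> itself; for large \<open>V\<close> they are below
  \<open>V powr t * ln V\<close>, and bounding each factor by a power \<open>q0 / 2\<close> gives an
  integrable power \<open>q0\<close>. This is why \<open>t n\<close> stops at
  \<open>q0 / 2\<close>.\<close>

lemma difference_quotient_tendsto_0:
  assumes t: "\<And>n. 0 < t n" "\<And>n. t n \<le> q0 / 2" "t \<longlonglongrightarrow> 0"
  shows "(\<lambda>n. \<integral>x. (\<bar>V x\<bar> powr t n - 1) / t n \<partial>\<tau>) \<longlonglongrightarrow> 0"
proof -
  have "(\<lambda>n. \<integral>x. (\<bar>V x\<bar> powr t n - 1) / t n \<partial>\<tau>) \<longlonglongrightarrow> (\<integral>x. ln \<bar>V x\<bar> \<partial>\<tau>)"
  proof (rule integral_dominated_convergence[where w="\<lambda>x. \<bar>ln \<bar>V x\<bar>\<bar> + \<bar>V x\<bar> powr q0 / (q0 / 2)"])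
    show "integrable \<tau> (\<lambda>x. \<bar>ln \<bar>V x\<bar>\<bar> + \<bar>V x\<bar> powr q0 / (q0 / 2))"
      using q0 by (intro Bochner_Integration.integrable_add integrable_abs V_log_integrable
          integrable_divide W0sp_integrable_powr V_W0sp) auto
    show "AE x in \<tau>. (\<lambda>n. (\<bar>V x\<bar> powr t n - 1) / t n) \<longlonglongrightarrow> ln \<bar>V x\<bar>"
      using V_pos_\<tau>
    proof eventually_elim
      case (elim x)
      have "((\<lambda>a. exp (a * ln \<bar>V x\<bar>)) has_real_derivative exp (0 * ln \<bar>V x\<bar>) * ln \<bar>V x\<bar>) (at 0)"
        by (rule DERIV_chain2[OF DERIV_exp]) (auto intro!: derivative_eq_intros)
      then have d: "((\<lambda>a. (exp (a * ln \<bar>V x\<bar>) - 1) / a) \<longlongrightarrow> ln \<bar>V x\<bar>) (at 0)"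
        by (simp add: DERIV_def)
      have "t n \<noteq> 0" for n using t(1)[of n] by simp
      then have "filterlim t (at 0) sequentially" using t(3) by (simp add: filterlim_at)
      from filterlim_compose[OF d this] show ?case using elim by (simp add: powr_def)
    qed
    show "AE x in \<tau>. norm ((\<bar>V x\<bar> powr t n - 1) / t n) \<le> \<bar>ln \<bar>V x\<bar>\<bar> + \<bar>V x\<bar> powr q0 / (q0 / 2)" for n
      using V_pos_\<tau>
    proof eventually_elim
      case (elim x)
      define a where "a = V x"
      have a: "a > 0" using elim by (simp add: a_def)
      have lo: "ln a \<le> (a powr t n - 1) / t n" by (rule ln_le_powr[OF a t(1)])
      have hi: "(a powr t n - 1) / t n \<le> a powr q0 / (q0 / 2)"
      proof (cases "a \<le> 1")
        case True
        then have "a powr t n \<le> 1" using a t(1)[of n] by (intro powr_le1) auto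
        then have "(a powr t n - 1) / t n \<le> 0" using t(1)[of n] by (intro divide_nonpos_pos) auto
        also have "0 \<le> a powr q0 / (q0 / 2)" using q0 by simp
        finally show ?thesis .
      next
        case False
        have "1 - t n * ln a \<le> exp (- (t n * ln a))" using exp_ge_add_one_self[of "- (t n * ln a)"] by simp
        then have "exp (t n * ln a) * (1 - t n * ln a) \<le> exp (t n * ln a) * exp (- (t n * ln a))"
          by (rule mult_left_mono) simp
        then have "a powr t n * (1 - t n * ln a) \<le> 1" using a by (simp add: powr_def exp_minus)
        then have "(a powr t n - 1) / t n \<le> a powr t n * ln a"
          using t(1)[of n] by (simp add: pos_divide_le_eq algebra_simps)
        also have "\<dots> \<le> a powr (q0 / 2) * (a powr (q0 / 2) / (q0 / 2))"
        proof (rule mult_mono)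
          show "a powr t n \<le> a powr (q0 / 2)" using False t(2)[of n] by (intro powr_mono) auto
          have "ln a \<le> (a powr (q0 / 2) - 1) / (q0 / 2)" using q0 by (intro ln_le_powr a) auto
          also have "\<dots> \<le> a powr (q0 / 2) / (q0 / 2)" using q0 by (intro divide_right_mono) auto
          finally show "ln a \<le> a powr (q0 / 2) / (q0 / 2)" .
        qed (use False in auto)
        also have "\<dots> = a powr q0 / (q0 / 2)" by (simp add: powr_add[symmetric])
        finally show ?thesis .
      qed
      have "0 \<le> a powr q0 / (q0 / 2)" using q0 by simp
      then have "\<bar>(a powr t n - 1) / t n\<bar> \<le> \<bar>ln a\<bar> + a powr q0 / (q0 / 2)" using lo hi by linarith
      then show ?case using elim by (simp add: a_def)
    qed
  qed measurable
  then show ?thesis by (simp add: V_log_integral)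
qed

text \<open>The limit is assumed to exist, so one sequence identifies it: along
  \<open>\<alpha> n = 1 / (1 + t n)\<close> the upper and lower bounds close up on
  \<open>E\<close>.\<close>

lemma lam_limit:
  assumes "((\<lambda>\<alpha>. lam s p \<Omega> \<omega> \<alpha> * W powr (p / (1 - \<alpha>))) \<longlongrightarrow> \<mu>) (at_left 1)"
  shows "\<mu> = E"
proof -
  define t where "t n = q0 / 2 * inverse (real (Suc n))" for n
  have t: "0 < t n" "t n \<le> q0 / 2" for n
    using q0 mult_left_mono[of "inverse (real (Suc n))" 1 "q0 / 2"] by (auto simp: t_def inverse_le_1_iff)
  have t0: "t \<longlonglongrightarrow> 0"
    unfolding t_def using tendsto_mult_left[OF LIMSEQ_inverse_real_of_nat, of "q0 / 2"] by simp
  define \<alpha> where "\<alpha> n = 1 / (1 + t n)" for n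
  have \<alpha>1: "\<alpha> n < 1" for n using t(1)[of n] by (simp add: \<alpha>_def)
  have "\<alpha> \<longlonglongrightarrow> 1 / (1 + 0)" unfolding \<alpha>_def by (intro tendsto_intros t0) simp
  then have "filterlim \<alpha> (at_left 1) sequentially"
    using \<alpha>1 by (auto simp: filterlim_at less_imp_neq)
  then have lim: "(\<lambda>n. lam s p \<Omega> \<omega> (\<alpha> n) * W powr (p / (1 - \<alpha> n))) \<longlonglongrightarrow> \<mu>"
    by (rule filterlim_compose[OF assms])
  define J where "J n = (\<integral>x. (\<bar>V x\<bar> powr t n - 1) / t n \<partial>\<tau>)" for n
  have J: "J \<longlonglongrightarrow> 0" unfolding J_def by (rule difference_quotient_tendsto_0[OF t t0])
  have lo: "E - p * E / W * J n \<le> lam s p \<Omega> \<omega> (\<alpha> n) * W powr (p / (1 - \<alpha> n))" for n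
    unfolding J_def using t[of n] q0 by (intro lam_lower) (auto simp: \<alpha>_def)
  have hi: "lam s p \<Omega> \<omega> (\<alpha> n) * W powr (p / (1 - \<alpha> n)) \<le> E" for n
  proof (rule lam_upper(2))
    have pos: "0 < 1 + t n" using t(1)[of n] by simp
    show "0 < t n / (1 + t n)" "t n / (1 + t n) < 1" "\<alpha> n = 1 - t n / (1 + t n)"
      using t(1)[of n] by (auto simp: \<alpha>_def field_simps)
    have "t n / (1 + t n) \<le> t n / 1" using t(1)[of n] by (intro divide_left_mono) auto
    then show "t n / (1 + t n) \<le> q0" using t(2)[of n] q0 by linarith
  qed
  have "(\<lambda>n. E - p * E / W * J n) \<longlonglongrightarrow> E - p * E / W * 0" by (intro tendsto_intros J)
  then have l: "(\<lambda>n. E - p * E / W * J n) \<longlonglongrightarrow> E" by simp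
  have "(\<lambda>n. lam s p \<Omega> \<omega> (\<alpha> n) * W powr (p / (1 - \<alpha> n))) \<longlonglongrightarrow> E"
    by (rule tendsto_sandwich[OF _ _ l tendsto_const]) (use lo hi in simp_all)
  with lim show ?thesis by (rule LIMSEQ_unique)
qed

end

section \<open>Weak solutions\<close>

context weighted_frac_sobolev
begin

text \<open>Bounds on subdomains and on compact sets are equivalent: small balls are subdomains and
  finitely many cover a compact set, while the closure of an admissible subdomain is
  compact.\<close>

lemma weak_solution_iff:
  assumes u: "u \<in> W0sp s p \<Omega>"
  shows "weak_solution s p \<Omega> \<omega> \<mu> u \<longleftrightarrow>
    (\<forall>K. compact K \<and> K \<subseteq> \<Omega> \<longrightarrow> (\<exists>C>0. AE x in lebesgue. x \<in> K \<longrightarrow> u x \<ge> C)) \<and>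
    (\<forall>\<phi>\<in>test_functions \<Omega>. P u \<phi> = \<mu> / W * (\<integral>x. \<phi> x / u x \<partial>\<tau>))"
    (is "_ \<longleftrightarrow> ?lb \<and> ?eq")
proof -
  have lb: "(\<forall>\<Omega>'. domain \<Omega>' \<and> compact (closure \<Omega>') \<and> closure \<Omega>' \<subseteq> \<Omega> \<longrightarrow>
        (\<exists>C>0. AE x\<in>\<Omega>' in lebesgue. u x \<ge> C)) \<longleftrightarrow> ?lb" (is "?d \<longleftrightarrow> _")
  proof
    assume d: ?d
    show ?lb
    proof (intro allI impI)
      fix K assume "compact K \<and> K \<subseteq> \<Omega>"
      then have K: "compact K" "K \<subseteq> \<Omega>" by auto
      show "\<exists>C>0. AE x in lebesgue. x \<in> K \<longrightarrow> u x \<ge> C"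
      proof (rule lower_bound_compact[OF _ K])
        fix x :: 'a and \<rho> :: real assume \<rho>: "\<rho> > 0" "cball x \<rho> \<subseteq> \<Omega>"
        have "domain (ball x (\<rho> / 2))" using \<rho>(1) by (auto simp: domain_def)
        moreover have "closure (ball x (\<rho> / 2)) = cball x (\<rho> / 2)" using \<rho>(1) by (intro closure_ball) simp
        moreover have "cball x (\<rho> / 2) \<subseteq> \<Omega>" using \<rho> by (intro order_trans[OF _ \<rho>(2)]) (auto simp: subset_eq)
        ultimately show "\<exists>C>0. AE y in lebesgue. y \<in> ball x (\<rho> / 2) \<longrightarrow> u y \<ge> C"
          using d[rule_format, of "ball x (\<rho> / 2)"] by simp
      qed
    qed
  next
    assume lb: ?lb
    show ?d
    proof (intro allI impI)
      fix \<Omega>' assume "domain \<Omega>' \<and> compact (closure \<Omega>') \<and> closure \<Omega>' \<subseteq> \<Omega>"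
      then obtain C where C: "C > 0" "AE x in lebesgue. x \<in> closure \<Omega>' \<longrightarrow> u x \<ge> C"
        using lb[rule_format, of "closure \<Omega>'"] by auto
      from C(2) have "AE x\<in>\<Omega>' in lebesgue. u x \<ge> C"
        by eventually_elim (simp add: subsetD[OF closure_subset])
      then show "\<exists>C>0. AE x\<in>\<Omega>' in lebesgue. u x \<ge> C" using C(1) by (intro exI[of _ C] conjI)
    qed
  qed
  have int: "(LINT x:\<Omega>|lebesgue. \<omega> x * \<phi> x / u x) = (\<integral>x. \<phi> x / u x \<partial>\<tau>)" if "\<phi> \<in> test_functions \<Omega>" for \<phi>
  proof -
    note [measurable] = W0sp_measurable[OF u] test_functions_measurable[OF that]
    have "(\<integral>x. \<phi> x / u x \<partial>\<tau>) = (LINT x:\<Omega>|lebesgue. \<phi> x / u x * \<omega> x)"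
      by (rule integral_\<tau>) measurable
    also have "(\<lambda>x. \<phi> x / u x * \<omega> x) = (\<lambda>x. \<omega> x * \<phi> x / u x)" by (simp add: mult.commute)
    finally show ?thesis by simp
  qed
  have eq: "(\<forall>\<phi>\<in>test_functions \<Omega>.
      P u \<phi> = \<mu> / Lp_norm 1 \<Omega> \<omega> * (LINT x:\<Omega>|lebesgue. \<omega> x * \<phi> x / u x)) \<longleftrightarrow> ?eq"
    unfolding W_eq by (rule ball_cong[OF refl]) (simp only: int)
  show ?thesis
    unfolding weak_solution_def lb eq by (simp only: u simp_thms)
qed

end

section \<open>Extension of the weak formulation and uniqueness\<close>

locale singular_weak_solution = weighted_frac_sobolev +
  fixes u :: "'a \<Rightarrow> real" and c :: real
  assumes u: "u \<in> W0sp s p \<Omega>" and c: "c > 0"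
    and lower: "\<And>K. compact K \<Longrightarrow> K \<subseteq> \<Omega> \<Longrightarrow> \<exists>C>0. AE x in lebesgue. x \<in> K \<longrightarrow> u x \<ge> C"
    and weak_form: "\<And>\<phi>. \<phi> \<in> test_functions \<Omega> \<Longrightarrow> P u \<phi> = c * (\<integral>x. \<phi> x / u x \<partial>\<tau>)"
begin

lemma u_measurable [measurable]: "u \<in> borel_measurable lebesgue"
  by (rule W0sp_measurable[OF u])

text \<open>Exhaust \<open>\<Omega>\<close> by countably many compact sets, each with its own
  positive lower bound.\<close>

lemma u_pos: "AE x in lebesgue. x \<in> \<Omega> \<longrightarrow> u x > 0"
proof -
  obtain K :: "nat \<Rightarrow> 'a set" where K: "\<And>n. compact (K n)" "\<And>n. K n \<subseteq> \<Omega>" "\<Union>(range K) = \<Omega>"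
  proof (rule open_Union_compact_subsets[OF open_\<Omega>])
    fix C :: "nat \<Rightarrow> 'a set"
    assume "\<And>n. compact (C n)" "\<And>n. C n \<subseteq> \<Omega>" "\<Union>(range C) = \<Omega>"
    then show thesis by (rule that)
  qed
  have "AE x in lebesgue. x \<in> K n \<longrightarrow> u x > 0" for n
  proof -
    obtain C where C: "C > 0" "AE x in lebesgue. x \<in> K n \<longrightarrow> u x \<ge> C"
      using lower[OF K(1,2), of n] by (elim exE conjE)
    from C(2) show ?thesis by eventually_elim (use C(1) in auto)
  qed
  then have "AE x in lebesgue. \<forall>n. x \<in> K n \<longrightarrow> u x > 0" by (subst AE_all_countable) simp
  then show ?thesis by eventually_elim (use K(3) in blast)
qed

lemma u_pos_\<tau>: "AE x in \<tau>. u x > 0"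
  unfolding AE_\<tau>_iff using u_pos
  by eventually_elim (auto simp: wt_def indicator_def split: if_splits)

lemma test_integrable:
  assumes \<phi>: "\<phi> \<in> test_functions \<Omega>"
  shows "integrable \<tau> (\<lambda>x. \<phi> x / u x)"
proof -
  note [measurable] = test_functions_measurable[OF \<phi>]
  obtain K where K: "compact K" "K \<subseteq> \<Omega>" "\<forall>x. \<phi> x \<noteq> 0 \<longrightarrow> x \<in> K" using test_functionsE[OF \<phi>] by blast
  obtain C where C: "C > 0" "AE x in lebesgue. x \<in> K \<longrightarrow> u x \<ge> C" using lower[OF K(1,2)] by (elim exE conjE)
  obtain M where M: "M > 0" "\<And>x. \<bar>\<phi> x\<bar> \<le> M" using test_functions_bounded[OF \<phi>] by blast
  have "AE x in \<tau>. norm (\<phi> x / u x) \<le> M / C"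
    using AE_\<tau>[OF C(2)]
  proof eventually_elim
    case (elim x)
    show ?case
    proof (cases "\<phi> x = 0")
      case True
      then show ?thesis using M(1) C(1) by simp
    next
      case False
      then have "u x \<ge> C" using elim K(3) by blast
      then have "\<bar>\<phi> x\<bar> / u x \<le> M / C" using M(2)[of x] C(1) M(1) by (intro frac_le) auto
      then show ?thesis using \<open>u x \<ge> C\<close> C(1) by (simp add: abs_divide)
    qed
  qed
  then show ?thesis by (rule \<tau>.integrable_const_bound) measurable
qed

text \<open>\<open>\<bar>\<phi>\<bar>\<close> need not be smooth, so the weak form is applied to
  smooth regularisations, which are dominated by \<open>\<bar>\<phi>\<bar>\<close> and have no
  larger energy. The weighted integral of \<open>\<bar>\<phi>\<bar> / u\<close> is thereby
  controlled by the Sobolev seminorm of \<open>\<phi>\<close>.\<close>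

lemma test_abs_le:
  assumes \<phi>: "\<phi> \<in> test_functions \<Omega>" and d: "d > 0"
  shows "c * (\<integral>x. \<bar>\<phi> x\<bar> / u x \<partial>\<tau>) \<le> d * energy u + (1 / d) powr (p - 1) * energy \<phi>"
proof -
  note [measurable] = test_functions_measurable[OF \<phi>]
  have \<phi>W: "\<phi> \<in> W0sp s p \<Omega>" by (rule test_functions_W0sp[OF \<phi>])
  define e where "e n = inverse (real (Suc n))" for n
  have e: "e n > 0" for n by (simp add: e_def)
  have e0: "e \<longlonglongrightarrow> 0" unfolding e_def by (rule LIMSEQ_inverse_real_of_nat)
  define \<psi> where "\<psi> n x = sqrt ((\<phi> x - 0)\<^sup>2 + (e n)\<^sup>2) - sqrt (0\<^sup>2 + (e n)\<^sup>2)" for n x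
  have \<psi>: "\<psi> n \<in> test_functions \<Omega>" for n
    unfolding \<psi>_def[abs_def] by (rule test_functions_sqrt[OF \<phi> e])
  have \<psi>W: "\<psi> n \<in> W0sp s p \<Omega>" for n by (rule test_functions_W0sp[OF \<psi>])
  have [measurable]: "\<psi> n \<in> borel_measurable lebesgue" for n by (rule test_functions_measurable[OF \<psi>])
  have \<psi>_le: "\<bar>\<psi> n x\<bar> \<le> \<bar>\<phi> x\<bar>" for n x
    using sqrt_shift_lipschitz[of "\<phi> x" 0 "e n" 0] by (simp add: \<psi>_def)
  have "G (\<psi> n) \<le> G \<phi>" for n
  proof (rule gagliardo_integral_mono[OF p0])
    show "\<bar>\<psi> n x - \<psi> n y\<bar> \<le> \<bar>\<phi> x - \<phi> y\<bar>" for x y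
      using sqrt_shift_lipschitz[of "\<phi> x" 0 "e n" "\<phi> y"] by (simp add: \<psi>_def)
  qed measurable
  then have en: "energy (\<psi> n) \<le> energy \<phi>" for n
    unfolding energy_def using W0sp_finite[OF \<phi>W] by (intro enn2real_mono) auto
  have le: "c * (\<integral>x. \<psi> n x / u x \<partial>\<tau>) \<le> d * energy u + (1 / d) powr (p - 1) * energy \<phi>" for n
  proof -
    have "c * (\<integral>x. \<psi> n x / u x \<partial>\<tau>) = P u (\<psi> n)" by (rule weak_form[OF \<psi>, symmetric])
    also have "\<dots> \<le> d * energy u + (1 / d) powr (p - 1) * energy (\<psi> n)"
      using pairing_le_delta[OF u \<psi>W d] by (rule order_trans[OF abs_ge_self])
    also have "\<dots> \<le> d * energy u + (1 / d) powr (p - 1) * energy \<phi>"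
      using en by (intro add_left_mono mult_left_mono) auto
    finally show ?thesis .
  qed
  have "(\<lambda>n. \<integral>x. \<psi> n x / u x \<partial>\<tau>) \<longlonglongrightarrow> (\<integral>x. \<bar>\<phi> x\<bar> / u x \<partial>\<tau>)"
  proof (rule integral_dominated_convergence[where w="\<lambda>x. \<bar>\<phi> x / u x\<bar>"])
    show "integrable \<tau> (\<lambda>x. \<bar>\<phi> x / u x\<bar>)" by (intro integrable_abs test_integrable \<phi>)
    show "AE x in \<tau>. (\<lambda>n. \<psi> n x / u x) \<longlonglongrightarrow> \<bar>\<phi> x\<bar> / u x"
      using u_pos_\<tau>
    proof eventually_elim
      case (elim x)
      have "(\<lambda>n. \<psi> n x / u x) \<longlonglongrightarrow> (sqrt ((\<phi> x - 0)\<^sup>2 + 0\<^sup>2) - sqrt (0\<^sup>2 + 0\<^sup>2)) / u x"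
        unfolding \<psi>_def using elim by (intro tendsto_intros e0) auto
      then show ?case by simp
    qed
    show "AE x in \<tau>. norm (\<psi> n x / u x) \<le> \<bar>\<phi> x / u x\<bar>" for n
      using \<psi>_le by (auto simp: abs_divide intro!: divide_right_mono)
  qed measurable
  then have "(\<lambda>n. c * (\<integral>x. \<psi> n x / u x \<partial>\<tau>)) \<longlonglongrightarrow> c * (\<integral>x. \<bar>\<phi> x\<bar> / u x \<partial>\<tau>)"
    by (rule tendsto_mult_left)
  then show ?thesis using le by (intro LIMSEQ_le_const2) auto
qed

text \<open>
  The preceding estimate shows that test functions converging in the Sobolev space converge in
  \<open>L\<^sup>1\<close> with weight \<open>\<omega> / u\<close>, so the weak formulation extends to the closure.
\<close>

lemma weak_form_extended:
  assumes w: "w \<in> W0sp s p \<Omega>"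
  shows "integrable \<tau> (\<lambda>x. w x / u x)" "P u w = c * (\<integral>x. w x / u x \<partial>\<tau>)"
proof -
  note [measurable] = W0sp_measurable[OF w]
  obtain \<phi> where \<phi>: "\<And>n::nat. \<phi> n \<in> test_functions \<Omega>"
    "\<And>n. G (\<lambda>x. \<phi> n x - w x) \<le> ennreal ((1/2) ^ n)" "AE x in lebesgue. (\<lambda>n. \<phi> n x) \<longlonglongrightarrow> w x"
    using W0sp_rapid_sequence[OF w] by blast
  have \<phi>m [measurable]: "\<phi> n \<in> borel_measurable lebesgue" for n by (rule test_functions_measurable[OF \<phi>(1)])
  have \<phi>W: "\<phi> n \<in> W0sp s p \<Omega>" for n by (rule test_functions_W0sp[OF \<phi>(1)])
  have e1: "energy (\<lambda>x. \<phi> n x - w x) \<le> (1/2) ^ n" for n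
    unfolding energy_def using enn2real_mono[OF \<phi>(2)[of n]] by simp
  \<comment> \<open>Differences of two approximants are test functions, to which
    \<open>test_abs_le\<close> applies; \<open>\<phi> n - w\<close> is reached afterwards by Fatou
    as \<open>m\<close> tends to infinity.\<close>
  have e2: "energy (\<lambda>x. \<phi> n x - \<phi> (m + n) x) \<le> 2 powr p * (2 * (1/2) ^ n)" for n m
  proof -
    have "G (\<lambda>x. \<phi> n x - \<phi> (m + n) x) = G (\<lambda>x. (\<phi> n x - w x) + (w x - \<phi> (m + n) x))" by simp
    also have "\<dots> \<le> ennreal (2 powr p) * (G (\<lambda>x. \<phi> n x - w x) + G (\<lambda>x. w x - \<phi> (m + n) x))"
      by (rule gagliardo_integral_add_le[OF p0]) measurable
    also have "G (\<lambda>x. w x - \<phi> (m + n) x) = G (\<lambda>x. \<phi> (m + n) x - w x)"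
      by (rule gagliardo_integral_diff_swap) measurable
    also have "ennreal (2 powr p) * (G (\<lambda>x. \<phi> n x - w x) + G (\<lambda>x. \<phi> (m + n) x - w x))
        \<le> ennreal (2 powr p) * (ennreal ((1/2) ^ n) + ennreal ((1/2) ^ (m + n)))"
      by (intro mult_left_mono add_mono \<phi>(2)) simp
    also have "\<dots> \<le> ennreal (2 powr p) * (ennreal ((1/2) ^ n) + ennreal ((1/2) ^ n))"
      by (intro mult_left_mono add_left_mono ennreal_leI power_decreasing) auto
    also have "\<dots> = ennreal (2 powr p * (2 * (1/2) ^ n))"
      by (simp add: ennreal_plus[symmetric] ennreal_mult'[symmetric] del: ennreal_plus)
    finally show ?thesis
      unfolding energy_def using enn2real_mono[of _ "ennreal (2 powr p * (2 * (1/2) ^ n))"] by fastforce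
  qed
  \<comment> \<open>A common bound for both errors, that of the pairing and that of the singular
    integral. First \<open>n\<close> tends to infinity, which removes the second term, then
    \<open>d\<close> tends to \<open>0\<close>.\<close>
  define b where "b d n = d * energy u + (1 / d) powr (p - 1) * (2 powr p * (2 * (1/2) ^ n))" for d :: real and n :: nat
  have b0: "b d n \<ge> 0" if "d > 0" for d n
    unfolding b_def using that energy_nonneg[of u] by simp
  have nnb: "(\<integral>\<^sup>+x. ennreal (\<bar>\<phi> n x - w x\<bar> / u x) \<partial>\<tau>) \<le> ennreal (b d n / c)" if d: "d > 0" for d n
  proof -
    have t: "(\<lambda>x. \<phi> n x - \<phi> (m + n) x) \<in> test_functions \<Omega>" for m
      by (rule test_functions_diff[OF \<phi>(1) \<phi>(1)])
    have one: "(\<integral>\<^sup>+x. ennreal (\<bar>\<phi> n x - \<phi> (m + n) x\<bar> / u x) \<partial>\<tau>) \<le> ennreal (b d n / c)" for m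
    proof -
      have "integrable \<tau> (\<lambda>x. \<bar>(\<phi> n x - \<phi> (m + n) x) / u x\<bar>)" by (intro integrable_abs test_integrable t)
      then have i: "integrable \<tau> (\<lambda>x. \<bar>\<phi> n x - \<phi> (m + n) x\<bar> / u x)"
        by (rule integrable_cong_AE_imp) (use u_pos_\<tau> in \<open>auto simp: abs_divide elim: eventually_mono\<close>)
      have "c * (\<integral>x. \<bar>\<phi> n x - \<phi> (m + n) x\<bar> / u x \<partial>\<tau>)
          \<le> d * energy u + (1 / d) powr (p - 1) * energy (\<lambda>x. \<phi> n x - \<phi> (m + n) x)"
        by (rule test_abs_le[OF t d])
      also have "\<dots> \<le> b d n" unfolding b_def by (intro add_left_mono mult_left_mono e2) simp
      finally have "(\<integral>x. \<bar>\<phi> n x - \<phi> (m + n) x\<bar> / u x \<partial>\<tau>) \<le> b d n / c"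
        using c by (simp add: pos_le_divide_eq mult.commute)
      moreover have "AE x in \<tau>. 0 \<le> \<bar>\<phi> n x - \<phi> (m + n) x\<bar> / u x" using u_pos_\<tau> by eventually_elim simp
      ultimately show ?thesis by (simp add: nn_integral_eq_integral[OF i] ennreal_leI)
    qed
    have "(\<integral>\<^sup>+x. ennreal (\<bar>\<phi> n x - w x\<bar> / u x) \<partial>\<tau>)
        = (\<integral>\<^sup>+x. liminf (\<lambda>m. ennreal (\<bar>\<phi> n x - \<phi> (m + n) x\<bar> / u x)) \<partial>\<tau>)"
    proof (rule nn_integral_cong_AE)
      show "AE x in \<tau>. ennreal (\<bar>\<phi> n x - w x\<bar> / u x) = liminf (\<lambda>m. ennreal (\<bar>\<phi> n x - \<phi> (m + n) x\<bar> / u x))"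
        using AE_\<tau>[OF \<phi>(3)] u_pos_\<tau>
      proof eventually_elim
        case (elim x)
        have "(\<lambda>m. \<phi> (m + n) x) \<longlonglongrightarrow> w x" by (rule LIMSEQ_ignore_initial_segment[OF elim(1)])
        then have "(\<lambda>m. ennreal (\<bar>\<phi> n x - \<phi> (m + n) x\<bar> / u x)) \<longlonglongrightarrow> ennreal (\<bar>\<phi> n x - w x\<bar> / u x)"
          using elim(2) by (intro tendsto_ennrealI tendsto_intros) auto
        then show ?case by (rule lim_imp_Liminf[OF sequentially_bot, symmetric])
      qed
    qed
    also have "\<dots> \<le> liminf (\<lambda>m. \<integral>\<^sup>+x. ennreal (\<bar>\<phi> n x - \<phi> (m + n) x\<bar> / u x) \<partial>\<tau>)"
      by (rule nn_integral_liminf) measurable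
    also have "\<dots> \<le> liminf (\<lambda>m::nat. ennreal (b d n / c))"
      by (intro Liminf_mono always_eventually allI one)
    also have "\<dots> = ennreal (b d n / c)" by (simp add: Liminf_const)
    finally show ?thesis .
  qed
  have di: "integrable \<tau> (\<lambda>x. (\<phi> n x - w x) / u x)" for n
  proof (rule integrableI_bounded)
    have "(\<integral>\<^sup>+x. ennreal (norm ((\<phi> n x - w x) / u x)) \<partial>\<tau>) = (\<integral>\<^sup>+x. ennreal (\<bar>\<phi> n x - w x\<bar> / u x) \<partial>\<tau>)"
      by (rule nn_integral_cong_AE) (use u_pos_\<tau> in \<open>auto simp: abs_divide elim: eventually_mono\<close>)
    also have "\<dots> < \<infinity>" by (rule order_le_less_trans[OF nnb[of 1]]) auto
    finally show "(\<integral>\<^sup>+x. ennreal (norm ((\<phi> n x - w x) / u x)) \<partial>\<tau>) < \<infinity>" .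
  qed measurable
  have "integrable \<tau> (\<lambda>x. \<phi> 0 x / u x - (\<phi> 0 x - w x) / u x)"
    by (intro Bochner_Integration.integrable_diff test_integrable \<phi>(1) di)
  then show wi: "integrable \<tau> (\<lambda>x. w x / u x)" by (simp add: diff_divide_distrib)
  define X where "X = \<bar>P u w - c * (\<integral>x. w x / u x \<partial>\<tau>)\<bar>"
  have X: "X \<le> 2 * b d n" if d: "d > 0" for d n
  proof -
    have "\<bar>\<integral>x. (\<phi> n x - w x) / u x \<partial>\<tau>\<bar> \<le> (\<integral>x. \<bar>(\<phi> n x - w x) / u x\<bar> \<partial>\<tau>)"
      by (rule integral_abs_bound)
    also have "\<dots> = (\<integral>x. \<bar>\<phi> n x - w x\<bar> / u x \<partial>\<tau>)"
      by (rule integral_cong_AE) (use u_pos_\<tau> in \<open>auto simp: abs_divide elim: eventually_mono\<close>)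
    also have "\<dots> \<le> b d n / c"
    proof -
      have "integrable \<tau> (\<lambda>x. \<bar>(\<phi> n x - w x) / u x\<bar>)" by (intro integrable_abs di)
      then have i: "integrable \<tau> (\<lambda>x. \<bar>\<phi> n x - w x\<bar> / u x)"
        by (rule integrable_cong_AE_imp) (use u_pos_\<tau> in \<open>auto simp: abs_divide elim: eventually_mono\<close>)
      have "AE x in \<tau>. 0 \<le> \<bar>\<phi> n x - w x\<bar> / u x" using u_pos_\<tau> by eventually_elim simp
      then have "ennreal (\<integral>x. \<bar>\<phi> n x - w x\<bar> / u x \<partial>\<tau>) \<le> ennreal (b d n / c)"
        using nnb[OF d, of n] by (simp add: nn_integral_eq_integral[OF i])
      then show ?thesis using b0[OF d, of n] c by (subst (asm) ennreal_le_iff) auto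
    qed
    finally have 1: "c * \<bar>\<integral>x. (\<phi> n x - w x) / u x \<partial>\<tau>\<bar> \<le> b d n"
      using c by (simp add: pos_le_divide_eq mult.commute)
    have "\<bar>P u (\<lambda>x. \<phi> n x - w x)\<bar> \<le> d * energy u + (1 / d) powr (p - 1) * energy (\<lambda>x. \<phi> n x - w x)"
      by (rule pairing_le_delta[OF u W0sp_diff[OF \<phi>W w] d])
    also have "\<dots> \<le> b d n"
    proof -
      have "1 * (1/2) ^ n \<le> (2 powr p * 2) * (1/2::real) ^ n"
        using p ge_one_powr_ge_zero[of 2 p] by (intro mult_right_mono) auto
      then have "energy (\<lambda>x. \<phi> n x - w x) \<le> 2 powr p * (2 * (1/2) ^ n)"
        unfolding mult_1_left mult.assoc by (rule order_trans[OF e1])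
      then show ?thesis unfolding b_def by (intro add_left_mono mult_left_mono) auto
    qed
    finally have 2: "\<bar>P u (\<lambda>x. \<phi> n x - w x)\<bar> \<le> b d n" .
    have "(\<integral>x. (\<phi> n x - w x) / u x \<partial>\<tau>) = (\<integral>x. \<phi> n x / u x \<partial>\<tau>) - (\<integral>x. w x / u x \<partial>\<tau>)"
      unfolding diff_divide_distrib by (rule Bochner_Integration.integral_diff[OF test_integrable[OF \<phi>(1)] wi])
    then have "P u w - c * (\<integral>x. w x / u x \<partial>\<tau>)
        = c * (\<integral>x. (\<phi> n x - w x) / u x \<partial>\<tau>) - P u (\<lambda>x. \<phi> n x - w x)"
      using pairing_diff[OF u \<phi>W w, of n] weak_form[OF \<phi>(1), of n] by (simp add: right_diff_distrib)
    then have "X \<le> \<bar>c * (\<integral>x. (\<phi> n x - w x) / u x \<partial>\<tau>)\<bar> + \<bar>P u (\<lambda>x. \<phi> n x - w x)\<bar>"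
      unfolding X_def by (simp only: abs_triangle_ineq4)
    then show ?thesis using 1 2 c by (simp add: abs_mult)
  qed
  have X2: "X \<le> 2 * (d * energy u)" if d: "d > 0" for d
  proof -
    have "(\<lambda>n. 2 * b d n) \<longlonglongrightarrow> 2 * (d * energy u + (1 / d) powr (p - 1) * (2 powr p * (2 * 0)))"
      unfolding b_def by (intro tendsto_intros LIMSEQ_power_zero) auto
    then have lim: "(\<lambda>n. 2 * b d n) \<longlonglongrightarrow> 2 * (d * energy u)" by simp
    show ?thesis by (rule LIMSEQ_le_const[OF lim]) (use X[OF d] in simp)
  qed
  have "X \<le> 0"
  proof (rule field_le_epsilon)
    fix \<epsilon> :: real assume \<epsilon>: "\<epsilon> > 0"
    \<comment> \<open>The added \<open>1\<close> covers the case of zero energy.\<close>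
    define d where "d = \<epsilon> / (2 * (energy u + 1))"
    have d: "d > 0" using \<epsilon> energy_nonneg[of u] by (simp add: d_def)
    have "2 * (d * energy u) \<le> 2 * (d * (energy u + 1))" using d by simp
    also have "\<dots> = \<epsilon>" using energy_nonneg[of u] by (simp add: d_def field_simps)
    finally show "X \<le> 0 + \<epsilon>" using X2[OF d] by simp
  qed
  then show "P u w = c * (\<integral>x. w x / u x \<partial>\<tau>)" by (simp add: X_def)
qed

end

context weighted_frac_sobolev
begin

text \<open>The map \<open>t \<mapsto> 1 / t\<close> is decreasing, so tested with
  \<open>u - v\<close> the singular right-hand sides are ordered against the monotone operator, and
  both inequalities can hold only if the functions agree.\<close>

lemma singular_weak_solution_unique:
  assumes "singular_weak_solution s p \<Omega> \<omega> r u c" "singular_weak_solution s p \<Omega> \<omega> r v c"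
  shows "AE x in lebesgue. u x = v x"
proof -
  interpret u: singular_weak_solution s p \<Omega> \<omega> r u c by (rule assms(1))
  interpret v: singular_weak_solution s p \<Omega> \<omega> r v c by (rule assms(2))
  have w: "(\<lambda>x. u x - v x) \<in> W0sp s p \<Omega>" by (rule W0sp_diff[OF u.u v.u])
  have "(\<integral>x. (u x - v x) / u x \<partial>\<tau>) \<le> (\<integral>x. (u x - v x) / v x \<partial>\<tau>)"
  proof (rule integral_mono_AE[OF u.weak_form_extended(1)[OF w] v.weak_form_extended(1)[OF w]])
    show "AE x in \<tau>. (u x - v x) / u x \<le> (u x - v x) / v x"
      using u.u_pos_\<tau> v.u_pos_\<tau>
    proof eventually_elim
      case (elim x)
      have "0 \<le> (u x - v x) * (u x - v x)" by simp
      then show ?case using elim by (simp add: divide_le_eq pos_le_divide_eq divide_simps algebra_simps)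
    qed
  qed
  then have "P u (\<lambda>x. u x - v x) \<le> P v (\<lambda>x. u x - v x)"
    unfolding u.weak_form_extended(2)[OF w] v.weak_form_extended(2)[OF w]
    using u.c by (intro mult_left_mono) auto
  then show ?thesis by (rule pairing_monotone[OF u.u v.u])
qed

lemma singular_weak_solution_iff:
  assumes "\<mu> > 0"
  shows "weak_solution s p \<Omega> \<omega> \<mu> u \<longleftrightarrow> singular_weak_solution s p \<Omega> \<omega> r u (\<mu> / W)"
proof (cases "u \<in> W0sp s p \<Omega>")
  case True
  have pos: "\<mu> / W > 0" using assms W_pos by simp
  have "weighted_frac_sobolev s p \<Omega> \<omega> r" by unfold_locales
  then show ?thesis
    unfolding weak_solution_iff[OF True] singular_weak_solution_def singular_weak_solution_axioms_def
    using True pos by auto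
next
  case False
  then show ?thesis
    by (auto simp: weak_solution_def singular_weak_solution_def singular_weak_solution_axioms_def)
qed

end

section \<open>The minimizer as a weak solution\<close>

context log_minimizer
begin

lemma V_not_0: "\<not> (AE x in lebesgue. V x = 0)"
proof
  assume "AE x in lebesgue. V x = 0"
  note AE_frac_measure_fst[OF this] AE_frac_measure_snd[OF this]
  then have "AE z in \<nu>. incr V z = 0" by eventually_elim (simp add: incr_def)
  then have "E = (\<integral>z. 0 \<partial>\<nu>)"
    unfolding energy_eq[OF V_W0sp] by (intro integral_cong_AE) (auto elim: eventually_mono)
  then show False using E_pos by simp
qed

lemma V_lower_bound:
  assumes "compact K" "K \<subseteq> \<Omega>"
  shows "\<exists>C>0. AE x in lebesgue. x \<in> K \<longrightarrow> V x \<ge> C"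
  by (rule minimum_principle[OF V_W0sp V_nonneg V_not_0 _ assms]) (rule pairing_nonneg)

text \<open>On the support of a test function \<open>V\<close> is at least some
  \<open>C > 0\<close>, so the function is bounded by \<open>M / C * V\<close> and qualifies for the
  Euler-Lagrange equality.\<close>

lemma V_weak_solution: "weak_solution s p \<Omega> \<omega> E V"
  unfolding weak_solution_iff[OF V_W0sp]
proof (intro conjI allI impI ballI)
  fix K assume K: "compact K \<and> K \<subseteq> \<Omega>"
  show "\<exists>C>0. AE x in lebesgue. x \<in> K \<longrightarrow> V x \<ge> C"
    using K by (intro V_lower_bound) auto
next
  fix \<phi> assume \<phi>: "\<phi> \<in> test_functions \<Omega>"
  obtain K where K: "compact K" "K \<subseteq> \<Omega>" "\<forall>x. \<phi> x \<noteq> 0 \<longrightarrow> x \<in> K" using test_functionsE[OF \<phi>] by blast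
  obtain C where C: "C > 0" "AE x in lebesgue. x \<in> K \<longrightarrow> V x \<ge> C"
    using V_lower_bound[OF K(1,2)] by (elim exE conjE)
  obtain M where M: "M > 0" "\<And>x. \<bar>\<phi> x\<bar> \<le> M" using test_functions_bounded[OF \<phi>] by blast
  have "AE x in lebesgue. \<bar>\<phi> x\<bar> \<le> M / C * V x"
    using C(2) V_nonneg
  proof eventually_elim
    case (elim x)
    show ?case
    proof (cases "\<phi> x = 0")
      case True
      then show ?thesis using elim M(1) C(1) by simp
    next
      case False
      then have "C \<le> V x" using elim K(3) by blast
      then have "M / C * C \<le> M / C * V x" using M(1) C(1) by (intro mult_left_mono) auto
      then show ?thesis using M(2)[of x] C(1) by simp
    qed
  qed
  then show "P V \<phi> = E / W * (\<integral>x. \<phi> x / V x \<partial>\<tau>)"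
    by (rule Euler_Lagrange_eq[OF test_functions_W0sp[OF \<phi>]])
qed

end

theorem proposition4p0p7:
  fixes \<Omega> :: "'a::euclidean_space set"
    and s p r \<mu> :: real
    and \<omega> V :: "'a \<Rightarrow> real"
  assumes "DIM('a) \<ge> 2"
    and "smooth_bounded_domain \<Omega>"
    and "0 < s" and "s < 1" and "1 < p"
    and "r > max 1 (real DIM('a) / (s * p))"
    and "\<omega> \<in> Lp_space r \<Omega>"
    and "AE x\<in>\<Omega> in lebesgue. \<omega> x \<ge> 0"
    and "\<not> (AE x\<in>\<Omega> in lebesgue. \<omega> x = 0)"
    and "((\<lambda>\<alpha>. lam s p \<Omega> \<omega> \<alpha> * Lp_norm 1 \<Omega> \<omega> powr (p / (1 - \<alpha>))) \<longlongrightarrow> \<mu>) (at_left 1)"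
    and "V \<in> log_constraint s p \<Omega> \<omega>"
    and "AE x in lebesgue. V x \<ge> 0"
    and "\<And>v. v \<in> log_constraint s p \<Omega> \<omega> \<Longrightarrow> gagliardo s p V powr p \<le> gagliardo s p v powr p"
  shows "weak_solution s p \<Omega> \<omega> \<mu> V \<and>
         (\<forall>u. weak_solution s p \<Omega> \<omega> \<mu> u \<longrightarrow> (AE x in lebesgue. u x = V x))"
proof -
  interpret log_minimizer s p \<Omega> \<omega> r V
    using assms by unfold_locales (auto simp: smooth_bounded_domain_def domain_def)
  have \<mu>: "\<mu> = E" by (rule lam_limit) (use assms(10) in \<open>simp only: W_eq\<close>)
  have V: "weak_solution s p \<Omega> \<omega> \<mu> V" unfolding \<mu> by (rule V_weak_solution)
  \<comment> \<open>Positivity of the energy makes \<open>E / W\<close> a positive constant, as the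
    uniqueness argument requires.\<close>
  moreover have "AE x in lebesgue. u x = V x" if "weak_solution s p \<Omega> \<omega> \<mu> u" for u
    using that V E_pos unfolding \<mu> singular_weak_solution_iff[OF E_pos]
    by (intro singular_weak_solution_unique)
  ultimately show ?thesis by blast
qed

end
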